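(* Let $(R,\mathfrak m,k)$ be a regular local ring (respectively, a standard graded polynomial ring over a field $k$ with homogeneous maximal ideal $\mathfrak m$), and let $I$ be a proper ideal of $R$ (homogeneous in the graded case) with $\operatorname{grade}(I)\ge 4$. Then there exists an ideal $J\subseteq I$ (homogeneous in the graded case) such that $R/IJ$ is not a Golod ring.
   Context: Let $(A,\mathfrak n,k)$ be a local ring, or a standard graded $k$-algebra with homogeneous maximal ideal $\mathfrak n$. Let $K^A$ be the Koszul complex over $A$ on a minimal set of generators of $\mathfrak n$; it is a DG-algebra with $H_0(K^A)\cong k$. For a homogeneous element $a$ of a DG-algebra put $\overline a:=(-1)^{|a|+1}a$, where $|a|$ is the homological degree. A DG-algebra $B$ with $H_0(B)\cong k$ admits a trivial Massey operation if for some homogeneous $k$-basis $\mathcal B=\{h_\lambda\}_{\lambda\in\Lambda}$ of $H_{\ge 1}(B)$ there is a function $\mu:\coprod_{i=1}^\infty \mathcal B^i\to B$ such that $\mu(h_\lambda)=z_\lambda$ is a cycle with homology class $[z_\lambda]=h_\lambda$, and $d\mu(h_{\lambda_1},\dots,h_{\lambda_p})=\sum_{j=1}^{p-1}\overline{\mu(h_{\lambda_1},\dots,h_{\lambda_j})}\,\mu(h_{\lambda_{j+1}},\dots,h_{\lambda_p})$ for all $p\ge 2$. The ring $A$ is called Golod if $K^A$ admits a trivial Massey operation. *)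

theory Defs
  imports
    "HOL-Algebra.Algebra"
    "HOL-Algebra.Algebraic_Closure_Type"
    "HOL-Library.Poly_Mapping"
    "HOL-Library.Extended_Nat"
begin

section \<open>DG-algebras and trivial Massey operations\<close>

record 'a dg_algebra = "'a ring" +
  differential :: "'a \<Rightarrow> 'a"
  graded_part :: "nat \<Rightarrow> 'a set"

definition cycles :: "('a, 'm) dg_algebra_scheme \<Rightarrow> 'a set" where
  "cycles B = {z \<in> carrier B. differential B z = \<zero>\<^bsub>B\<^esub>}"

definition boundaries :: "('a, 'm) dg_algebra_scheme \<Rightarrow> 'a set" where
  "boundaries B = differential B ` carrier B"

definition homology :: "('a, 'm) dg_algebra_scheme \<Rightarrow> 'a set ring" where
  "homology B = B\<lparr>carrier := cycles B\<rparr> Quot boundaries B"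

definition homology_class :: "('a, 'm) dg_algebra_scheme \<Rightarrow> 'a \<Rightarrow> 'a set" where
  "homology_class B z = boundaries B +>\<^bsub>B\<^esub> z"

definition homology_part :: "('a, 'm) dg_algebra_scheme \<Rightarrow> nat \<Rightarrow> 'a set set" where
  "homology_part B i = homology_class B ` (cycles B \<inter> graded_part B i)"

definition homology_pos :: "('a, 'm) dg_algebra_scheme \<Rightarrow> 'a set set" where
  "homology_pos B = generate (add_monoid (homology B)) (\<Union>i\<in>{1..}. homology_part B i)"

text \<open>Bases of a possibly infinite-dimensional subspace \<open>V\<close> of \<open>R\<close> over a subfield \<open>K\<close>, in terms
  of the list-based notions of \<^theory>\<open>HOL-Algebra.Embedded_Algebras\<close>.\<close>

definition is_basis :: "('a, 'm) ring_scheme \<Rightarrow> 'a set \<Rightarrow> 'a set \<Rightarrow> 'a set \<Rightarrow> bool" where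
  "is_basis R K V S \<longleftrightarrow> S \<subseteq> V
     \<and> (\<forall>us. distinct us \<and> set us \<subseteq> S \<longrightarrow> ring.independent R K us)
     \<and> (\<forall>v\<in>V. \<exists>us. set us \<subseteq> S \<and> v \<in> ring.Span R K us)"

text \<open>The residue field \<open>k\<close> is realised as the subfield \<open>H\<^sub>0(B)\<close> of the ring \<open>H(B)\<close>.\<close>

definition homogeneous_basis :: "('a, 'm) dg_algebra_scheme \<Rightarrow> 'a set set \<Rightarrow> bool" where
  "homogeneous_basis B S \<longleftrightarrow> S \<subseteq> (\<Union>i\<in>{1..}. homology_part B i)
     \<and> is_basis (homology B) (homology_part B 0) (homology_pos B) S"

text \<open>Only meaningful for homogeneous \<open>a\<close>. The degree of a nonzero homogeneous element is unique;
  for \<open>a = \<zero>\<close> the value chosen by \<open>LEAST\<close> does not matter.\<close>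

definition bar :: "('a, 'm) dg_algebra_scheme \<Rightarrow> 'a \<Rightarrow> 'a" where
  "bar B a = (\<ominus>\<^bsub>B\<^esub> \<one>\<^bsub>B\<^esub>) [^]\<^bsub>B\<^esub> ((LEAST i. a \<in> graded_part B i) + 1) \<otimes>\<^bsub>B\<^esub> a"

text \<open>Words \<open>(h\<^sub>1, \<dots>, h\<^sub>p)\<close>, \<open>p \<ge> 1\<close>, are nonempty lists. The values of \<open>\<mu>\<close> have to be homogeneous
  for \<^const>\<open>bar\<close> to apply to them.\<close>

definition trivial_massey_operation ::
  "('a, 'm) dg_algebra_scheme \<Rightarrow> 'a set set \<Rightarrow> ('a set list \<Rightarrow> 'a) \<Rightarrow> bool" where
  "trivial_massey_operation B S \<mu> \<longleftrightarrow>
     (\<forall>hs. hs \<noteq> [] \<and> set hs \<subseteq> S \<longrightarrow> \<mu> hs \<in> (\<Union>i. graded_part B i))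
   \<and> (\<forall>h\<in>S. \<mu> [h] \<in> cycles B \<and> homology_class B (\<mu> [h]) = h)
   \<and> (\<forall>hs. 2 \<le> length hs \<and> set hs \<subseteq> S \<longrightarrow>
        differential B (\<mu> hs) =
          (\<Oplus>\<^bsub>B\<^esub>j\<in>{1..length hs - 1}. bar B (\<mu> (take j hs)) \<otimes>\<^bsub>B\<^esub> \<mu> (drop j hs)))"

definition admits_trivial_massey_operation :: "('a, 'm) dg_algebra_scheme \<Rightarrow> bool" where
  "admits_trivial_massey_operation B \<longleftrightarrow>
     (\<exists>S \<mu>. homogeneous_basis B S \<and> trivial_massey_operation B S \<mu>)"


section \<open>Koszul complexes\<close>

text \<open>The Koszul complex on \<open>x\<^sub>0, \<dots>, x\<^bsub>n-1\<^esub>\<close> is the exterior algebra on \<open>e\<^sub>0, \<dots>, e\<^bsub>n-1\<^esub>\<close> with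
  \<open>d e\<^sub>i = x\<^sub>i\<close>. The function \<open>f\<close> stands for \<open>\<Sum> f(S) e\<^sub>S\<close>, where \<open>S\<close> runs over the subsets of
  \<open>{0..<n}\<close> and \<open>e\<^sub>S\<close> is the product of the \<open>e\<^sub>i\<close>, \<open>i \<in> S\<close>, in increasing order. Hence
  \<open>e\<^sub>T e\<^sub>U = \<plusminus>e\<^bsub>T \<union> U\<^esub>\<close> for disjoint \<open>T, U\<close>, with sign given by the number of inversions, and
  \<open>d e\<^sub>T = \<Sum> \<plusminus>x\<^sub>i e\<^bsub>T - {i}\<^esub>\<close> over \<open>i \<in> T\<close>, with sign given by the position of \<open>i\<close> in \<open>T\<close>.\<close>

definition koszul :: "('a, 'm) ring_scheme \<Rightarrow> 'a list \<Rightarrow> (nat set \<Rightarrow> 'a) dg_algebra" where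
  "koszul A xs = (let P = Pow {..<length xs} in
     \<lparr> carrier = P \<rightarrow>\<^sub>E carrier A,
       monoid.mult = (\<lambda>f g. \<lambda>S\<in>P. \<Oplus>\<^bsub>A\<^esub>T\<in>Pow S.
                 (\<ominus>\<^bsub>A\<^esub> \<one>\<^bsub>A\<^esub>) [^]\<^bsub>A\<^esub> card {(t, u). t \<in> T \<and> u \<in> S - T \<and> u < t}
                   \<otimes>\<^bsub>A\<^esub> (f T \<otimes>\<^bsub>A\<^esub> g (S - T))),
       monoid.one = (\<lambda>S\<in>P. if S = {} then \<one>\<^bsub>A\<^esub> else \<zero>\<^bsub>A\<^esub>),
       ring.zero = (\<lambda>S\<in>P. \<zero>\<^bsub>A\<^esub>),
       ring.add = (\<lambda>f g. \<lambda>S\<in>P. f S \<oplus>\<^bsub>A\<^esub> g S),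
       differential = (\<lambda>f. \<lambda>S\<in>P. \<Oplus>\<^bsub>A\<^esub>i\<in>{..<length xs} - S.
                 (\<ominus>\<^bsub>A\<^esub> \<one>\<^bsub>A\<^esub>) [^]\<^bsub>A\<^esub> card {j \<in> S. j < i} \<otimes>\<^bsub>A\<^esub> (xs ! i \<otimes>\<^bsub>A\<^esub> f (insert i S))),
       graded_part = (\<lambda>i. {f \<in> P \<rightarrow>\<^sub>E carrier A. \<forall>S\<in>P. card S \<noteq> i \<longrightarrow> f S = \<zero>\<^bsub>A\<^esub>}) \<rparr>)"


section \<open>Golod rings\<close>

definition minimal_generators :: "('a, 'm) ring_scheme \<Rightarrow> 'a set \<Rightarrow> 'a list \<Rightarrow> bool" where
  "minimal_generators A I xs \<longleftrightarrow> distinct xs \<and> set xs \<subseteq> carrier A \<and> Idl\<^bsub>A\<^esub> (set xs) = I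
     \<and> (\<forall>T. T \<subset> set xs \<longrightarrow> Idl\<^bsub>A\<^esub> T \<noteq> I)"

text \<open>For a local ring \<open>A\<close> with maximal ideal \<open>\<nn>\<close>. The Koszul complex does not depend, up to
  isomorphism, on the choice of the minimal generators.\<close>

definition golod_local :: "('a, 'm) ring_scheme \<Rightarrow> 'a set \<Rightarrow> bool" where
  "golod_local A \<nn> \<longleftrightarrow>
     (\<exists>xs. minimal_generators A \<nn> xs \<and> admits_trivial_massey_operation (koszul A xs))"

text \<open>For a standard graded algebra \<open>A\<close> with graded components \<open>G i\<close>. Minimal generators are taken
  homogeneous: in a non-local ring, irredundant inhomogeneous generating sets can differ in size.\<close>

definition irrelevant_ideal :: "('a, 'm) ring_scheme \<Rightarrow> (nat \<Rightarrow> 'a set) \<Rightarrow> 'a set" where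
  "irrelevant_ideal A G = Idl\<^bsub>A\<^esub> (\<Union>i\<in>{1..}. G i)"

definition golod_graded :: "('a, 'm) ring_scheme \<Rightarrow> (nat \<Rightarrow> 'a set) \<Rightarrow> bool" where
  "golod_graded A G \<longleftrightarrow>
     (\<exists>xs. minimal_generators A (irrelevant_ideal A G) xs \<and> set xs \<subseteq> (\<Union>i. G i)
        \<and> admits_trivial_massey_operation (koszul A xs))"


section \<open>Grade, dimension and regular local rings\<close>

definition regular_sequence :: "('a, 'm) ring_scheme \<Rightarrow> 'a list \<Rightarrow> bool" where
  "regular_sequence R xs \<longleftrightarrow> set xs \<subseteq> carrier R \<and> Idl\<^bsub>R\<^esub> (set xs) \<noteq> carrier R
     \<and> (\<forall>i<length xs. \<forall>r\<in>carrier R.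
          xs ! i \<otimes>\<^bsub>R\<^esub> r \<in> Idl\<^bsub>R\<^esub> (set (take i xs)) \<longrightarrow> r \<in> Idl\<^bsub>R\<^esub> (set (take i xs)))"

definition grade :: "('a, 'm) ring_scheme \<Rightarrow> 'a set \<Rightarrow> enat" where
  "grade R I = Sup {enat (length xs) | xs. set xs \<subseteq> I \<and> regular_sequence R xs}"

definition krull_dim :: "('a, 'm) ring_scheme \<Rightarrow> enat" where
  "krull_dim R = Sup {enat n | n. \<exists>P. (\<forall>i\<le>n. primeideal (P i) R) \<and> (\<forall>i<n. P i \<subset> P (Suc i))}"

definition local_ring :: "('a, 'm) ring_scheme \<Rightarrow> 'a set \<Rightarrow> bool" where
  "local_ring R \<mm> \<longleftrightarrow> cring R \<and> noetherian_ring R \<and> maximalideal \<mm> R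
     \<and> (\<forall>M. maximalideal M R \<longrightarrow> M = \<mm>)"

definition regular_local_ring :: "('a, 'm) ring_scheme \<Rightarrow> 'a set \<Rightarrow> bool" where
  "regular_local_ring R \<mm> \<longleftrightarrow> local_ring R \<mm>
     \<and> (\<exists>S. finite S \<and> S \<subseteq> carrier R \<and> Idl\<^bsub>R\<^esub> S = \<mm> \<and> enat (card S) = krull_dim R)"


section \<open>Graded polynomial rings\<close>

text \<open>The polynomial ring \<open>k[x\<^sub>v | v \<in> 'v]\<close>; a monomial is its exponent vector.\<close>

definition mpoly_ring :: "(('v::finite \<Rightarrow>\<^sub>0 nat) \<Rightarrow>\<^sub>0 'k::field) ring" where
  "mpoly_ring = ring_of_type_algebra"

definition mpoly_part :: "nat \<Rightarrow> (('v::finite \<Rightarrow>\<^sub>0 nat) \<Rightarrow>\<^sub>0 'k::field) set" where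
  "mpoly_part i = {p. \<forall>m\<in>Poly_Mapping.keys p. (\<Sum>v\<in>UNIV. Poly_Mapping.lookup m v) = i}"

definition homogeneous_ideal :: "('a, 'm) ring_scheme \<Rightarrow> (nat \<Rightarrow> 'a set) \<Rightarrow> 'a set \<Rightarrow> bool" where
  "homogeneous_ideal R G I \<longleftrightarrow> (\<exists>S \<subseteq> (\<Union>i. G i). I = Idl\<^bsub>R\<^esub> S)"

definition quot_part :: "('a, 'm) ring_scheme \<Rightarrow> (nat \<Rightarrow> 'a set) \<Rightarrow> 'a set \<Rightarrow> nat \<Rightarrow> 'a set set" where
  "quot_part R G I i = (\<lambda>r. I +>\<^bsub>R\<^esub> r) ` G i"

end

theory Submission
  imports Defs
begin

text \<open>Let \<open>f\<^sub>0, \<dots>, f\<^sub>3 \<in> I\<close> be a regular sequence, homogeneous in the graded case, and let \<open>J\<close> be generated by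
  the squares \<open>f\<^sub>i\<^sup>2\<close>. Choose \<open>F\<^sub>i\<close> of degree 1 in the Koszul complex of \<open>R\<close> with \<open>d F\<^sub>i = f\<^sub>i\<close> and put
  \<open>G\<^sub>i = f\<^sub>i F\<^sub>i\<close>, so that \<open>d G\<^sub>i = f\<^sub>i\<^sup>2\<close>. Then \<open>d (G\<^sub>i G\<^sub>j)\<close> has coefficients in \<open>I J\<close>, so \<open>G\<^sub>0 G\<^sub>1\<close> and
  \<open>G\<^sub>2 G\<^sub>3\<close> are cycles over \<open>R/I J\<close>. A trivial Massey operation would make their product a boundary
  over \<open>R/I J\<close>, hence over \<open>R/J\<close>. But \<open>J\<close> is generated by a regular sequence, so the product of the
  classes of the \<open>G\<^sub>i\<close> is nonzero in the Koszul homology of \<open>R/J\<close>.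

  In the graded case a homogeneous regular sequence has to be found first. Koszul homology shows
  that \<open>I\<close> annihilates nothing modulo a regular sequence of fewer than four elements, and
  homogeneous prime avoidance then yields the next element.\<close>

section \<open>The Koszul complex as a DG-algebra\<close>

text \<open>A single G_i is not a cycle over R/IJ, since f_i^2 need not lie in IJ. In d(G_i G_j),
  however, each f_i^2 meets the factor f_j carried by G_j, and this puts the coefficients into IJ.
  So cycles are built from pairs, and a product of two such cycles uses four elements: this is the
  origin of the bound on the grade. Nonvanishing is tested over R/J, where the G_i themselves are
  cycles.

  The Golod property speaks of a Koszul complex over R/IJ on some minimal generators of its maximal
  ideal. Their lifts \<open>xt\<close> to R generate the maximal ideal a priori only modulo IJ,
  whereas F_i requires f_i to lie in the ideal (xt) of R itself. Nakayama's lemma closes this gap,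
  in a local and in a graded version.\<close>

lemma koszul_simps:
  "carrier (koszul A xs) = Pow {..<length xs} \<rightarrow>\<^sub>E carrier A"
  "\<zero>\<^bsub>koszul A xs\<^esub> = (\<lambda>S\<in>Pow {..<length xs}. \<zero>\<^bsub>A\<^esub>)"
  "\<one>\<^bsub>koszul A xs\<^esub> = (\<lambda>S\<in>Pow {..<length xs}. if S = {} then \<one>\<^bsub>A\<^esub> else \<zero>\<^bsub>A\<^esub>)"
  "f \<oplus>\<^bsub>koszul A xs\<^esub> g = (\<lambda>S\<in>Pow {..<length xs}. f S \<oplus>\<^bsub>A\<^esub> g S)"
  "f \<otimes>\<^bsub>koszul A xs\<^esub> g = (\<lambda>S\<in>Pow {..<length xs}. \<Oplus>\<^bsub>A\<^esub>T\<in>Pow S.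
     (\<ominus>\<^bsub>A\<^esub> \<one>\<^bsub>A\<^esub>) [^]\<^bsub>A\<^esub> card {(t, u). t \<in> T \<and> u \<in> S - T \<and> u < t}
       \<otimes>\<^bsub>A\<^esub> (f T \<otimes>\<^bsub>A\<^esub> g (S - T)))"
  "differential (koszul A xs) f = (\<lambda>S\<in>Pow {..<length xs}. \<Oplus>\<^bsub>A\<^esub>i\<in>{..<length xs} - S.
     (\<ominus>\<^bsub>A\<^esub> \<one>\<^bsub>A\<^esub>) [^]\<^bsub>A\<^esub> card {j \<in> S. j < i} \<otimes>\<^bsub>A\<^esub> (xs ! i \<otimes>\<^bsub>A\<^esub> f (insert i S)))"
  "graded_part (koszul A xs) i = {f \<in> Pow {..<length xs} \<rightarrow>\<^sub>E carrier A.
     \<forall>S\<in>Pow {..<length xs}. card S \<noteq> i \<longrightarrow> f S = \<zero>\<^bsub>A\<^esub>}"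
  by (simp_all add: koszul_def Let_def)

text \<open>The involution \<tau> f = (-1)^|f| f, extended to inhomogeneous elements. With it the
  Leibniz rule d(f g) = (d f) g + \<tau>(f) d g needs no reference to degrees.\<close>

definition koszul_sign :: "('a, 'm) ring_scheme \<Rightarrow> 'a list \<Rightarrow> (nat set \<Rightarrow> 'a) \<Rightarrow> (nat set \<Rightarrow> 'a)" where
  "koszul_sign A xs f = (\<lambda>S\<in>Pow {..<length xs}. (\<ominus>\<^bsub>A\<^esub> \<one>\<^bsub>A\<^esub>) [^]\<^bsub>A\<^esub> card S \<otimes>\<^bsub>A\<^esub> f S)"

definition koszul_scale :: "('a, 'm) ring_scheme \<Rightarrow> 'a list \<Rightarrow> 'a \<Rightarrow> (nat set \<Rightarrow> 'a) \<Rightarrow> (nat set \<Rightarrow> 'a)" where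
  "koszul_scale A xs a f = (\<lambda>S\<in>Pow {..<length xs}. a \<otimes>\<^bsub>A\<^esub> f S)"

text \<open>The grading enters only through the involution \<tau>: that d has odd degree becomes the
  anticommutation \<open>d_sign\<close>. The structural laws are thus equations between arbitrary
  elements, which can be checked coordinatewise when a generator is adjoined. Scalars pass through
  both factors of a product, so A acts centrally.\<close>

locale signed_dga = A?: cring A + B?: ring B
  for A :: "('a, 'm) ring_scheme" (structure) and B :: "('b, 'n) ring_scheme" (structure)
    and d \<tau> :: "'b \<Rightarrow> 'b" and sc :: "'a \<Rightarrow> 'b \<Rightarrow> 'b" +
  assumes d_closed [simp]: "f \<in> carrier B \<Longrightarrow> d f \<in> carrier B"
    and d_add: "\<lbrakk>f \<in> carrier B; g \<in> carrier B\<rbrakk> \<Longrightarrow> d (f \<oplus>\<^bsub>B\<^esub> g) = d f \<oplus>\<^bsub>B\<^esub> d g"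
    and d_d [simp]: "f \<in> carrier B \<Longrightarrow> d (d f) = \<zero>\<^bsub>B\<^esub>"
    and sign_closed [simp]: "f \<in> carrier B \<Longrightarrow> \<tau> f \<in> carrier B"
    and sign_add: "\<lbrakk>f \<in> carrier B; g \<in> carrier B\<rbrakk> \<Longrightarrow> \<tau> (f \<oplus>\<^bsub>B\<^esub> g) = \<tau> f \<oplus>\<^bsub>B\<^esub> \<tau> g"
    and sign_sign [simp]: "f \<in> carrier B \<Longrightarrow> \<tau> (\<tau> f) = f"
    and sign_mult: "\<lbrakk>f \<in> carrier B; g \<in> carrier B\<rbrakk> \<Longrightarrow> \<tau> (f \<otimes>\<^bsub>B\<^esub> g) = \<tau> f \<otimes>\<^bsub>B\<^esub> \<tau> g"
    and sign_one [simp]: "\<tau> \<one>\<^bsub>B\<^esub> = \<one>\<^bsub>B\<^esub>"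
    and d_sign: "f \<in> carrier B \<Longrightarrow> d (\<tau> f) = \<ominus>\<^bsub>B\<^esub> \<tau> (d f)"
    and d_mult: "\<lbrakk>f \<in> carrier B; g \<in> carrier B\<rbrakk> \<Longrightarrow>
          d (f \<otimes>\<^bsub>B\<^esub> g) = (d f \<otimes>\<^bsub>B\<^esub> g) \<oplus>\<^bsub>B\<^esub> (\<tau> f \<otimes>\<^bsub>B\<^esub> d g)"
    and scale_closed [simp]: "\<lbrakk>a \<in> carrier A; f \<in> carrier B\<rbrakk> \<Longrightarrow> sc a f \<in> carrier B"
    and scale_add: "\<lbrakk>a \<in> carrier A; f \<in> carrier B; g \<in> carrier B\<rbrakk> \<Longrightarrow>
          sc a (f \<oplus>\<^bsub>B\<^esub> g) = sc a f \<oplus>\<^bsub>B\<^esub> sc a g"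
    and scale_scale: "\<lbrakk>a \<in> carrier A; b \<in> carrier A; f \<in> carrier B\<rbrakk> \<Longrightarrow>
          sc a (sc b f) = sc (a \<otimes>\<^bsub>A\<^esub> b) f"
    and scale_mult_left: "\<lbrakk>a \<in> carrier A; f \<in> carrier B; g \<in> carrier B\<rbrakk> \<Longrightarrow>
          sc a f \<otimes>\<^bsub>B\<^esub> g = sc a (f \<otimes>\<^bsub>B\<^esub> g)"
    and scale_mult_right: "\<lbrakk>a \<in> carrier A; f \<in> carrier B; g \<in> carrier B\<rbrakk> \<Longrightarrow>
          f \<otimes>\<^bsub>B\<^esub> sc a g = sc a (f \<otimes>\<^bsub>B\<^esub> g)"
    and d_scale: "\<lbrakk>a \<in> carrier A; f \<in> carrier B\<rbrakk> \<Longrightarrow> d (sc a f) = sc a (d f)"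
    and sign_scale: "\<lbrakk>a \<in> carrier A; f \<in> carrier B\<rbrakk> \<Longrightarrow> \<tau> (sc a f) = sc a (\<tau> f)"
begin

lemma additive_zero_minus:
  assumes "\<And>f. f \<in> carrier B \<Longrightarrow> h f \<in> carrier B"
    and "\<And>f g. \<lbrakk>f \<in> carrier B; g \<in> carrier B\<rbrakk> \<Longrightarrow> h (f \<oplus>\<^bsub>B\<^esub> g) = h f \<oplus>\<^bsub>B\<^esub> h g"
  shows "h \<zero>\<^bsub>B\<^esub> = \<zero>\<^bsub>B\<^esub>" "f \<in> carrier B \<Longrightarrow> h (\<ominus>\<^bsub>B\<^esub> f) = \<ominus>\<^bsub>B\<^esub> h f"
proof -
  show z: "h \<zero>\<^bsub>B\<^esub> = \<zero>\<^bsub>B\<^esub>"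
    using assms(1)[of "\<zero>\<^bsub>B\<^esub>"] assms(2)[of "\<zero>\<^bsub>B\<^esub>" "\<zero>\<^bsub>B\<^esub>"] by (metis B.add.l_cancel_one' B.zero_closed B.l_zero)
  show "h (\<ominus>\<^bsub>B\<^esub> f) = \<ominus>\<^bsub>B\<^esub> h f" if "f \<in> carrier B"
    using assms(2)[of "\<ominus>\<^bsub>B\<^esub> f" f] z that assms(1)
    by (metis B.a_inv_closed B.l_neg B.minus_equality)
qed

lemma d_zero [simp]: "d \<zero>\<^bsub>B\<^esub> = \<zero>\<^bsub>B\<^esub>"
  and d_minus: "f \<in> carrier B \<Longrightarrow> d (\<ominus>\<^bsub>B\<^esub> f) = \<ominus>\<^bsub>B\<^esub> d f"
  using additive_zero_minus[of d] by (auto simp: d_add)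

lemma sign_zero [simp]: "\<tau> \<zero>\<^bsub>B\<^esub> = \<zero>\<^bsub>B\<^esub>"
  and sign_minus: "f \<in> carrier B \<Longrightarrow> \<tau> (\<ominus>\<^bsub>B\<^esub> f) = \<ominus>\<^bsub>B\<^esub> \<tau> f"
  using additive_zero_minus[of \<tau>] by (auto simp: sign_add)

lemma scale_zero [simp]: "a \<in> carrier A \<Longrightarrow> sc a \<zero>\<^bsub>B\<^esub> = \<zero>\<^bsub>B\<^esub>"
  and scale_minus: "\<lbrakk>a \<in> carrier A; f \<in> carrier B\<rbrakk> \<Longrightarrow> sc a (\<ominus>\<^bsub>B\<^esub> f) = \<ominus>\<^bsub>B\<^esub> sc a f"
  using additive_zero_minus[of "sc a"] by (auto simp: scale_add)

lemma sign_d: "f \<in> carrier B \<Longrightarrow> \<tau> (d f) = \<ominus>\<^bsub>B\<^esub> d (\<tau> f)"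
  by (simp add: d_sign)

end

text \<open>Adjoining one exterior generator \<open>e\<close> with \<open>d e = x\<close>: an element of \<open>C = B \<oplus> B e\<close> is
  identified with its coordinates \<open>p\<^sub>0, p\<^sub>1\<close>.\<close>

lemma (in signed_dga) signed_dga_extension:
  fixes C :: "('c, 'k) ring_scheme" and p0 p1 :: "'c \<Rightarrow> 'b"
  assumes x: "x \<in> carrier A"
    and abelian: "abelian_group C"
    and closed: "\<And>f. f \<in> carrier C \<Longrightarrow> p0 f \<in> carrier B" "\<And>f. f \<in> carrier C \<Longrightarrow> p1 f \<in> carrier B"
    and one_closed: "\<one>\<^bsub>C\<^esub> \<in> carrier C"
    and mult_closed: "\<And>f g. \<lbrakk>f \<in> carrier C; g \<in> carrier C\<rbrakk> \<Longrightarrow> f \<otimes>\<^bsub>C\<^esub> g \<in> carrier C"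
    and dC: "\<And>f. f \<in> carrier C \<Longrightarrow> dC f \<in> carrier C"
    and tC: "\<And>f. f \<in> carrier C \<Longrightarrow> tC f \<in> carrier C"
    and sC: "\<And>a f. \<lbrakk>a \<in> carrier A; f \<in> carrier C\<rbrakk> \<Longrightarrow> sC a f \<in> carrier C"
    and eqI: "\<And>f g. \<lbrakk>f \<in> carrier C; g \<in> carrier C; p0 f = p0 g; p1 f = p1 g\<rbrakk> \<Longrightarrow> f = g"
    and zero: "p0 \<zero>\<^bsub>C\<^esub> = \<zero>\<^bsub>B\<^esub>" "p1 \<zero>\<^bsub>C\<^esub> = \<zero>\<^bsub>B\<^esub>"
    and one: "p0 \<one>\<^bsub>C\<^esub> = \<one>\<^bsub>B\<^esub>" "p1 \<one>\<^bsub>C\<^esub> = \<zero>\<^bsub>B\<^esub>"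
    and add: "\<And>f g. \<lbrakk>f \<in> carrier C; g \<in> carrier C\<rbrakk> \<Longrightarrow> p0 (f \<oplus>\<^bsub>C\<^esub> g) = p0 f \<oplus>\<^bsub>B\<^esub> p0 g"
       "\<And>f g. \<lbrakk>f \<in> carrier C; g \<in> carrier C\<rbrakk> \<Longrightarrow> p1 (f \<oplus>\<^bsub>C\<^esub> g) = p1 f \<oplus>\<^bsub>B\<^esub> p1 g"
    and mult: "\<And>f g. \<lbrakk>f \<in> carrier C; g \<in> carrier C\<rbrakk> \<Longrightarrow> p0 (f \<otimes>\<^bsub>C\<^esub> g) = p0 f \<otimes>\<^bsub>B\<^esub> p0 g"
       "\<And>f g. \<lbrakk>f \<in> carrier C; g \<in> carrier C\<rbrakk> \<Longrightarrow>
          p1 (f \<otimes>\<^bsub>C\<^esub> g) = (p0 f \<otimes>\<^bsub>B\<^esub> p1 g) \<oplus>\<^bsub>B\<^esub> (p1 f \<otimes>\<^bsub>B\<^esub> \<tau> (p0 g))"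
    and diff: "\<And>f. f \<in> carrier C \<Longrightarrow> p0 (dC f) = d (p0 f) \<oplus>\<^bsub>B\<^esub> sc x (\<tau> (p1 f))"
       "\<And>f. f \<in> carrier C \<Longrightarrow> p1 (dC f) = d (p1 f)"
    and sign: "\<And>f. f \<in> carrier C \<Longrightarrow> p0 (tC f) = \<tau> (p0 f)"
       "\<And>f. f \<in> carrier C \<Longrightarrow> p1 (tC f) = \<ominus>\<^bsub>B\<^esub> \<tau> (p1 f)"
    and scale: "\<And>a f. \<lbrakk>a \<in> carrier A; f \<in> carrier C\<rbrakk> \<Longrightarrow> p0 (sC a f) = sc a (p0 f)"
       "\<And>a f. \<lbrakk>a \<in> carrier A; f \<in> carrier C\<rbrakk> \<Longrightarrow> p1 (sC a f) = sc a (p1 f)"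
  shows "signed_dga A C dC tC sC"
proof -
  interpret C: abelian_group C by fact
  have minus: "p0 (\<ominus>\<^bsub>C\<^esub> f) = \<ominus>\<^bsub>B\<^esub> p0 f" "p1 (\<ominus>\<^bsub>C\<^esub> f) = \<ominus>\<^bsub>B\<^esub> p1 f" if "f \<in> carrier C" for f
    using add[of "\<ominus>\<^bsub>C\<^esub> f" f] that closed zero by (metis B.minus_equality C.a_inv_closed C.l_neg)+
  \<comment> \<open>The coordinate formulas express e b = \<tau>(b) e, d(b e) = (d b) e + x
    \<tau>(b) and \<tau>(b e) = -\<tau>(b) e.\<close>
  note ss = closed zero one add mult diff sign scale one_closed mult_closed dC tC sC minus
  note exp = B.l_distr B.r_distr B.m_assoc B.a_ac B.minus_add B.l_minus B.r_minus sign_mult sign_add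
    scale_add scale_scale scale_mult_left scale_mult_right d_scale sign_scale sign_minus d_minus scale_minus
    d_sign d_add d_mult
  have ring: "ring C"
  proof (intro ringI monoidI abelian)
    fix f g h assume "f \<in> carrier C" "g \<in> carrier C" "h \<in> carrier C"
    then show "(f \<otimes>\<^bsub>C\<^esub> g) \<otimes>\<^bsub>C\<^esub> h = f \<otimes>\<^bsub>C\<^esub> (g \<otimes>\<^bsub>C\<^esub> h)"
      "(f \<oplus>\<^bsub>C\<^esub> g) \<otimes>\<^bsub>C\<^esub> h = (f \<otimes>\<^bsub>C\<^esub> h) \<oplus>\<^bsub>C\<^esub> (g \<otimes>\<^bsub>C\<^esub> h)"
      "h \<otimes>\<^bsub>C\<^esub> (f \<oplus>\<^bsub>C\<^esub> g) = (h \<otimes>\<^bsub>C\<^esub> f) \<oplus>\<^bsub>C\<^esub> (h \<otimes>\<^bsub>C\<^esub> g)"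
      "\<one>\<^bsub>C\<^esub> \<otimes>\<^bsub>C\<^esub> f = f" "f \<otimes>\<^bsub>C\<^esub> \<one>\<^bsub>C\<^esub> = f"
      by (auto intro!: eqI simp: ss exp)
  qed (simp_all add: ss)
  \<comment> \<open>In the e-coordinate of the Leibniz rule the term x \<tau>(p1 f) p1 g occurs
    twice with opposite signs, since d e = x acts in either factor. \<open>cancel\<close> removes
    this pair.\<close>
  have cancel: "a \<oplus>\<^bsub>B\<^esub> (b \<oplus>\<^bsub>B\<^esub> \<ominus>\<^bsub>B\<^esub> a) = b" if "a \<in> carrier B" "b \<in> carrier B" for a b
    using that by (metis B.a_lcomm B.r_neg B.r_zero B.a_inv_closed)
  interpret C: ring C by fact
  \<comment> \<open>The e-free coordinate is x d(\<tau>(p1 f)) + x \<tau>(d(p1 f)), which vanishes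
    because d and \<tau> anticommute.\<close>
  have d_d': "dC (dC f) = \<zero>\<^bsub>C\<^esub>" if "f \<in> carrier C" for f
    using that x by (intro eqI) (simp_all add: ss exp B.r_neg B.l_neg)
  have d_m: "dC (f \<otimes>\<^bsub>C\<^esub> g) = (dC f \<otimes>\<^bsub>C\<^esub> g) \<oplus>\<^bsub>C\<^esub> (tC f \<otimes>\<^bsub>C\<^esub> dC g)"
    if "f \<in> carrier C" "g \<in> carrier C" for f g
  proof (intro eqI)
    show "p0 (dC (f \<otimes>\<^bsub>C\<^esub> g)) = p0 ((dC f \<otimes>\<^bsub>C\<^esub> g) \<oplus>\<^bsub>C\<^esub> (tC f \<otimes>\<^bsub>C\<^esub> dC g))"
      using that x by (simp add: ss exp)
    show "p1 (dC (f \<otimes>\<^bsub>C\<^esub> g)) = p1 ((dC f \<otimes>\<^bsub>C\<^esub> g) \<oplus>\<^bsub>C\<^esub> (tC f \<otimes>\<^bsub>C\<^esub> dC g))"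
      using that x by (simp add: ss exp)
        (rule cancel[symmetric]; simp add: closed)
  qed (use that in \<open>simp_all add: ss\<close>)
  show ?thesis
  proof unfold_locales
    show "\<And>f g. \<lbrakk>f \<in> carrier C; g \<in> carrier C\<rbrakk> \<Longrightarrow> dC (f \<oplus>\<^bsub>C\<^esub> g) = dC f \<oplus>\<^bsub>C\<^esub> dC g"
      by (rule eqI) (use x in \<open>simp_all add: ss exp\<close>)
    show "\<And>f. f \<in> carrier C \<Longrightarrow> dC (tC f) = \<ominus>\<^bsub>C\<^esub> tC (dC f)"
      by (rule eqI) (use x in \<open>simp_all add: ss exp\<close>)
    show "\<And>f g. \<lbrakk>f \<in> carrier C; g \<in> carrier C\<rbrakk> \<Longrightarrow> tC (f \<oplus>\<^bsub>C\<^esub> g) = tC f \<oplus>\<^bsub>C\<^esub> tC g"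
      by (rule eqI) (use x in \<open>simp_all add: ss exp\<close>)
    show "\<And>f g. \<lbrakk>f \<in> carrier C; g \<in> carrier C\<rbrakk> \<Longrightarrow> tC (f \<otimes>\<^bsub>C\<^esub> g) = tC f \<otimes>\<^bsub>C\<^esub> tC g"
      by (rule eqI) (use x in \<open>simp_all add: ss exp\<close>)
    show "\<And>f. f \<in> carrier C \<Longrightarrow> tC (tC f) = f"
      by (rule eqI) (use x in \<open>simp_all add: ss exp\<close>)
    show "tC \<one>\<^bsub>C\<^esub> = \<one>\<^bsub>C\<^esub>"
      by (rule eqI) (use x in \<open>simp_all add: ss exp\<close>)
    show "\<And>a f g. \<lbrakk>a \<in> carrier A; f \<in> carrier C; g \<in> carrier C\<rbrakk> \<Longrightarrow>
          sC a (f \<oplus>\<^bsub>C\<^esub> g) = sC a f \<oplus>\<^bsub>C\<^esub> sC a g"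
      by (rule eqI) (use x in \<open>simp_all add: ss exp\<close>)
    show "\<And>a b f. \<lbrakk>a \<in> carrier A; b \<in> carrier A; f \<in> carrier C\<rbrakk> \<Longrightarrow>
          sC a (sC b f) = sC (a \<otimes>\<^bsub>A\<^esub> b) f"
      by (rule eqI) (use x in \<open>simp_all add: ss exp\<close>)
    show "\<And>a f g. \<lbrakk>a \<in> carrier A; f \<in> carrier C; g \<in> carrier C\<rbrakk> \<Longrightarrow>
          sC a f \<otimes>\<^bsub>C\<^esub> g = sC a (f \<otimes>\<^bsub>C\<^esub> g)"
      by (rule eqI) (use x in \<open>simp_all add: ss exp\<close>)
    show "\<And>a f g. \<lbrakk>a \<in> carrier A; f \<in> carrier C; g \<in> carrier C\<rbrakk> \<Longrightarrow>
          f \<otimes>\<^bsub>C\<^esub> sC a g = sC a (f \<otimes>\<^bsub>C\<^esub> g)"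
      by (rule eqI) (use x in \<open>simp_all add: ss exp\<close>)
    show "\<And>a f. \<lbrakk>a \<in> carrier A; f \<in> carrier C\<rbrakk> \<Longrightarrow> dC (sC a f) = sC a (dC f)"
      by (rule eqI) (use x in \<open>simp_all add: ss exp A.m_comm\<close>)
    show "\<And>a f. \<lbrakk>a \<in> carrier A; f \<in> carrier C\<rbrakk> \<Longrightarrow> tC (sC a f) = sC a (tC f)"
      by (rule eqI) (use x in \<open>simp_all add: ss exp\<close>)
  qed (simp_all add: ss d_d' d_m)
qed

section \<open>The Koszul complex as an iterated extension by one exterior generator\<close>

context cring
begin

lemma sign_pow:
  "(\<ominus> \<one>) [^] (k::nat) \<in> carrier R"
  "(\<ominus> \<one>) [^] (k + l) = (\<ominus> \<one>) [^] k \<otimes> (\<ominus> \<one>) [^] (l::nat)"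
  "(\<ominus> \<one>) [^] Suc k = \<ominus> ((\<ominus> \<one>) [^] k)"
  "(\<ominus> \<one>) [^] k \<otimes> (\<ominus> \<one>) [^] k = \<one>"
proof -
  show c: "(\<ominus> \<one>) [^] (k::nat) \<in> carrier R" for k by simp
  show "(\<ominus> \<one>) [^] (k + l) = (\<ominus> \<one>) [^] k \<otimes> (\<ominus> \<one>) [^] (l::nat)" by (simp add: nat_pow_mult)
  show s: "(\<ominus> \<one>) [^] Suc k = \<ominus> ((\<ominus> \<one>) [^] k)" for k by (simp add: r_minus)
  show "(\<ominus> \<one>) [^] k \<otimes> (\<ominus> \<one>) [^] k = \<one>"
    by (induction k) (simp_all only: nat_pow_0 l_one s l_minus r_minus minus_minus c m_closed one_closed a_inv_closed)
qed

lemma koszul_abelian_group: "abelian_group (koszul R xs)"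
proof (rule abelian_groupI)
  fix f assume f: "f \<in> carrier (koszul R xs)"
  show "\<exists>g\<in>carrier (koszul R xs). g \<oplus>\<^bsub>koszul R xs\<^esub> f = \<zero>\<^bsub>koszul R xs\<^esub>"
    by (rule bexI[of _ "\<lambda>S\<in>Pow {..<length xs}. \<ominus> f S"])
      (use f in \<open>auto simp: koszul_simps l_neg PiE_iff intro!: restrict_ext\<close>)
qed (auto simp: koszul_simps PiE_def Pi_def restrict_def extensional_def a_ac intro!: ext)

lemma koszul_closed:
  assumes "f \<in> carrier (koszul R xs)" "set xs \<subseteq> carrier R"
  shows "differential (koszul R xs) f \<in> carrier (koszul R xs)"
    and "koszul_sign R xs f \<in> carrier (koszul R xs)"
    and "a \<in> carrier R \<Longrightarrow> koszul_scale R xs a f \<in> carrier (koszul R xs)"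
    and "g \<in> carrier (koszul R xs) \<Longrightarrow> f \<otimes>\<^bsub>koszul R xs\<^esub> g \<in> carrier (koszul R xs)"
proof -
  have f: "f S \<in> carrier R" if "S \<subseteq> {..<length xs}" for S
    using assms(1) that by (auto simp: koszul_simps)
  have x: "xs ! i \<in> carrier R" if "i < length xs" for i using assms(2) that by auto
  show "koszul_sign R xs f \<in> carrier (koszul R xs)"
    "a \<in> carrier R \<Longrightarrow> koszul_scale R xs a f \<in> carrier (koszul R xs)"
    by (auto simp: koszul_simps koszul_sign_def koszul_scale_def f)
  show "differential (koszul R xs) f \<in> carrier (koszul R xs)"
    by (auto simp: koszul_simps intro!: finsum_closed f x)
  show "f \<otimes>\<^bsub>koszul R xs\<^esub> g \<in> carrier (koszul R xs)" if g: "g \<in> carrier (koszul R xs)"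
  proof -
    have "g S \<in> carrier R" if "S \<subseteq> {..<length xs}" for S
      using g that by (auto simp: koszul_simps)
    note gc = this[OF subset_trans[OF Diff_subset]]
    show ?thesis by (auto simp: koszul_simps intro!: finsum_closed m_closed f gc)
  qed
qed

text \<open>The new index n = \<open>length xs\<close> is the largest one, so e_(S + n) = e_S e_n
  without a sign. Restricting to the subsets without and with n therefore gives exactly the two
  coordinates of B + B e.\<close>

abbreviation (input) coord0 :: "'a list \<Rightarrow> (nat set \<Rightarrow> 'a) \<Rightarrow> (nat set \<Rightarrow> 'a)" where
  "coord0 xs f \<equiv> (\<lambda>S\<in>Pow {..<length xs}. f S)"

abbreviation (input) coord1 :: "'a list \<Rightarrow> (nat set \<Rightarrow> 'a) \<Rightarrow> (nat set \<Rightarrow> 'a)" where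
  "coord1 xs f \<equiv> (\<lambda>S\<in>Pow {..<length xs}. f (insert (length xs) S))"

lemma subset_lessThan_Suc_cases:
  assumes "S \<subseteq> {..<Suc n}"
  obtains "S \<subseteq> {..<n}" | T where "T \<subseteq> {..<n}" "S = insert n T"
proof (cases "n \<in> S")
  case True
  then show ?thesis using assms that(2)[of "S - {n}"] by (force simp: less_Suc_eq)
next
  case False
  then show ?thesis using assms that(1) by (force simp: less_Suc_eq)
qed

lemma coord_eqI:
  assumes "f \<in> carrier (koszul R (xs @ [x]))" "g \<in> carrier (koszul R (xs @ [x]))"
    and "coord0 xs f = coord0 xs g" "coord1 xs f = coord1 xs g"
  shows "f = g"
proof (rule PiE_ext)
  show "f \<in> Pow {..<Suc (length xs)} \<rightarrow>\<^sub>E carrier R" "g \<in> Pow {..<Suc (length xs)} \<rightarrow>\<^sub>E carrier R"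
    using assms(1,2) by (auto simp: koszul_simps)
  fix S assume "S \<in> Pow {..<Suc (length xs)}"
  then have "S \<subseteq> {..<Suc (length xs)}" by simp
  then show "f S = g S"
  proof (cases rule: subset_lessThan_Suc_cases)
    case 1
    then show ?thesis using fun_cong[OF assms(3), of S] by simp
  next
    case (2 T)
    then show ?thesis using fun_cong[OF assms(4), of T] by simp
  qed
qed

lemma koszul_mult_apply:
  "S \<subseteq> {..<length xs} \<Longrightarrow> (f \<otimes>\<^bsub>koszul R xs\<^esub> g) S = (\<Oplus>T\<in>Pow S.
     (\<ominus> \<one>) [^] card {(t, u). t \<in> T \<and> u \<in> S - T \<and> u < t} \<otimes> (f T \<otimes> g (S - T)))"
  by (simp add: koszul_simps)

text \<open>A term containing e_n arises in two ways. If n belongs to the right factor, it creates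
  no inversion, being the largest index. If it belongs to the left factor, it is inverted with every
  index of the right factor, and the resulting sign is \<open>koszul_sign\<close> of that
  factor.\<close>

lemma coord_mult:
  assumes f: "f \<in> carrier (koszul R (xs @ [x]))" and g: "g \<in> carrier (koszul R (xs @ [x]))"
  shows "coord0 xs (f \<otimes>\<^bsub>koszul R (xs @ [x])\<^esub> g) = coord0 xs f \<otimes>\<^bsub>koszul R xs\<^esub> coord0 xs g"
    and "coord1 xs (f \<otimes>\<^bsub>koszul R (xs @ [x])\<^esub> g) =
      (coord0 xs f \<otimes>\<^bsub>koszul R xs\<^esub> coord1 xs g) \<oplus>\<^bsub>koszul R xs\<^esub>
      (coord1 xs f \<otimes>\<^bsub>koszul R xs\<^esub> koszul_sign R xs (coord0 xs g))"
proof -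
  define n where "n = length xs"
  have fc: "f S \<in> carrier R" and gc: "g S \<in> carrier R" if "S \<subseteq> {..<Suc n}" for S
    using f g that by (auto simp: koszul_simps n_def)
  have [simp]: "{..<n} \<subseteq> {..<Suc n}" by auto
  have len: "length (xs @ [x]) = Suc n" "length xs = n" by (simp_all add: n_def)
  show "coord0 xs (f \<otimes>\<^bsub>koszul R (xs @ [x])\<^esub> g) = coord0 xs f \<otimes>\<^bsub>koszul R xs\<^esub> coord0 xs g"
  proof (rule extensionalityI[of _ "Pow {..<n}"])
    fix S assume "S \<in> Pow {..<n}"
    then have S: "S \<subseteq> {..<n}" by simp
    then have S': "S \<subseteq> {..<Suc n}" by auto
    have "(f \<otimes>\<^bsub>koszul R (xs @ [x])\<^esub> g) S = (\<Oplus>T\<in>Pow S.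
       (\<ominus> \<one>) [^] card {(t, u). t \<in> T \<and> u \<in> S - T \<and> u < t} \<otimes> (f T \<otimes> g (S - T)))"
      by (rule koszul_mult_apply[of _ "xs @ [x]", unfolded len, OF S'])
    also have "\<dots> = (\<Oplus>T\<in>Pow S. (\<ominus> \<one>) [^] card {(t, u). t \<in> T \<and> u \<in> S - T \<and> u < t} \<otimes>
       (coord0 xs f T \<otimes> coord0 xs g (S - T)))"
    proof (rule finsum_cong')
      fix T assume T: "T \<in> Pow S"
      then have "T \<subseteq> {..<n}" "S - T \<subseteq> {..<n}" using S by auto
      then show "(\<ominus> \<one>) [^] card {(t, u). t \<in> T \<and> u \<in> S - T \<and> u < t} \<otimes> (f T \<otimes> g (S - T)) =
        (\<ominus> \<one>) [^] card {(t, u). t \<in> T \<and> u \<in> S - T \<and> u < t} \<otimes>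
         (coord0 xs f T \<otimes> coord0 xs g (S - T))" by (simp only: len restrict_apply' PowI)
    next
      show "(\<lambda>T. (\<ominus> \<one>) [^] card {(t, u). t \<in> T \<and> u \<in> S - T \<and> u < t} \<otimes>
         (coord0 xs f T \<otimes> coord0 xs g (S - T))) \<in> Pow S \<rightarrow> carrier R"
      proof (intro Pi_I m_closed sign_pow)
        fix T assume "T \<in> Pow S"
        then have "T \<subseteq> {..<n}" "S - T \<subseteq> {..<n}" "T \<subseteq> {..<Suc n}" "S - T \<subseteq> {..<Suc n}"
          using S S' by auto
        then show "coord0 xs f T \<in> carrier R" "coord0 xs g (S - T) \<in> carrier R"
          by (simp_all only: len restrict_apply' PowI fc gc)
      qed
    qed simp
    also have "\<dots> = (coord0 xs f \<otimes>\<^bsub>koszul R xs\<^esub> coord0 xs g) S"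
      by (rule koszul_mult_apply[of _ xs, unfolded len, OF S, symmetric])
    finally show "coord0 xs (f \<otimes>\<^bsub>koszul R (xs @ [x])\<^esub> g) S = (coord0 xs f \<otimes>\<^bsub>koszul R xs\<^esub> coord0 xs g) S"
      using S by (simp only: len restrict_apply' PowI)
  qed (auto simp: koszul_simps n_def)
  show "coord1 xs (f \<otimes>\<^bsub>koszul R (xs @ [x])\<^esub> g) =
      (coord0 xs f \<otimes>\<^bsub>koszul R xs\<^esub> coord1 xs g) \<oplus>\<^bsub>koszul R xs\<^esub>
      (coord1 xs f \<otimes>\<^bsub>koszul R xs\<^esub> koszul_sign R xs (coord0 xs g))" (is "?L = ?R")
  proof (rule extensionalityI[of _ "Pow {..<n}"])
    show "?L \<in> extensional (Pow {..<n})" "?R \<in> extensional (Pow {..<n})"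
      by (simp_all add: koszul_simps n_def)
    fix S assume "S \<in> Pow {..<n}"
    then have S: "S \<subseteq> {..<n}" and S': "insert n S \<subseteq> {..<Suc n}" and nS: "n \<notin> S"
      by auto
    have finS: "finite S" using S finite_subset by blast
    define F where "F = (\<lambda>T. (\<ominus> \<one>) [^] card {(t, u). t \<in> T \<and> u \<in> insert n S - T \<and> u < t} \<otimes>
       (f T \<otimes> g (insert n S - T)))"
    have Fc: "F T \<in> carrier R" if "T \<subseteq> insert n S" for T
      unfolding F_def using that S by (intro m_closed sign_pow fc gc) auto
    have "(\<Oplus>T\<in>Pow (insert n S). F T) = (\<Oplus>T\<in>Pow S \<union> insert n ` Pow S. F T)"
      by (simp add: Pow_insert)
    also have "\<dots> = (\<Oplus>T\<in>Pow S. F T) \<oplus> (\<Oplus>T\<in>insert n ` Pow S. F T)"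
      using nS finS by (intro finsum_Un_disjoint) (auto intro!: Fc)
    also have "(\<Oplus>T\<in>insert n ` Pow S. F T) = (\<Oplus>T\<in>Pow S. F (insert n T))"
    proof (intro finsum_reindex inj_onI)
      fix T U assume "T \<in> Pow S" "U \<in> Pow S" "insert n T = insert n U"
      then show "T = U" using nS by (metis PowD insert_ident subsetD)
    qed (auto intro!: Fc)
    also have "(\<Oplus>T\<in>Pow S. F T) = (\<Oplus>T\<in>Pow S. (\<ominus> \<one>) [^] card {(t, u). t \<in> T \<and> u \<in> S - T \<and> u < t} \<otimes>
       (coord0 xs f T \<otimes> coord1 xs g (S - T)))"
    proof (rule finsum_cong')
      fix T assume T: "T \<in> Pow S"
      have "{(t, u). t \<in> T \<and> u \<in> insert n S - T \<and> u < t} = {(t, u). t \<in> T \<and> u \<in> S - T \<and> u < t}"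
        using T S nS by force
      moreover have "insert n S - T = insert n (S - T)" using T nS by auto
      moreover have "T \<subseteq> {..<n}" "S - T \<subseteq> {..<n}" using T S by auto
      ultimately show "F T = (\<ominus> \<one>) [^] card {(t, u). t \<in> T \<and> u \<in> S - T \<and> u < t} \<otimes>
       (coord0 xs f T \<otimes> coord1 xs g (S - T))" by (simp only: F_def len restrict_apply' PowI)
    next
      show "(\<lambda>T. (\<ominus> \<one>) [^] card {(t, u). t \<in> T \<and> u \<in> S - T \<and> u < t} \<otimes>
       (coord0 xs f T \<otimes> coord1 xs g (S - T))) \<in> Pow S \<rightarrow> carrier R"
      proof (intro Pi_I m_closed sign_pow)
        fix T assume "T \<in> Pow S"
        then have "T \<subseteq> {..<n}" "S - T \<subseteq> {..<n}" "T \<subseteq> {..<Suc n}" "insert n (S - T) \<subseteq> {..<Suc n}"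
          using S S' by auto
        then show "coord0 xs f T \<in> carrier R" "coord1 xs g (S - T) \<in> carrier R"
          by (simp_all only: len restrict_apply' PowI fc gc)
      qed
    qed simp
    also have "(\<Oplus>T\<in>Pow S. F (insert n T)) =
       (\<Oplus>T\<in>Pow S. (\<ominus> \<one>) [^] card {(t, u). t \<in> T \<and> u \<in> S - T \<and> u < t} \<otimes>
       (coord1 xs f T \<otimes> koszul_sign R xs (coord0 xs g) (S - T)))"
    proof (rule finsum_cong')
      fix T assume T: "T \<in> Pow S"
      have eq: "{(t, u). t \<in> insert n T \<and> u \<in> insert n S - insert n T \<and> u < t} =
        {(t, u). t \<in> T \<and> u \<in> S - T \<and> u < t} \<union> Pair n ` (S - T)"
        using T S nS by force
      have fin: "finite {(t, u). t \<in> T \<and> u \<in> S - T \<and> u < t}"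
        by (rule finite_subset[of _ "S \<times> S"]) (use T finS in auto)
      have card: "card {(t, u). t \<in> insert n T \<and> u \<in> insert n S - insert n T \<and> u < t} =
        card {(t, u). t \<in> T \<and> u \<in> S - T \<and> u < t} + card (S - T)"
        unfolding eq
      proof (subst card_Un_disjoint)
        show "card {(t, u). t \<in> T \<and> u \<in> S - T \<and> u < t} + card (Pair n ` (S - T)) =
           card {(t, u). t \<in> T \<and> u \<in> S - T \<and> u < t} + card (S - T)"
          by (simp add: card_image inj_on_def)
      qed (use T nS finS fin in auto)
      have d: "insert n S - insert n T = S - T" using nS by auto
      have "f (insert n T) \<in> carrier R" "g (S - T) \<in> carrier R"
        using T S by (auto intro!: fc gc)
      moreover have "T \<subseteq> {..<n}" "S - T \<subseteq> {..<n}" using T S by auto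
      ultimately show "F (insert n T) = (\<ominus> \<one>) [^] card {(t, u). t \<in> T \<and> u \<in> S - T \<and> u < t} \<otimes>
       (coord1 xs f T \<otimes> koszul_sign R xs (coord0 xs g) (S - T))"
        unfolding F_def card unfolding d sign_pow(2) koszul_sign_def len
        by (simp only: restrict_apply' PowI m_ac m_closed sign_pow(1))
    next
      show "(\<lambda>T. (\<ominus> \<one>) [^] card {(t, u). t \<in> T \<and> u \<in> S - T \<and> u < t} \<otimes>
       (coord1 xs f T \<otimes> koszul_sign R xs (coord0 xs g) (S - T))) \<in> Pow S \<rightarrow> carrier R"
      proof (intro Pi_I m_closed sign_pow)
        fix T assume "T \<in> Pow S"
        then have "T \<subseteq> {..<n}" "S - T \<subseteq> {..<n}" "insert n T \<subseteq> {..<Suc n}" "S - T \<subseteq> {..<Suc n}"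
          using S S' by auto
        then show "coord1 xs f T \<in> carrier R" "koszul_sign R xs (coord0 xs g) (S - T) \<in> carrier R"
          unfolding koszul_sign_def by (simp_all only: len restrict_apply' PowI fc gc m_closed sign_pow)
      qed
    qed simp
    finally have "(f \<otimes>\<^bsub>koszul R (xs @ [x])\<^esub> g) (insert n S) =
       (coord0 xs f \<otimes>\<^bsub>koszul R xs\<^esub> coord1 xs g) S \<oplus>
       (coord1 xs f \<otimes>\<^bsub>koszul R xs\<^esub> koszul_sign R xs (coord0 xs g)) S"
      unfolding koszul_mult_apply[of _ xs, unfolded len, OF S]
        koszul_mult_apply[of _ "xs @ [x]", unfolded len, OF S'] F_def .
    then show "?L S = ?R S"
      unfolding koszul_simps(4) using S by (simp add: len)
  qed
qed

lemma koszul_d_apply: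
  "S \<subseteq> {..<length xs} \<Longrightarrow> differential (koszul R xs) f S = (\<Oplus>i\<in>{..<length xs} - S.
     (\<ominus> \<one>) [^] card {j \<in> S. j < i} \<otimes> (xs ! i \<otimes> f (insert i S)))"
  by (simp add: koszul_simps)

text \<open>As n is the largest index, deleting it from \<open>insert n S\<close> costs the sign
  (-1)^|S|, while its presence does not change the position of any smaller index.\<close>

lemma coord_d:
  assumes f: "f \<in> carrier (koszul R (xs @ [x]))" and xs: "set (xs @ [x]) \<subseteq> carrier R"
  shows "coord0 xs (differential (koszul R (xs @ [x])) f) =
      differential (koszul R xs) (coord0 xs f) \<oplus>\<^bsub>koszul R xs\<^esub>
      koszul_scale R xs x (koszul_sign R xs (coord1 xs f))"
    and "coord1 xs (differential (koszul R (xs @ [x])) f) = differential (koszul R xs) (coord1 xs f)"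
proof -
  define n where "n = length xs"
  have fc: "f S \<in> carrier R" if "S \<subseteq> {..<Suc n}" for S
    using f that by (auto simp: koszul_simps n_def)
  have len: "length (xs @ [x]) = Suc n" "length xs = n" by (simp_all add: n_def)
  have xc: "xs ! i \<in> carrier R" if "i < n" for i using xs that by (auto simp: n_def)
  have x: "x \<in> carrier R" using xs by simp
  have nth: "(xs @ [x]) ! n = x" "i < n \<Longrightarrow> (xs @ [x]) ! i = xs ! i" for i
    by (simp_all add: n_def nth_append)
  show "coord0 xs (differential (koszul R (xs @ [x])) f) =
      differential (koszul R xs) (coord0 xs f) \<oplus>\<^bsub>koszul R xs\<^esub>
      koszul_scale R xs x (koszul_sign R xs (coord1 xs f))" (is "?L = ?R")
  proof (rule extensionalityI[of _ "Pow {..<n}"])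
    fix S assume "S \<in> Pow {..<n}"
    then have S: "S \<subseteq> {..<n}" and S': "S \<subseteq> {..<Suc n}" and nS: "insert n S \<subseteq> {..<Suc n}"
      by auto
    have e: "{..<Suc n} - S = insert n ({..<n} - S)" "{j \<in> S. j < n} = S" using S by auto
    have "differential (koszul R (xs @ [x])) f S =
      (\<Oplus>i\<in>insert n ({..<n} - S). (\<ominus> \<one>) [^] card {j \<in> S. j < i} \<otimes> ((xs @ [x]) ! i \<otimes> f (insert i S)))"
      by (rule koszul_d_apply[of _ "xs @ [x]", unfolded len, OF S', unfolded e])
    also have "\<dots> = (\<ominus> \<one>) [^] card S \<otimes> (x \<otimes> f (insert n S)) \<oplus>
      (\<Oplus>i\<in>{..<n} - S. (\<ominus> \<one>) [^] card {j \<in> S. j < i} \<otimes> ((xs @ [x]) ! i \<otimes> f (insert i S)))"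
    proof (subst finsum_insert)
      show "(\<lambda>i. (\<ominus> \<one>) [^] card {j \<in> S. j < i} \<otimes> ((xs @ [x]) ! i \<otimes> f (insert i S))) \<in> {..<n} - S \<rightarrow> carrier R"
        using S by (auto simp: nth intro!: xc fc m_closed)
    qed (use nS in \<open>auto simp: e nth intro!: x fc m_closed\<close>)
    also have "(\<Oplus>i\<in>{..<n} - S. (\<ominus> \<one>) [^] card {j \<in> S. j < i} \<otimes> ((xs @ [x]) ! i \<otimes> f (insert i S))) =
      (\<Oplus>i\<in>{..<n} - S. (\<ominus> \<one>) [^] card {j \<in> S. j < i} \<otimes> (xs ! i \<otimes> coord0 xs f (insert i S)))"
      using S S' by (intro finsum_cong') (auto simp: nth len intro!: xc fc m_closed)
    also have "\<dots> = differential (koszul R xs) (coord0 xs f) S"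
      by (rule koszul_d_apply[of _ xs, unfolded len, OF S, symmetric])
    finally have eq: "differential (koszul R (xs @ [x])) f S =
      (\<ominus> \<one>) [^] card S \<otimes> (x \<otimes> f (insert n S)) \<oplus> differential (koszul R xs) (coord0 xs f) S" .
    have "differential (koszul R xs) (coord0 xs f) S \<in> carrier R"
      unfolding koszul_d_apply[of _ xs, unfolded len, OF S]
      using S S' by (intro finsum_closed) (auto simp: len intro!: xc fc m_closed)
    then have "(\<ominus> \<one>) [^] card S \<otimes> (x \<otimes> f (insert n S)) \<oplus> differential (koszul R xs) (coord0 xs f) S
      = differential (koszul R xs) (coord0 xs f) S \<oplus> x \<otimes> ((\<ominus> \<one>) [^] card S \<otimes> f (insert n S))"
      using x fc[OF nS] by (metis a_comm m_lcomm m_closed sign_pow(1))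
    then show "?L S = ?R S"
      unfolding koszul_simps(4) koszul_scale_def koszul_sign_def len
      by (simp only: restrict_apply' PowI[OF S] eq len)
  qed (simp_all add: koszul_simps n_def)
  show "coord1 xs (differential (koszul R (xs @ [x])) f) = differential (koszul R xs) (coord1 xs f)"
    (is "?L = ?R")
  proof (rule extensionalityI[of _ "Pow {..<n}"])
    fix S assume "S \<in> Pow {..<n}"
    then have S: "S \<subseteq> {..<n}" and nS: "insert n S \<subseteq> {..<Suc n}"
      by auto
    have e: "{..<Suc n} - insert n S = {..<n} - S" using S by auto
    have "differential (koszul R (xs @ [x])) f (insert n S) =
      (\<Oplus>i\<in>{..<n} - S. (\<ominus> \<one>) [^] card {j \<in> insert n S. j < i} \<otimes> ((xs @ [x]) ! i \<otimes> f (insert i (insert n S))))"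
      by (rule koszul_d_apply[of _ "xs @ [x]", unfolded len, OF nS, unfolded e])
    also have "\<dots> = (\<Oplus>i\<in>{..<n} - S. (\<ominus> \<one>) [^] card {j \<in> S. j < i} \<otimes> (xs ! i \<otimes> coord1 xs f (insert i S)))"
    proof (rule finsum_cong')
      fix i assume i: "i \<in> {..<n} - S"
      have "{j \<in> insert n S. j < i} = {j \<in> S. j < i}" using i by auto
      then show "(\<ominus> \<one>) [^] card {j \<in> insert n S. j < i} \<otimes> ((xs @ [x]) ! i \<otimes> f (insert i (insert n S))) =
        (\<ominus> \<one>) [^] card {j \<in> S. j < i} \<otimes> (xs ! i \<otimes> coord1 xs f (insert i S))"
        using i S by (simp add: nth len insert_commute)
    qed (use S nS in \<open>auto simp: len intro!: xc fc m_closed\<close>)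
    also have "\<dots> = differential (koszul R xs) (coord1 xs f) S"
      by (rule koszul_d_apply[of _ xs, unfolded len, OF S, symmetric])
    finally show "?L S = ?R S"
      using S by (simp add: len)
  qed (simp_all add: koszul_simps n_def)
qed

lemma koszul_a_inv:
  assumes "f \<in> carrier (koszul R xs)"
  shows "\<ominus>\<^bsub>koszul R xs\<^esub> f = (\<lambda>S\<in>Pow {..<length xs}. \<ominus> f S)"
proof -
  interpret K: abelian_group "koszul R xs" by (rule koszul_abelian_group)
  show ?thesis
    by (rule K.minus_equality) (use assms in \<open>auto simp: koszul_simps l_neg PiE_iff intro!: restrict_ext\<close>)
qed

text \<open>Associativity, d d = 0 and the Leibniz rule are inherited from adjoining one generator
  at a time. The sums with inversion signs have to be split only in \<open>coord_mult\<close> and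
  \<open>coord_d\<close>.\<close>

lemma koszul_signed_dga:
  "set xs \<subseteq> carrier R \<Longrightarrow>
     signed_dga R (koszul R xs) (differential (koszul R xs)) (koszul_sign R xs) (koszul_scale R xs)"
proof (induction xs rule: rev_induct)
  case Nil
  let ?K = "koszul R []"
  interpret K: abelian_group ?K by (rule koszul_abelian_group)
  \<comment> \<open>Without generators only the coefficient at {} is left: the complex is R itself,
    with zero differential and trivial sign.\<close>
  have eqI: "f = g" if "f \<in> carrier ?K" "g \<in> carrier ?K" "f {} = g {}" for f g
    using that by (auto simp: koszul_simps PiE_iff intro: extensionalityI)
  note closed = koszul_closed[where xs = "[]", simplified]
  have fc: "f {} \<in> carrier R" if "f \<in> carrier ?K" for f
    using that by (auto simp: koszul_simps)
  have ev: "f {} \<in> carrier R" "(f \<otimes>\<^bsub>?K\<^esub> g) {} = f {} \<otimes> g {}" "(f \<oplus>\<^bsub>?K\<^esub> g) {} = f {} \<oplus> g {}"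
    "\<one>\<^bsub>?K\<^esub> {} = \<one>" "\<zero>\<^bsub>?K\<^esub> {} = \<zero>" "differential ?K f {} = \<zero>" "koszul_sign R [] f {} = f {}"
    "koszul_scale R [] a f {} = a \<otimes> f {}" "\<one>\<^bsub>?K\<^esub> \<in> carrier ?K" "(\<ominus>\<^bsub>?K\<^esub> f) {} = \<ominus> f {}"
    if f: "f \<in> carrier ?K" and g: "g \<in> carrier ?K" for a f g
  proof -
    show "f {} \<in> carrier R" by (rule fc[OF f])
    show "(f \<otimes>\<^bsub>?K\<^esub> g) {} = f {} \<otimes> g {}" using fc[OF f] fc[OF g] by (simp add: koszul_simps)
    show "(\<ominus>\<^bsub>?K\<^esub> f) {} = \<ominus> f {}" using f by (simp add: koszul_a_inv)
  qed (use f fc[OF f] in \<open>auto simp: koszul_simps koszul_sign_def koszul_scale_def\<close>)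
  note ev' = ev(1)[OF _ K.zero_closed] ev(2,3) ev(4,5)[OF K.zero_closed K.zero_closed]
    ev(6-8)[OF _ K.zero_closed] ev(9)[OF K.zero_closed K.zero_closed] ev(10)[OF _ K.zero_closed]
  have ring: "ring ?K"
  proof (intro ringI monoidI)
    fix f g h assume "f \<in> carrier ?K" "g \<in> carrier ?K" "h \<in> carrier ?K"
    then show "(f \<otimes>\<^bsub>?K\<^esub> g) \<otimes>\<^bsub>?K\<^esub> h = f \<otimes>\<^bsub>?K\<^esub> (g \<otimes>\<^bsub>?K\<^esub> h)"
      "(f \<oplus>\<^bsub>?K\<^esub> g) \<otimes>\<^bsub>?K\<^esub> h = (f \<otimes>\<^bsub>?K\<^esub> h) \<oplus>\<^bsub>?K\<^esub> (g \<otimes>\<^bsub>?K\<^esub> h)"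
      "h \<otimes>\<^bsub>?K\<^esub> (f \<oplus>\<^bsub>?K\<^esub> g) = (h \<otimes>\<^bsub>?K\<^esub> f) \<oplus>\<^bsub>?K\<^esub> (h \<otimes>\<^bsub>?K\<^esub> g)"
      "\<one>\<^bsub>?K\<^esub> \<otimes>\<^bsub>?K\<^esub> f = f" "f \<otimes>\<^bsub>?K\<^esub> \<one>\<^bsub>?K\<^esub> = f"
      by (auto intro!: eqI simp: closed ev' l_distr r_distr m_assoc)
  qed (simp_all add: closed ev' K.abelian_group_axioms)
  interpret K: ring ?K by fact
  show ?case
    by unfold_locales
      (simp_all add: closed, (rule eqI; simp add: closed ev' l_distr r_distr m_assoc m_lcomm)+)
next
  case (snoc x xs)
  then interpret B: signed_dga R "koszul R xs" "differential (koszul R xs)" "koszul_sign R xs" "koszul_scale R xs"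
    by simp
  have len: "length (xs @ [x]) = Suc (length xs)" by simp
  have xs: "set xs \<subseteq> carrier R" using snoc.prems by simp
  show ?case
  proof (rule B.signed_dga_extension[where ?p0.0 = "coord0 xs" and ?p1.0 = "coord1 xs" and x = x])
    show "x \<in> carrier R" using snoc.prems by simp
    show "abelian_group (koszul R (xs @ [x]))" by (rule koszul_abelian_group)
    show "\<one>\<^bsub>koszul R (xs @ [x])\<^esub> \<in> carrier (koszul R (xs @ [x]))"
      by (simp add: koszul_simps)
    show "coord0 xs \<one>\<^bsub>koszul R (xs @ [x])\<^esub> = \<one>\<^bsub>koszul R xs\<^esub>"
      "coord1 xs \<one>\<^bsub>koszul R (xs @ [x])\<^esub> = \<zero>\<^bsub>koszul R xs\<^esub>"
      "coord0 xs \<zero>\<^bsub>koszul R (xs @ [x])\<^esub> = \<zero>\<^bsub>koszul R xs\<^esub>"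
      "coord1 xs \<zero>\<^bsub>koszul R (xs @ [x])\<^esub> = \<zero>\<^bsub>koszul R xs\<^esub>"
      unfolding koszul_simps len by (auto intro!: restrict_ext simp: lessThan_Suc)
    fix f assume f: "f \<in> carrier (koszul R (xs @ [x]))"
    then have fc: "f S \<in> carrier R" if "S \<subseteq> {..<Suc (length xs)}" for S
      using that by (auto simp: koszul_simps)
    show f0: "coord0 xs f \<in> carrier (koszul R xs)" and f1: "coord1 xs f \<in> carrier (koszul R xs)"
      by (auto simp: koszul_simps intro!: fc)
    show "differential (koszul R (xs @ [x])) f \<in> carrier (koszul R (xs @ [x]))"
      "koszul_sign R (xs @ [x]) f \<in> carrier (koszul R (xs @ [x]))"
      by (rule koszul_closed[OF f snoc.prems])+
    show "coord0 xs (differential (koszul R (xs @ [x])) f) =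
      differential (koszul R xs) (coord0 xs f) \<oplus>\<^bsub>koszul R xs\<^esub>
      koszul_scale R xs x (koszul_sign R xs (coord1 xs f))"
      "coord1 xs (differential (koszul R (xs @ [x])) f) = differential (koszul R xs) (coord1 xs f)"
      by (rule coord_d[OF f snoc.prems])+
    show "coord0 xs (koszul_sign R (xs @ [x]) f) = koszul_sign R xs (coord0 xs f)"
      unfolding koszul_sign_def len by (rule restrict_ext) auto
    show "coord1 xs (koszul_sign R (xs @ [x]) f) = \<ominus>\<^bsub>koszul R xs\<^esub> koszul_sign R xs (coord1 xs f)"
    proof -
      have "(\<ominus> \<one>) [^] card (insert (length xs) S) \<otimes> f (insert (length xs) S) =
        \<ominus> ((\<ominus> \<one>) [^] card S \<otimes> f (insert (length xs) S))" if "S \<subseteq> {..<length xs}" for S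
      proof -
        have "length xs \<notin> S" "finite S" using that by (auto intro: finite_subset)
        then have c: "card (insert (length xs) S) = Suc (card S)" by simp
        show ?thesis
          unfolding c sign_pow(3) using that by (intro l_minus fc) auto
      qed
      then show ?thesis
        unfolding koszul_a_inv[OF koszul_closed(2)[OF f1 xs]] unfolding koszul_sign_def len
        by (intro restrict_ext) auto
    qed
    show "koszul_scale R (xs @ [x]) a f \<in> carrier (koszul R (xs @ [x]))" if "a \<in> carrier R" for a
      using koszul_closed(3)[OF f snoc.prems that] .
    show "coord0 xs (koszul_scale R (xs @ [x]) a f) = koszul_scale R xs a (coord0 xs f)"
      "coord1 xs (koszul_scale R (xs @ [x]) a f) = koszul_scale R xs a (coord1 xs f)" for a
      unfolding koszul_scale_def len by (rule restrict_ext, auto)+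
    fix g assume g: "g \<in> carrier (koszul R (xs @ [x]))"
    show "f \<otimes>\<^bsub>koszul R (xs @ [x])\<^esub> g \<in> carrier (koszul R (xs @ [x]))"
      by (rule koszul_closed(4)[OF f snoc.prems g])
    show "coord0 xs (f \<otimes>\<^bsub>koszul R (xs @ [x])\<^esub> g) = coord0 xs f \<otimes>\<^bsub>koszul R xs\<^esub> coord0 xs g"
      "coord1 xs (f \<otimes>\<^bsub>koszul R (xs @ [x])\<^esub> g) =
      (coord0 xs f \<otimes>\<^bsub>koszul R xs\<^esub> coord1 xs g) \<oplus>\<^bsub>koszul R xs\<^esub>
      (coord1 xs f \<otimes>\<^bsub>koszul R xs\<^esub> koszul_sign R xs (coord0 xs g))"
      by (rule coord_mult[OF f g])+
    show "coord0 xs (f \<oplus>\<^bsub>koszul R (xs @ [x])\<^esub> g) = coord0 xs f \<oplus>\<^bsub>koszul R xs\<^esub> coord0 xs g"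
      "coord1 xs (f \<oplus>\<^bsub>koszul R (xs @ [x])\<^esub> g) = coord1 xs f \<oplus>\<^bsub>koszul R xs\<^esub> coord1 xs g"
      unfolding koszul_simps len by (rule restrict_ext, auto)+
    show "f = g" if "coord0 xs f = coord0 xs g" "coord1 xs f = coord1 xs g"
      by (rule coord_eqI[OF f g that])
  qed
qed

end

section \<open>Trivial Massey operations make products of cycles boundaries\<close>

text \<open>The exponent in \<open>bar\<close> is given by a \<open>LEAST\<close>. Below it only
  matters that the factor is 1 or -1.\<close>

lemma (in ring) minus_one_pow_cases: "(\<ominus> \<one>) [^] (k::nat) \<in> {\<one>, \<ominus> \<one>}"
  by (induction k) (auto simp: l_minus r_minus)

context cring
begin

text \<open>Elements of degree zero are scalars and hence central. This lets coefficients from the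
  zeroth homology move past any cycle.\<close>

lemma koszul_degree_zero:
  assumes "c \<in> graded_part (koszul R xs) 0"
  shows "c = koszul_scale R xs (c {}) \<one>\<^bsub>koszul R xs\<^esub>"
proof (rule extensionalityI[of _ "Pow {..<length xs}"])
  fix S assume S: "S \<in> Pow {..<length xs}"
  then have "finite S" by (auto intro: finite_subset)
  moreover have "c {} \<in> carrier R" using assms by (auto simp: koszul_simps)
  moreover have "c S = \<zero>" if "S \<noteq> {}" using assms that S \<open>finite S\<close> by (auto simp: koszul_simps card_gt_0_iff)
  ultimately show "c S = koszul_scale R xs (c {}) \<one>\<^bsub>koszul R xs\<^esub> S"
    using S by (cases "S = {}") (simp_all add: koszul_scale_def koszul_simps(3))
qed (use assms in \<open>auto simp: koszul_scale_def koszul_simps PiE_iff\<close>)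

lemma graded_part_carrier: "f \<in> graded_part (koszul R xs) i \<Longrightarrow> f \<in> carrier (koszul R xs)"
  by (simp add: koszul_simps)

text \<open>For words of length two a trivial Massey operation says that products of the chosen
  representatives of basis classes are boundaries. Every class of positive degree is a combination
  of basis classes over the zeroth homology, and changing a cycle by a boundary changes a product
  with a cycle by a boundary. So the statement extends to arbitrary cycles, first in the left factor
  and then in the right one.\<close>

lemma massey_products_boundaries:
  assumes xs: "set xs \<subseteq> carrier R"
    and adm: "admits_trivial_massey_operation (koszul R xs)"
    and z: "z \<in> cycles (koszul R xs)" "z \<in> graded_part (koszul R xs) i" "1 \<le> i"
    and z': "z' \<in> cycles (koszul R xs)" "z' \<in> graded_part (koszul R xs) j" "1 \<le> j"
  shows "z \<otimes>\<^bsub>koszul R xs\<^esub> z' \<in> boundaries (koszul R xs)"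
proof -
  define K where "K = koszul R xs"
  interpret D: signed_dga R K "differential K" "koszul_sign R xs" "koszul_scale R xs"
    unfolding K_def by (rule koszul_signed_dga[OF xs])
  have cyc: "w \<in> cycles K \<longleftrightarrow> w \<in> carrier K \<and> differential K w = \<zero>\<^bsub>K\<^esub>" for w
    by (simp add: cycles_def)
  have bdI: "differential K w \<in> boundaries K" if "w \<in> carrier K" for w
    using that by (simp add: boundaries_def)
  have bdE: "\<exists>w\<in>carrier K. b = differential K w" if "b \<in> boundaries K" for b
    using that by (auto simp: boundaries_def)
  have bd_mult: "b \<otimes>\<^bsub>K\<^esub> w \<in> boundaries K" "w \<otimes>\<^bsub>K\<^esub> b \<in> boundaries K"
    if b: "b \<in> boundaries K" and w: "w \<in> cycles K" for b w
  proof -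
    obtain v where v: "v \<in> carrier K" "b = differential K v" using bdE[OF b] by blast
    have w: "w \<in> carrier K" "differential K w = \<zero>\<^bsub>K\<^esub>" using w cyc by auto
    have "differential K (v \<otimes>\<^bsub>K\<^esub> w) = b \<otimes>\<^bsub>K\<^esub> w" using v w by (simp add: D.d_mult)
    then show "b \<otimes>\<^bsub>K\<^esub> w \<in> boundaries K" using bdI[of "v \<otimes>\<^bsub>K\<^esub> w"] v w by simp
    \<comment> \<open>The primitive is \<tau>(w) v rather than w v, so that the Leibniz rule yields
      w b without a sign.\<close>
    have "differential K (koszul_sign R xs w \<otimes>\<^bsub>K\<^esub> v) = w \<otimes>\<^bsub>K\<^esub> b"
      using v w by (simp add: D.d_mult D.d_sign)
    then show "w \<otimes>\<^bsub>K\<^esub> b \<in> boundaries K" using bdI[of "koszul_sign R xs w \<otimes>\<^bsub>K\<^esub> v"] v w by simp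
  qed
  have bd_zero: "\<zero>\<^bsub>K\<^esub> \<in> boundaries K" using bdI[OF D.B.zero_closed] by simp
  have bd_add: "b \<oplus>\<^bsub>K\<^esub> b' \<in> boundaries K" if "b \<in> boundaries K" "b' \<in> boundaries K" for b b'
    using bdE[OF that(1)] bdE[OF that(2)] bdI by (metis D.d_add D.B.a_closed)
  have bd_minus: "\<ominus>\<^bsub>K\<^esub> b \<in> boundaries K" if "b \<in> boundaries K" for b
    using bdE[OF that] bdI by (metis D.d_minus D.B.a_inv_closed)
  have bd_cyc: "b \<in> cycles K" if "b \<in> boundaries K" for b
    using that by (auto simp: cyc dest!: bdE)
  define Z where "Z = K\<lparr>carrier := cycles K\<rparr>"
  have sub: "subring (cycles K) K"
    by (rule D.B.subringI) (auto simp: cyc D.d_minus D.d_mult D.d_add D.d_sign,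
       use D.d_mult[of "\<one>\<^bsub>K\<^esub>" "\<one>\<^bsub>K\<^esub>"] D.B.add.l_cancel_one' in force)
  interpret Z: ring Z unfolding Z_def by (rule D.B.subring_is_ring[OF sub])
  have Zs: "carrier Z = cycles K" "monoid.mult Z = monoid.mult K" "ring.add Z = ring.add K"
    "ring.zero Z = ring.zero K" "monoid.one Z = monoid.one K"
    by (simp_all add: Z_def)
  have idl: "ideal (boundaries K) Z"
  proof (rule idealI[OF Z.ring_axioms])
    show "subgroup (boundaries K) (add_monoid Z)"
    proof (rule Z.add.subgroupI)
      show "boundaries K \<subseteq> carrier Z" using bd_cyc by (auto simp: Zs)
      show "boundaries K \<noteq> {}" using bd_zero by blast
      fix a assume a: "a \<in> boundaries K"
      have "\<ominus>\<^bsub>Z\<^esub> a = \<ominus>\<^bsub>K\<^esub> a"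
        by (rule Z.minus_equality) (use a bd_cyc bd_minus in \<open>auto simp: Zs cyc D.B.l_neg\<close>)
      then show "\<ominus>\<^bsub>Z\<^esub> a \<in> boundaries K" using bd_minus[OF a] by simp
    qed (simp add: Zs bd_add)
  qed (simp_all add: Zs bd_mult)
  interpret I: ideal "boundaries K" Z by fact
  have hom: "homology K = Z Quot boundaries K" by (simp add: homology_def Z_def)
  interpret H: ring "homology K" unfolding hom by (rule I.quotient_is_ring)
  have hc: "homology_class K w = boundaries K +>\<^bsub>Z\<^esub> w" for w
    by (simp add: homology_class_def a_r_coset_def r_coset_def Zs)
  note h = I.rcos_ring_hom[folded hom]
  have h_mult: "homology_class K v \<otimes>\<^bsub>homology K\<^esub> homology_class K w = homology_class K (v \<otimes>\<^bsub>K\<^esub> w)"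
    and h_add: "homology_class K v \<oplus>\<^bsub>homology K\<^esub> homology_class K w = homology_class K (v \<oplus>\<^bsub>K\<^esub> w)"
    if "v \<in> cycles K" "w \<in> cycles K" for v w
    using ring_hom_mult[OF h] ring_hom_add[OF h] that by (simp_all add: hc Zs)
  have h_zero: "\<zero>\<^bsub>homology K\<^esub> = homology_class K \<zero>\<^bsub>K\<^esub>"
    using ring_hom_zero[OF h Z.ring_axioms H.ring_axioms] by (simp add: hc Zs)
  have h_eq: "\<exists>b\<in>boundaries K. v = w \<oplus>\<^bsub>K\<^esub> b"
    if "v \<in> cycles K" "w \<in> cycles K" "homology_class K v = homology_class K w" for v w
  proof -
    have "v \<in> boundaries K +>\<^bsub>Z\<^esub> v"
      using I.a_rcos_self[of v] that by (simp add: Zs)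
    then have "v \<in> boundaries K +>\<^bsub>Z\<^esub> w" using that hc by simp
    then obtain b where "b \<in> boundaries K" "v = b \<oplus>\<^bsub>K\<^esub> w"
      by (auto simp: a_r_coset_def r_coset_def Zs)
    then show ?thesis using that bd_cyc D.B.a_comm cyc by metis
  qed
  obtain S \<mu> where S: "homogeneous_basis K S" and mu: "trivial_massey_operation K S \<mu>"
    using adm unfolding admits_trivial_massey_operation_def K_def by blast
  have mu_cyc: "\<mu> [h] \<in> cycles K" "homology_class K (\<mu> [h]) = h" if "h \<in> S" for h
    using mu that by (auto simp: trivial_massey_operation_def)
  \<comment> \<open>Induction over a linear combination of basis classes, for an arbitrary property
    P of representing cycles that is stable under the operations involved. It is applied once to
    each factor of the product.\<close>
  have span: "\<exists>w. w \<in> cycles K \<and> homology_class K w = v \<and> P w"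
    if "v \<in> ring.Span (homology K) (homology_part K 0) us" "set us \<subseteq> S"
      and zero: "P \<zero>\<^bsub>K\<^esub>"
      and add: "\<And>v w. v \<in> cycles K \<Longrightarrow> w \<in> cycles K \<Longrightarrow> P v \<Longrightarrow> P w \<Longrightarrow> P (v \<oplus>\<^bsub>K\<^esub> w)"
      and mult: "\<And>c w. c \<in> cycles K \<inter> graded_part K 0 \<Longrightarrow> w \<in> cycles K \<Longrightarrow> P w \<Longrightarrow> P (c \<otimes>\<^bsub>K\<^esub> w)"
      and base: "\<And>h. h \<in> S \<Longrightarrow> P (\<mu> [h])"
    for P us v
    using that(1,2)
  proof (induction us arbitrary: v)
    case Nil
    then have "v = homology_class K \<zero>\<^bsub>K\<^esub>" by (simp add: h_zero)
    then show ?case using zero cyc by auto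
  next
    case (Cons u us)
    have u: "u \<in> S" using Cons.prems by simp
    obtain k v' where k: "k \<in> homology_part K 0" and v': "v' \<in> H.Span (homology_part K 0) us"
      and v: "v = k \<otimes>\<^bsub>homology K\<^esub> u \<oplus>\<^bsub>homology K\<^esub> v'"
      using Cons.prems(1) by (auto simp: H.line_extension_mem_iff)
    obtain w' where w': "w' \<in> cycles K" "homology_class K w' = v'" "P w'"
      using Cons.IH[OF v'] Cons.prems by auto
    obtain c where c: "c \<in> cycles K \<inter> graded_part K 0" "k = homology_class K c"
      using k by (auto simp: homology_part_def)
    let ?w = "c \<otimes>\<^bsub>K\<^esub> \<mu> [u] \<oplus>\<^bsub>K\<^esub> w'"
    have m: "c \<otimes>\<^bsub>K\<^esub> \<mu> [u] \<in> cycles K"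
      using c mu_cyc[OF u] cyc by (auto simp: D.d_mult)
    have "homology_class K ?w = v"
      using c w' m mu_cyc[OF u] by (simp add: v flip: h_mult h_add)
    moreover have "P ?w" using add[OF m w'(1) mult[OF c(1) mu_cyc(1)[OF u] base[OF u]] w'(3)] .
    moreover have "?w \<in> cycles K" using m w'(1) cyc by (auto simp: D.d_add)
    ultimately show ?case by blast
  qed
  have in_span: "\<exists>us. set us \<subseteq> S \<and> homology_class K w \<in> ring.Span (homology K) (homology_part K 0) us"
    if "w \<in> cycles K" "w \<in> graded_part K n" "1 \<le> n" for w n
  proof -
    have "homology_class K w \<in> homology_pos K"
      unfolding homology_pos_def homology_part_def
      by (rule generate.incl) (use that in auto)
    then show ?thesis using S unfolding homogeneous_basis_def is_basis_def by blast
  qed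
  have base: "\<mu> [h] \<otimes>\<^bsub>K\<^esub> \<mu> [h'] \<in> boundaries K" if "h \<in> S" "h' \<in> S" for h h'
  proof -
    let ?e = "(\<ominus>\<^bsub>K\<^esub> \<one>\<^bsub>K\<^esub>) [^]\<^bsub>K\<^esub> ((LEAST i. \<mu> [h] \<in> graded_part K i) + 1)"
    have c: "\<mu> [h] \<in> carrier K" "\<mu> [h'] \<in> carrier K" using mu_cyc that cyc by auto
    have mc: "\<mu> [h, h'] \<in> carrier K"
      using mu that graded_part_carrier unfolding trivial_massey_operation_def K_def
      by (metis (no_types, lifting) UN_E empty_subsetI insert_subset list.distinct(1) list.set)
    \<comment> \<open>A word of length two contributes the single term j = 1, so the product of two
      representatives is a boundary up to sign.\<close>
    have "differential K (\<mu> [h, h']) =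
      (\<Oplus>\<^bsub>K\<^esub>j\<in>{1..length [h, h'] - 1}. bar K (\<mu> (take j [h, h'])) \<otimes>\<^bsub>K\<^esub> \<mu> (drop j [h, h']))"
      using mu that unfolding trivial_massey_operation_def by simp
    also have "\<dots> = bar K (\<mu> [h]) \<otimes>\<^bsub>K\<^esub> \<mu> [h']"
      using c by (simp add: bar_def)
    also have "\<dots> = ?e \<otimes>\<^bsub>K\<^esub> (\<mu> [h] \<otimes>\<^bsub>K\<^esub> \<mu> [h'])"
      using c by (simp add: bar_def D.B.m_assoc)
    finally have eq: "differential K (\<mu> [h, h']) = ?e \<otimes>\<^bsub>K\<^esub> (\<mu> [h] \<otimes>\<^bsub>K\<^esub> \<mu> [h'])" .
    have "?e = \<one>\<^bsub>K\<^esub> \<or> ?e = \<ominus>\<^bsub>K\<^esub> \<one>\<^bsub>K\<^esub>" using D.B.minus_one_pow_cases by blast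
    then show ?thesis
    proof
      assume e: "?e = \<one>\<^bsub>K\<^esub>"
      show ?thesis using eq[unfolded e] bdI[OF mc] c by simp
    next
      assume e: "?e = \<ominus>\<^bsub>K\<^esub> \<one>\<^bsub>K\<^esub>"
      have "differential K (\<mu> [h, h']) = \<ominus>\<^bsub>K\<^esub> (\<mu> [h] \<otimes>\<^bsub>K\<^esub> \<mu> [h'])"
        using eq[unfolded e] c by (simp add: D.B.l_minus)
      then show ?thesis using bd_minus[OF bdI[OF mc]] c by simp
    qed
  qed
  have step1: "w \<otimes>\<^bsub>K\<^esub> \<mu> [h] \<in> boundaries K"
    if w: "w \<in> cycles K" "w \<in> graded_part K n" "1 \<le> n" and h: "h \<in> S" for w n h
  proof -
    have hh: "\<mu> [h] \<in> cycles K" using mu_cyc h by blast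
    obtain us where us: "set us \<subseteq> S" "homology_class K w \<in> ring.Span (homology K) (homology_part K 0) us"
      using in_span[OF w] by blast
    have "\<exists>v. v \<in> cycles K \<and> homology_class K v = homology_class K w \<and> v \<otimes>\<^bsub>K\<^esub> \<mu> [h] \<in> boundaries K"
    proof (rule span[OF us(2,1)])
      show "\<zero>\<^bsub>K\<^esub> \<otimes>\<^bsub>K\<^esub> \<mu> [h] \<in> boundaries K" using hh cyc bd_zero by simp
      show "(v \<oplus>\<^bsub>K\<^esub> w) \<otimes>\<^bsub>K\<^esub> \<mu> [h] \<in> boundaries K"
        if "v \<in> cycles K" "w \<in> cycles K" "v \<otimes>\<^bsub>K\<^esub> \<mu> [h] \<in> boundaries K" "w \<otimes>\<^bsub>K\<^esub> \<mu> [h] \<in> boundaries K" for v w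
        using that hh cyc bd_add by (simp add: D.B.l_distr)
      show "(c \<otimes>\<^bsub>K\<^esub> w) \<otimes>\<^bsub>K\<^esub> \<mu> [h] \<in> boundaries K"
        if "c \<in> cycles K \<inter> graded_part K 0" "w \<in> cycles K" "w \<otimes>\<^bsub>K\<^esub> \<mu> [h] \<in> boundaries K" for c w
        using that hh cyc bd_mult by (simp add: D.B.m_assoc)
    qed (rule base[OF _ h])
    then obtain v where v: "v \<in> cycles K" "homology_class K v = homology_class K w"
      "v \<otimes>\<^bsub>K\<^esub> \<mu> [h] \<in> boundaries K" by blast
    obtain b where "b \<in> boundaries K" "w = v \<oplus>\<^bsub>K\<^esub> b" using h_eq[OF w(1) v(1)] v(2) by auto
    then show ?thesis using v hh bd_add bd_mult bd_cyc cyc by (simp add: D.B.l_distr)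
  qed
  note zK = z[folded K_def] and z'K = z'[folded K_def]
  obtain us where us: "set us \<subseteq> S" "homology_class K z' \<in> ring.Span (homology K) (homology_part K 0) us"
    using in_span[OF z'K] by blast
  have "\<exists>v. v \<in> cycles K \<and> homology_class K v = homology_class K z' \<and> z \<otimes>\<^bsub>K\<^esub> v \<in> boundaries K"
  proof (rule span[OF us(2,1)])
    show "z \<otimes>\<^bsub>K\<^esub> \<zero>\<^bsub>K\<^esub> \<in> boundaries K" using zK cyc bd_zero by simp
    show "z \<otimes>\<^bsub>K\<^esub> (v \<oplus>\<^bsub>K\<^esub> w) \<in> boundaries K"
      if "v \<in> cycles K" "w \<in> cycles K" "z \<otimes>\<^bsub>K\<^esub> v \<in> boundaries K" "z \<otimes>\<^bsub>K\<^esub> w \<in> boundaries K" for v w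
      using that zK cyc bd_add by (simp add: D.B.r_distr)
    show "z \<otimes>\<^bsub>K\<^esub> (c \<otimes>\<^bsub>K\<^esub> w) \<in> boundaries K"
      if c: "c \<in> cycles K \<inter> graded_part K 0" and w: "w \<in> cycles K" "z \<otimes>\<^bsub>K\<^esub> w \<in> boundaries K" for c w
    proof -
      have zw: "z \<in> carrier K" "w \<in> carrier K" "c {} \<in> carrier R"
        using zK w c cyc by (auto simp: K_def koszul_simps)
      have ce: "c = koszul_scale R xs (c {}) \<one>\<^bsub>K\<^esub>"
        using koszul_degree_zero c unfolding K_def by blast
      have "z \<otimes>\<^bsub>K\<^esub> (c \<otimes>\<^bsub>K\<^esub> w) = c \<otimes>\<^bsub>K\<^esub> (z \<otimes>\<^bsub>K\<^esub> w)"
        using zw by (subst (1 2) ce) (simp add: D.scale_mult_left D.scale_mult_right)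
      then show ?thesis using c w bd_mult by auto
    qed
  qed (rule step1[OF zK])
  then obtain v where v: "v \<in> cycles K" "homology_class K v = homology_class K z'"
    "z \<otimes>\<^bsub>K\<^esub> v \<in> boundaries K" by blast
  obtain b where "b \<in> boundaries K" "z' = v \<oplus>\<^bsub>K\<^esub> b" using h_eq[OF z'K(1) v(1)] v(2) by auto
  then show ?thesis using v zK bd_add bd_mult bd_cyc cyc by (simp add: D.B.r_distr flip: K_def)
qed

end

lemma (in abelian_group) add_eq_add_imp:
  assumes "a \<oplus> b = c \<oplus> e" "a \<in> carrier G" "b \<in> carrier G" "c \<in> carrier G" "e \<in> carrier G"
  shows "b \<oplus> \<ominus> e = c \<oplus> \<ominus> a"
proof -
  have "b = \<ominus> a \<oplus> (c \<oplus> e)" using assms r_neg1 by metis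
  then have "b \<oplus> \<ominus> e = \<ominus> a \<oplus> (c \<oplus> (e \<oplus> \<ominus> e))" using assms by (simp only: a_assoc a_closed a_inv_closed)
  then show ?thesis using assms by (simp add: r_neg a_comm)
qed

section \<open>Koszul complexes modulo an ideal\<close>

context cring
begin

lemma finsum_ideal:
  assumes "ideal Q R" "f \<in> A \<rightarrow> Q"
  shows "(\<Oplus>i\<in>A. f i) \<in> Q"
proof -
  interpret Q: ideal Q R by fact
  show ?thesis
    using assms(2)
  proof (induction A rule: infinite_finite_induct)
    case (insert a A)
    then have "f \<in> A \<rightarrow> carrier R" "f a \<in> carrier R" by (auto intro: Q.Icarr)
    then show ?case using insert by (simp add: Q.a_closed)
  qed auto
qed

definition adjoin :: "'a set \<Rightarrow> 'a \<Rightarrow> 'a set" where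
  "adjoin Q c = {q \<oplus> c \<otimes> s |q s. q \<in> Q \<and> s \<in> carrier R}"

lemma adjoinI: "q \<in> Q \<Longrightarrow> s \<in> carrier R \<Longrightarrow> q \<oplus> c \<otimes> s \<in> adjoin Q c"
  by (auto simp: adjoin_def)

lemma adjoinE:
  assumes "x \<in> adjoin Q c"
  obtains q s where "q \<in> Q" "s \<in> carrier R" "x = q \<oplus> c \<otimes> s"
  using assms by (auto simp: adjoin_def)

lemma adjoin_ideal:
  assumes "ideal Q R" "c \<in> carrier R"
  shows "ideal (adjoin Q c) R"
proof -
  interpret Q: ideal Q R by fact
  have mult: "x \<otimes> a \<in> adjoin Q c" if a: "a \<in> adjoin Q c" and x: "x \<in> carrier R" for a x
  proof -
    obtain q s where "q \<in> Q" "s \<in> carrier R" "a = q \<oplus> c \<otimes> s" using a by (auto simp: adjoin_def)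
    then have "x \<otimes> a = x \<otimes> q \<oplus> c \<otimes> (x \<otimes> s)" "x \<otimes> q \<in> Q" "x \<otimes> s \<in> carrier R"
      using x assms(2) Q.Icarr by (simp_all add: r_distr m_lcomm Q.I_l_closed)
    then show ?thesis unfolding adjoin_def by blast
  qed
  have carr: "adjoin Q c \<subseteq> carrier R" using assms(2) Q.Icarr by (auto simp: adjoin_def)
  show ?thesis
  proof (rule idealI[OF ring_axioms])
    show "subgroup (adjoin Q c) (add_monoid R)"
    proof (rule add.subgroupI)
      show "adjoin Q c \<subseteq> carrier R" by fact
      have "\<zero> \<oplus> c \<otimes> \<zero> \<in> adjoin Q c" unfolding adjoin_def using Q.zero_closed by blast
      then show "adjoin Q c \<noteq> {}" by blast
      show "\<ominus> a \<in> adjoin Q c" if "a \<in> adjoin Q c" for a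
        using mult[OF that, of "\<ominus> \<one>"] that carr by (auto simp: l_minus)
      fix a b assume "a \<in> adjoin Q c" "b \<in> adjoin Q c"
      then obtain q s q' s' where "q \<in> Q" "s \<in> carrier R" "a = q \<oplus> c \<otimes> s"
        "q' \<in> Q" "s' \<in> carrier R" "b = q' \<oplus> c \<otimes> s'" by (auto simp: adjoin_def)
      then have "a \<oplus> b = (q \<oplus> q') \<oplus> c \<otimes> (s \<oplus> s')" "q \<oplus> q' \<in> Q" "s \<oplus> s' \<in> carrier R"
        using assms(2) Q.Icarr by (simp_all add: r_distr a_ac)
      then show "a \<oplus> b \<in> adjoin Q c" unfolding adjoin_def by blast
    qed
    show "x \<otimes> a \<in> adjoin Q c" "a \<otimes> x \<in> adjoin Q c" if "a \<in> adjoin Q c" "x \<in> carrier R" for a x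
      using mult[OF that] that carr by (auto simp: m_comm)
  qed
qed

lemma adjoin_memI:
  assumes "ideal Q R" "c \<in> carrier R"
  shows "q \<in> Q \<Longrightarrow> q \<in> adjoin Q c" "s \<in> carrier R \<Longrightarrow> c \<otimes> s \<in> adjoin Q c" "c \<in> adjoin Q c"
proof -
  interpret Q: ideal Q R by fact
  show "q \<in> adjoin Q c" if "q \<in> Q"
    using adjoinI[OF that, of \<zero> c] assms(2) Q.Icarr[OF that] by simp
  show s: "c \<otimes> s \<in> adjoin Q c" if "s \<in> carrier R" for s
    using adjoinI[OF Q.zero_closed that, of c] assms(2) that by simp
  show "c \<in> adjoin Q c" using s[of \<one>] assms(2) by simp
qed

lemma Idl_insert_eq_adjoin:
  assumes "A \<subseteq> carrier R" "c \<in> carrier R"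
  shows "Idl (insert c A) = adjoin (Idl A) c"
proof
  have A: "ideal (Idl A) R" using assms(1) by (rule genideal_ideal)
  show "Idl (insert c A) \<subseteq> adjoin (Idl A) c"
    using adjoin_memI[OF A assms(2)] genideal_self[OF assms(1)]
    by (intro genideal_minimal adjoin_ideal A assms) auto
  have B: "ideal (Idl (insert c A)) R" using assms by (intro genideal_ideal) auto
  interpret B: ideal "Idl (insert c A)" R by fact
  have "Idl A \<subseteq> Idl (insert c A)" using assms by (intro subset_Idl_subset) auto
  moreover have "c \<in> Idl (insert c A)" using assms by (intro subsetD[OF genideal_self]) auto
  ultimately show "adjoin (Idl A) c \<subseteq> Idl (insert c A)"
    by (auto simp: adjoin_def intro!: B.a_closed B.I_r_closed)
qed

text \<open>This is Q K(x; R), the kernel of reduction to K(x; R/Q). Working modulo it replaces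
  Koszul complexes over factor rings by congruences in one fixed complex.\<close>

definition koszul_ideal :: "'a list \<Rightarrow> 'a set \<Rightarrow> (nat set \<Rightarrow> 'a) set" where
  "koszul_ideal xs Q = {f \<in> carrier (koszul R xs). \<forall>S\<subseteq>{..<length xs}. f S \<in> Q}"

lemma koszul_carrierD: "f \<in> carrier (koszul R xs) \<Longrightarrow> S \<subseteq> {..<length xs} \<Longrightarrow> f S \<in> carrier R"
  by (auto simp: koszul_simps)

lemma koszul_eqI:
  assumes "f \<in> carrier (koszul R xs)" "g \<in> carrier (koszul R xs)"
    and "\<And>S. S \<subseteq> {..<length xs} \<Longrightarrow> f S = g S"
  shows "f = g"
  by (rule PiE_ext[of _ "Pow {..<length xs}" "\<lambda>_. carrier R"]) (use assms in \<open>auto simp: koszul_simps\<close>)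

lemma koszul_add_apply: "S \<subseteq> {..<length xs} \<Longrightarrow> (f \<oplus>\<^bsub>koszul R xs\<^esub> g) S = f S \<oplus> g S"
  by (simp add: koszul_simps)

lemma koszul_minus_apply:
  "f \<in> carrier (koszul R xs) \<Longrightarrow> S \<subseteq> {..<length xs} \<Longrightarrow> (\<ominus>\<^bsub>koszul R xs\<^esub> f) S = \<ominus> f S"
  by (simp add: koszul_a_inv)

lemma koszul_scale_apply: "S \<subseteq> {..<length xs} \<Longrightarrow> koszul_scale R xs a f S = a \<otimes> f S"
  by (simp add: koszul_scale_def)

lemma koszul_sign_apply: "S \<subseteq> {..<length xs} \<Longrightarrow> koszul_sign R xs f S = (\<ominus> \<one>) [^] card S \<otimes> f S"
  by (simp add: koszul_sign_def)

lemma koszul_scale_by_add: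
  assumes "a \<in> carrier R" "b \<in> carrier R" "f \<in> carrier (koszul R xs)"
  shows "koszul_scale R xs (a \<oplus> b) f = koszul_scale R xs a f \<oplus>\<^bsub>koszul R xs\<^esub> koszul_scale R xs b f"
  unfolding koszul_simps(4)
  using koszul_carrierD[OF assms(3)] assms(1,2)
  by (auto simp: koszul_scale_def l_distr intro!: restrict_ext)

lemma koszul_ideal_closed:
  assumes Q: "ideal Q R" and xs: "set xs \<subseteq> carrier R"
    and f: "f \<in> koszul_ideal xs Q" and g: "g \<in> carrier (koszul R xs)"
  shows "f \<in> carrier (koszul R xs)"
    and "differential (koszul R xs) f \<in> koszul_ideal xs Q"
    and "koszul_sign R xs f \<in> koszul_ideal xs Q"
    and "\<ominus>\<^bsub>koszul R xs\<^esub> f \<in> koszul_ideal xs Q"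
    and "f \<otimes>\<^bsub>koszul R xs\<^esub> g \<in> koszul_ideal xs Q"
    and "h \<in> koszul_ideal xs Q \<Longrightarrow> f \<oplus>\<^bsub>koszul R xs\<^esub> h \<in> koszul_ideal xs Q"
proof -
  interpret Q: ideal Q R by fact
  interpret D: signed_dga R "koszul R xs" "differential (koszul R xs)" "koszul_sign R xs" "koszul_scale R xs"
    by (rule koszul_signed_dga[OF xs])
  have f': "f \<in> carrier (koszul R xs)" and fQ: "\<And>S. S \<subseteq> {..<length xs} \<Longrightarrow> f S \<in> Q"
    using f by (auto simp: koszul_ideal_def)
  show "f \<in> carrier (koszul R xs)" by fact
  have x: "xs ! i \<in> carrier R" if "i < length xs" for i using xs that by auto
  show "differential (koszul R xs) f \<in> koszul_ideal xs Q"
    unfolding koszul_ideal_def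
  proof (intro CollectI conjI allI impI)
    fix S assume S: "S \<subseteq> {..<length xs}"
    show "differential (koszul R xs) f S \<in> Q"
      unfolding koszul_d_apply[OF S]
      by (intro finsum_ideal[OF Q] Pi_I Q.I_l_closed sign_pow fQ x) (use S in auto)
  qed (use f' in simp)
  show "koszul_sign R xs f \<in> koszul_ideal xs Q"
    unfolding koszul_ideal_def using f' by (simp add: koszul_sign_apply fQ Q.I_l_closed)
  show "\<ominus>\<^bsub>koszul R xs\<^esub> f \<in> koszul_ideal xs Q"
    unfolding koszul_ideal_def using f' by (simp add: koszul_minus_apply fQ Q.a_inv_closed)
  show "f \<oplus>\<^bsub>koszul R xs\<^esub> h \<in> koszul_ideal xs Q" if "h \<in> koszul_ideal xs Q"
    using that f' unfolding koszul_ideal_def by (auto simp: koszul_add_apply fQ)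
  show "f \<otimes>\<^bsub>koszul R xs\<^esub> g \<in> koszul_ideal xs Q"
    unfolding koszul_ideal_def
  proof (intro CollectI conjI allI impI)
    fix S assume S: "S \<subseteq> {..<length xs}"
    show "(f \<otimes>\<^bsub>koszul R xs\<^esub> g) S \<in> Q"
      unfolding koszul_mult_apply[OF S]
      by (intro finsum_ideal[OF Q] Pi_I Q.I_l_closed Q.I_r_closed sign_pow fQ koszul_carrierD[OF g])
        (use S in auto)
  qed (use f' g in simp)
qed

lemma koszul_ideal_zero: "ideal Q R \<Longrightarrow> \<zero>\<^bsub>koszul R xs\<^esub> \<in> koszul_ideal xs Q"
  by (auto simp: koszul_ideal_def koszul_simps(1,2) ideal.axioms(1) additive_subgroup.zero_closed)

lemma koszul_ideal_add_decomp:
  assumes f: "f \<in> koszul_ideal xs (adjoin Q g)" and g: "g \<in> carrier R" and Q: "ideal Q R"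
  obtains q w where "q \<in> koszul_ideal xs Q" "w \<in> carrier (koszul R xs)"
    "f = q \<oplus>\<^bsub>koszul R xs\<^esub> koszul_scale R xs g w"
    "\<And>i. f \<in> graded_part (koszul R xs) i \<Longrightarrow> w \<in> graded_part (koszul R xs) i"
proof -
  interpret Q: ideal Q R by fact
  \<comment> \<open>Where f vanishes, the multiplier is chosen to be 0. This makes the second
    summand inherit the degree of f.\<close>
  have "\<exists>w s. f S = w \<oplus> g \<otimes> s \<and> w \<in> Q \<and> s \<in> carrier R \<and> (f S = \<zero> \<longrightarrow> s = \<zero>)"
    if S: "S \<subseteq> {..<length xs}" for S
  proof (cases "f S = \<zero>")
    case True
    then show ?thesis using g by (intro exI[of _ "\<zero>"]) simp
  next
    case False
    have "f S \<in> adjoin Q g" using f S by (auto simp: koszul_ideal_def)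
    then show ?thesis using False by (auto elim!: adjoinE)
  qed
  then obtain w s where ws: "\<And>S. S \<subseteq> {..<length xs} \<Longrightarrow>
      f S = w S \<oplus> g \<otimes> s S \<and> w S \<in> Q \<and> s S \<in> carrier R \<and> (f S = \<zero> \<longrightarrow> s S = \<zero>)"
    by metis
  let ?w = "\<lambda>S\<in>Pow {..<length xs}. w S" and ?s = "\<lambda>S\<in>Pow {..<length xs}. s S"
  have s: "?s \<in> carrier (koszul R xs)" using ws by (auto simp: koszul_simps)
  show ?thesis
  proof (rule that[of ?w ?s])
    show w: "?w \<in> koszul_ideal xs Q" using ws by (auto simp: koszul_ideal_def koszul_simps)
    show "?s \<in> carrier (koszul R xs)" by fact
    show "f = ?w \<oplus>\<^bsub>koszul R xs\<^esub> koszul_scale R xs g ?s"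
    proof (rule koszul_eqI)
      show "f \<in> carrier (koszul R xs)" using f by (auto simp: koszul_ideal_def)
      show "?w \<oplus>\<^bsub>koszul R xs\<^esub> koszul_scale R xs g ?s \<in> carrier (koszul R xs)"
        using ws g by (auto simp: koszul_simps koszul_scale_def)
      show "f S = (?w \<oplus>\<^bsub>koszul R xs\<^esub> koszul_scale R xs g ?s) S" if "S \<subseteq> {..<length xs}" for S
        using that ws by (simp add: koszul_add_apply koszul_scale_apply)
    qed
    show "?s \<in> graded_part (koszul R xs) i" if "f \<in> graded_part (koszul R xs) i" for i
    proof -
      have "s S = \<zero>" if "S \<subseteq> {..<length xs}" "f S = \<zero>" for S
        using ws that by blast
      then show ?thesis
        using that s unfolding koszul_simps by simp
    qed
  qed
qed

lemma koszul_ideal_cancel: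
  assumes "w \<in> carrier (koszul R xs)" "koszul_scale R xs g w \<in> koszul_ideal xs Q"
    and "\<And>r. r \<in> carrier R \<Longrightarrow> g \<otimes> r \<in> Q \<Longrightarrow> r \<in> Q"
  shows "w \<in> koszul_ideal xs Q"
  unfolding koszul_ideal_def
proof (intro CollectI conjI allI impI)
  fix S assume S: "S \<subseteq> {..<length xs}"
  then have "g \<otimes> w S \<in> Q" using assms(2) by (auto simp: koszul_ideal_def koszul_scale_apply)
  then show "w S \<in> Q" using assms(3) koszul_carrierD[OF assms(1) S] by blast
qed (fact assms(1))

primrec koszul_prod :: "'a list \<Rightarrow> (nat \<Rightarrow> nat set \<Rightarrow> 'a) \<Rightarrow> nat \<Rightarrow> nat set \<Rightarrow> 'a" where
  "koszul_prod xs G 0 = \<one>\<^bsub>koszul R xs\<^esub>"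
| "koszul_prod xs G (Suc n) = koszul_prod xs G n \<otimes>\<^bsub>koszul R xs\<^esub> G n"

text \<open>The products of \<open>G\<^sub>i\<close> with \<open>d G\<^sub>i = g\<^sub>i\<close> survive in the homology of \<open>K(x; R/(g\<^sub>0, \<dots>, g\<^bsub>n-1\<^esub>))\<close>:
  if \<open>G\<^sub>0\<cdots>G\<^sub>n = d H + q + g\<^sub>n N\<close> with \<open>q\<close> in \<open>(g\<^sub>0, \<dots>, g\<^bsub>n-1\<^esub>)\<close>, then applying \<open>d\<close> and cancelling \<open>g\<^sub>n\<close>
  shows that \<open>\<plusminus>G\<^sub>0\<cdots>G\<^bsub>n-1\<^esub> - d N\<close> vanishes modulo \<open>(g\<^sub>0, \<dots>, g\<^bsub>n-1\<^esub>)\<close>.\<close>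

lemma koszul_prod_not_boundary:
  fixes g :: "nat \<Rightarrow> 'a"
  assumes xs: "set xs \<subseteq> carrier R" and one: "\<one> \<notin> Idl (set xs)"
    and g: "\<And>i. i < n \<Longrightarrow> g i \<in> carrier R"
    and reg: "\<And>i r. i < n \<Longrightarrow> r \<in> carrier R \<Longrightarrow> g i \<otimes> r \<in> Idl (g ` {..<i}) \<Longrightarrow> r \<in> Idl (g ` {..<i})"
    and G: "\<And>i. i < n \<Longrightarrow> G i \<in> carrier (koszul R xs)"
    and dG: "\<And>i. i < n \<Longrightarrow> differential (koszul R xs) (G i) = koszul_scale R xs (g i) \<one>\<^bsub>koszul R xs\<^esub>"
    and H: "H \<in> carrier (koszul R xs)" and q: "q \<in> koszul_ideal xs (Idl (g ` {..<n}))"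
  shows "koszul_prod xs G n \<noteq> differential (koszul R xs) H \<oplus>\<^bsub>koszul R xs\<^esub> q"
proof -
  define K where "K = koszul R xs"
  interpret D: signed_dga R K "differential K" "koszul_sign R xs" "koszul_scale R xs"
    unfolding K_def by (rule koszul_signed_dga[OF xs])
  note g = g and G = G[folded K_def] and dG = dG[folded K_def]
  have idl: "ideal (Idl (g ` {..<i})) R" if "i \<le> n" for i
    using g that by (intro genideal_ideal) auto
  have mono: "koszul_ideal xs (Idl (g ` {..<i})) \<subseteq> koszul_ideal xs (Idl (g ` {..<Suc i}))" if "i < n" for i
  proof -
    have "Idl (g ` {..<i}) \<subseteq> Idl (g ` {..<Suc i})"
      using g that by (intro subset_Idl_subset) auto
    then show ?thesis by (auto simp: koszul_ideal_def)
  qed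
  let ?P = "koszul_prod xs G"
  have P: "?P i \<in> carrier K" if "i \<le> n" for i
    using that by (induction i) (auto simp: G simp flip: K_def)
  have dSuc: "differential K (?P (Suc i)) = differential K (?P i) \<otimes>\<^bsub>K\<^esub> G i \<oplus>\<^bsub>K\<^esub>
      koszul_scale R xs (g i) (koszul_sign R xs (?P i))" if "i < n" for i
    using that P[of i] G[of i] dG[of i] g[of i]
    by (simp add: D.d_mult D.scale_mult_right flip: K_def)
  \<comment> \<open>By the Leibniz rule each term of d(G_0 ... G_(i-1)) carries one of the factors
    g_0, ..., g_(i-1), so the product is a cycle modulo them.\<close>
  have dP: "differential K (?P i) \<in> koszul_ideal xs (Idl (g ` {..<i}))" if "i \<le> n" for i
    using that
  proof (induction i)
    case 0
    have "differential K \<one>\<^bsub>K\<^esub> = \<zero>\<^bsub>K\<^esub>"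
      using D.d_mult[of "\<one>\<^bsub>K\<^esub>" "\<one>\<^bsub>K\<^esub>"] D.B.add.l_cancel_one'[of "differential K \<one>\<^bsub>K\<^esub>" "differential K \<one>\<^bsub>K\<^esub>"] by simp
    then show ?case using koszul_ideal_zero[OF idl[of 0], of xs, folded K_def] by (simp flip: K_def)
  next
    case (Suc i)
    have i: "i < n" "i \<le> n" "Suc i \<le> n" using Suc.prems by auto
    note cl = koszul_ideal_closed[OF idl[OF i(3)] xs, folded K_def]
    have "koszul_scale R xs (g i) (koszul_sign R xs (?P i)) \<in> koszul_ideal xs (Idl (g ` {..<Suc i}))"
    proof -
      have "g i \<in> Idl (g ` {..<Suc i})" using g i by (intro subsetD[OF genideal_self]) auto
      moreover have "koszul_sign R xs (?P i) \<in> carrier K" using P i by simp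
      ultimately show ?thesis
        using idl[OF i(3)] g[OF i(1)]
        by (auto simp: koszul_ideal_def koszul_scale_apply K_def
            intro!: ideal.I_r_closed koszul_carrierD koszul_closed(3) xs)
    qed
    moreover have "differential K (?P i) \<otimes>\<^bsub>K\<^esub> G i \<in> koszul_ideal xs (Idl (g ` {..<Suc i}))"
      using Suc.IH i mono[OF i(1)] G[OF i(1)] cl(5) by blast
    ultimately show ?case unfolding dSuc[OF i(1)] using cl(6)[OF _ G[OF i(1)]] by blast
  qed
  have "?P m \<noteq> differential K H \<oplus>\<^bsub>K\<^esub> q"
    if "m \<le> n" "H \<in> carrier K" "q \<in> koszul_ideal xs (Idl (g ` {..<m}))" for m H q
    using that
  proof (induction m arbitrary: H q)
    case 0
    \<comment> \<open>The empty product is 1, while a boundary has its coefficient at {} in the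
      ideal (x), which does not contain 1.\<close>
    have "q {} \<in> Idl {}" using 0 by (auto simp: koszul_ideal_def)
    moreover have "Idl {} \<subseteq> Idl (set xs)" by (rule subset_Idl_subset[OF xs]) simp
    moreover have "differential K H {} \<in> Idl (set xs)"
    proof -
      interpret X: ideal "Idl (set xs)" R by (rule genideal_ideal[OF xs])
      have H: "H \<in> carrier (koszul R xs)" using 0 by (simp add: K_def)
      have "xs ! i \<in> Idl (set xs)" if "i < length xs" for i
        using that genideal_self[OF xs] by auto
      then show ?thesis
        unfolding K_def koszul_d_apply[OF empty_subsetI]
        by (intro finsum_ideal[OF X.is_ideal] Pi_I X.I_l_closed X.I_r_closed sign_pow koszul_carrierD[OF H]) auto
    qed
    ultimately have "(differential K H \<oplus>\<^bsub>K\<^esub> q) {} \<in> Idl (set xs)"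
      using genideal_ideal[OF xs]
      by (auto simp: K_def koszul_add_apply additive_subgroup.a_closed ideal.axioms(1))
    moreover have "?P 0 {} = \<one>" by (simp add: koszul_simps)
    ultimately show ?case using one by metis
  next
    case (Suc m)
    have m: "m < n" "m \<le> n" using Suc.prems by auto
    note cl = koszul_ideal_closed[OF idl[OF m(2)] xs, folded K_def]
    note Gm = G[OF m(1)]
    have "g ` {..<Suc m} = insert (g m) (g ` {..<m})" by (simp add: lessThan_Suc)
    then have im: "Idl (g ` {..<Suc m}) = adjoin (Idl (g ` {..<m})) (g m)"
      using g m by (simp add: Idl_insert_eq_adjoin image_subset_iff)
    obtain q' N where N: "q' \<in> koszul_ideal xs (Idl (g ` {..<m}))" "N \<in> carrier K"
      "q = q' \<oplus>\<^bsub>K\<^esub> koszul_scale R xs (g m) N"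
      using koszul_ideal_add_decomp[OF Suc.prems(3)[unfolded im] g[OF m(1)] idl[OF m(2)], folded K_def] by metis
    show ?case
    proof
      assume eq: "?P (Suc m) = differential K H \<oplus>\<^bsub>K\<^esub> q"
      have q': "q' \<in> carrier K" using N by (simp add: koszul_ideal_def K_def)
      let ?sP = "koszul_sign R xs (?P m)" and ?dPG = "differential K (?P m) \<otimes>\<^bsub>K\<^esub> G m"
      have c: "?sP \<in> carrier K" "?dPG \<in> carrier K" "differential K N \<in> carrier K" "differential K q' \<in> carrier K"
        "g m \<in> carrier R"
        using P m G N q' g by auto
      \<comment> \<open>Applying d removes d H. The terms without the factor g_m, namely d q' and
        d(P_m) G_m, both vanish modulo (g_0, ..., g_(m-1)), so g_m can be cancelled from the
        rest.\<close>
      have "?dPG \<oplus>\<^bsub>K\<^esub> koszul_scale R xs (g m) ?sP =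
          differential K q' \<oplus>\<^bsub>K\<^esub> koszul_scale R xs (g m) (differential K N)"
        using arg_cong[OF eq, of "differential K", unfolded dSuc[OF m(1)]] N Suc.prems(2) q' c
        by (simp add: D.d_add D.d_scale)
      then have "koszul_scale R xs (g m) (?sP \<ominus>\<^bsub>K\<^esub> differential K N) = differential K q' \<oplus>\<^bsub>K\<^esub> \<ominus>\<^bsub>K\<^esub> ?dPG"
        using c by (simp add: a_minus_def D.scale_add D.scale_minus D.B.add_eq_add_imp)
      also have "\<dots> \<in> koszul_ideal xs (Idl (g ` {..<m}))"
        by (rule cl(6)[OF cl(2)[OF N(1) Gm] Gm cl(4)[OF cl(5)[OF dP[OF m(2)] Gm] Gm]])
      finally have "?sP \<ominus>\<^bsub>K\<^esub> differential K N \<in> koszul_ideal xs (Idl (g ` {..<m}))"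
        by (rule koszul_ideal_cancel[where xs = xs, folded K_def, rotated])
          (use c reg[OF m(1)] in simp_all)
      \<comment> \<open>The cancellation concerns \<tau>(P_m) - d N. Applying \<tau> turns it into
        P_m + d(\<tau> N), because \<tau> and d anticommute, and so reaches the form required by the
        induction hypothesis.\<close>
      then have mem: "koszul_sign R xs (?sP \<ominus>\<^bsub>K\<^esub> differential K N) \<in> koszul_ideal xs (Idl (g ` {..<m}))"
        by (rule cl(3)[OF _ Gm])
      have eq2: "koszul_sign R xs (?sP \<ominus>\<^bsub>K\<^esub> differential K N) = ?P m \<oplus>\<^bsub>K\<^esub> differential K (koszul_sign R xs N)"
        using c P[OF m(2)] N by (simp add: a_minus_def D.sign_add D.sign_minus D.sign_d)
      have "?P m = differential K (\<ominus>\<^bsub>K\<^esub> koszul_sign R xs N) \<oplus>\<^bsub>K\<^esub> koszul_sign R xs (?sP \<ominus>\<^bsub>K\<^esub> differential K N)"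
        unfolding eq2 using P[OF m(2)] N
        by (simp add: D.d_minus D.B.a_comm[of "?P m"] D.B.r_neg1)
      then show False
        using Suc.IH[OF m(2) _ mem] N(2) by simp
    qed
  qed
  from this[OF order_refl H[folded K_def] q] show ?thesis unfolding K_def .
qed

end

section \<open>Base change of Koszul complexes along a ring homomorphism\<close>

definition koszul_map :: "('a \<Rightarrow> 'b) \<Rightarrow> 'a list \<Rightarrow> (nat set \<Rightarrow> 'a) \<Rightarrow> (nat set \<Rightarrow> 'b)" where
  "koszul_map h xs f = (\<lambda>S\<in>Pow {..<length xs}. h (f S))"

context ring_hom_cring
begin

lemma hom_sign_pow: "h ((\<ominus> \<one>) [^] (k::nat)) = (\<ominus>\<^bsub>S\<^esub> \<one>\<^bsub>S\<^esub>) [^]\<^bsub>S\<^esub> k"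
  by (induction k) simp_all

lemma koszul_map_closed: "f \<in> carrier (koszul R xs) \<Longrightarrow> koszul_map h xs f \<in> carrier (koszul S (map h xs))"
  by (auto simp: koszul_map_def koszul_simps)

lemma koszul_map_graded_part:
  "f \<in> graded_part (koszul R xs) i \<Longrightarrow> koszul_map h xs f \<in> graded_part (koszul S (map h xs)) i"
  by (auto simp: koszul_map_def koszul_simps)

lemma koszul_map_add:
  assumes "f \<in> carrier (koszul R xs)" "g \<in> carrier (koszul R xs)"
  shows "koszul_map h xs (f \<oplus>\<^bsub>koszul R xs\<^esub> g) = koszul_map h xs f \<oplus>\<^bsub>koszul S (map h xs)\<^esub> koszul_map h xs g"
  unfolding koszul_simps(4) koszul_map_def length_map
  using R.koszul_carrierD[OF assms(1)] R.koszul_carrierD[OF assms(2)]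
  by (intro restrict_ext) simp

lemma koszul_map_mult:
  assumes "f \<in> carrier (koszul R xs)" "g \<in> carrier (koszul R xs)"
  shows "koszul_map h xs (f \<otimes>\<^bsub>koszul R xs\<^esub> g) = koszul_map h xs f \<otimes>\<^bsub>koszul S (map h xs)\<^esub> koszul_map h xs g"
proof (rule extensionalityI[of _ "Pow {..<length xs}"])
  fix U assume "U \<in> Pow {..<length xs}"
  then have U: "U \<subseteq> {..<length xs}" and U': "U \<subseteq> {..<length (map h xs)}" by auto
  have c: "f T \<in> carrier R" "g (U - T) \<in> carrier R" "T \<subseteq> {..<length xs}" "U - T \<subseteq> {..<length xs}"
    if "T \<in> Pow U" for T
    using that U by (auto intro!: R.koszul_carrierD[OF assms(1)] R.koszul_carrierD[OF assms(2)])
  have "koszul_map h xs (f \<otimes>\<^bsub>koszul R xs\<^esub> g) U = h (\<Oplus>T\<in>Pow U.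
     (\<ominus> \<one>) [^] card {(t, u). t \<in> T \<and> u \<in> U - T \<and> u < t} \<otimes> (f T \<otimes> g (U - T)))"
    using U unfolding koszul_map_def by (simp only: restrict_apply' PowI R.koszul_mult_apply)
  also have "\<dots> = (\<Oplus>\<^bsub>S\<^esub>T\<in>Pow U. h ((\<ominus> \<one>) [^] card {(t, u). t \<in> T \<and> u \<in> U - T \<and> u < t} \<otimes> (f T \<otimes> g (U - T))))"
    using c by (subst hom_finsum) (auto simp: comp_def)
  also have "\<dots> = (\<Oplus>\<^bsub>S\<^esub>T\<in>Pow U. (\<ominus>\<^bsub>S\<^esub> \<one>\<^bsub>S\<^esub>) [^]\<^bsub>S\<^esub> card {(t, u). t \<in> T \<and> u \<in> U - T \<and> u < t}
      \<otimes>\<^bsub>S\<^esub> (koszul_map h xs f T \<otimes>\<^bsub>S\<^esub> koszul_map h xs g (U - T)))"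
  proof (rule S.finsum_cong')
    show "(\<lambda>T. (\<ominus>\<^bsub>S\<^esub> \<one>\<^bsub>S\<^esub>) [^]\<^bsub>S\<^esub> card {(t, u). t \<in> T \<and> u \<in> U - T \<and> u < t}
      \<otimes>\<^bsub>S\<^esub> (koszul_map h xs f T \<otimes>\<^bsub>S\<^esub> koszul_map h xs g (U - T))) \<in> Pow U \<rightarrow> carrier S"
      using c unfolding koszul_map_def by (intro Pi_I S.m_closed S.sign_pow) (simp_all only: restrict_apply' PowI hom_closed)
    fix T assume T: "T \<in> Pow U"
    show "h ((\<ominus> \<one>) [^] card {(t, u). t \<in> T \<and> u \<in> U - T \<and> u < t} \<otimes> (f T \<otimes> g (U - T))) =
      (\<ominus>\<^bsub>S\<^esub> \<one>\<^bsub>S\<^esub>) [^]\<^bsub>S\<^esub> card {(t, u). t \<in> T \<and> u \<in> U - T \<and> u < t}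
      \<otimes>\<^bsub>S\<^esub> (koszul_map h xs f T \<otimes>\<^bsub>S\<^esub> koszul_map h xs g (U - T))"
      using c[OF T] unfolding koszul_map_def
      by (simp only: restrict_apply' PowI hom_mult R.m_closed R.sign_pow(1) hom_sign_pow)
  qed simp
  also have "\<dots> = (koszul_map h xs f \<otimes>\<^bsub>koszul S (map h xs)\<^esub> koszul_map h xs g) U"
    by (rule S.koszul_mult_apply[OF U', symmetric])
  finally show "koszul_map h xs (f \<otimes>\<^bsub>koszul R xs\<^esub> g) U =
    (koszul_map h xs f \<otimes>\<^bsub>koszul S (map h xs)\<^esub> koszul_map h xs g) U" .
qed (simp_all add: koszul_map_def koszul_simps(5))

lemma koszul_map_d:
  assumes f: "f \<in> carrier (koszul R xs)" and xs: "set xs \<subseteq> carrier R"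
  shows "koszul_map h xs (differential (koszul R xs) f) =
    differential (koszul S (map h xs)) (koszul_map h xs f)"
proof (rule extensionalityI[of _ "Pow {..<length xs}"])
  fix U assume "U \<in> Pow {..<length xs}"
  then have U: "U \<subseteq> {..<length xs}" and U': "U \<subseteq> {..<length (map h xs)}" by auto
  have c: "f (insert i U) \<in> carrier R" "xs ! i \<in> carrier R" "insert i U \<subseteq> {..<length xs}" "i < length xs"
    if "i \<in> {..<length xs} - U" for i
    using that U xs by (auto intro!: R.koszul_carrierD[OF f])
  have "koszul_map h xs (differential (koszul R xs) f) U =
     h (\<Oplus>i\<in>{..<length xs} - U. (\<ominus> \<one>) [^] card {j \<in> U. j < i} \<otimes> (xs ! i \<otimes> f (insert i U)))"
    using U unfolding koszul_map_def by (simp only: restrict_apply' PowI R.koszul_d_apply)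
  also have "\<dots> = (\<Oplus>\<^bsub>S\<^esub>i\<in>{..<length xs} - U. h ((\<ominus> \<one>) [^] card {j \<in> U. j < i} \<otimes> (xs ! i \<otimes> f (insert i U))))"
    using c by (subst hom_finsum) (auto simp: comp_def)
  also have "\<dots> = (\<Oplus>\<^bsub>S\<^esub>i\<in>{..<length (map h xs)} - U. (\<ominus>\<^bsub>S\<^esub> \<one>\<^bsub>S\<^esub>) [^]\<^bsub>S\<^esub> card {j \<in> U. j < i} \<otimes>\<^bsub>S\<^esub>
      (map h xs ! i \<otimes>\<^bsub>S\<^esub> koszul_map h xs f (insert i U)))"
  proof (rule S.finsum_cong')
    show "(\<lambda>i. (\<ominus>\<^bsub>S\<^esub> \<one>\<^bsub>S\<^esub>) [^]\<^bsub>S\<^esub> card {j \<in> U. j < i} \<otimes>\<^bsub>S\<^esub>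
      (map h xs ! i \<otimes>\<^bsub>S\<^esub> koszul_map h xs f (insert i U))) \<in> {..<length (map h xs)} - U \<rightarrow> carrier S"
      using c unfolding koszul_map_def
      by (intro Pi_I S.m_closed S.sign_pow) (simp_all only: restrict_apply' PowI hom_closed length_map nth_map)
    fix i assume "i \<in> {..<length (map h xs)} - U"
    then have i: "i \<in> {..<length xs} - U" by simp
    show "h ((\<ominus> \<one>) [^] card {j \<in> U. j < i} \<otimes> (xs ! i \<otimes> f (insert i U))) =
      (\<ominus>\<^bsub>S\<^esub> \<one>\<^bsub>S\<^esub>) [^]\<^bsub>S\<^esub> card {j \<in> U. j < i} \<otimes>\<^bsub>S\<^esub> (map h xs ! i \<otimes>\<^bsub>S\<^esub> koszul_map h xs f (insert i U))"
      using c[OF i] unfolding koszul_map_def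
      by (simp only: restrict_apply' PowI hom_mult R.m_closed R.sign_pow(1) hom_sign_pow nth_map)
  qed simp
  also have "\<dots> = differential (koszul S (map h xs)) (koszul_map h xs f) U"
    by (rule S.koszul_d_apply[OF U', symmetric])
  finally show "koszul_map h xs (differential (koszul R xs) f) U =
    differential (koszul S (map h xs)) (koszul_map h xs f) U" .
qed (simp_all add: koszul_map_def koszul_simps(6))

end

section \<open>A criterion for the failure of the Golod property\<close>

context cring
begin

lemma graded_part_mult:
  assumes xs: "set xs \<subseteq> carrier R"
    and f: "f \<in> graded_part (koszul R xs) i" and g: "g \<in> graded_part (koszul R xs) j"
  shows "f \<otimes>\<^bsub>koszul R xs\<^esub> g \<in> graded_part (koszul R xs) (i + j)"
proof -
  interpret D: signed_dga R "koszul R xs" "differential (koszul R xs)" "koszul_sign R xs" "koszul_scale R xs"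
    by (rule koszul_signed_dga[OF xs])
  have c: "f \<in> carrier (koszul R xs)" "g \<in> carrier (koszul R xs)"
    using f g graded_part_carrier by auto
  have "(f \<otimes>\<^bsub>koszul R xs\<^esub> g) S = \<zero>" if S: "S \<subseteq> {..<length xs}" "card S \<noteq> i + j" for S
  proof -
    have fin: "finite S" using S finite_subset by blast
    have z: "(\<ominus> \<one>) [^] card {(t, u). t \<in> T \<and> u \<in> S - T \<and> u < t} \<otimes> (f T \<otimes> g (S - T)) \<in> {\<zero>}"
      if T: "T \<in> Pow S" for T
    proof -
      have TS: "T \<subseteq> {..<length xs}" "S - T \<subseteq> {..<length xs}" using T S by auto
      have "card S = card T + card (S - T)"
        using T fin by (metis PowD card_Diff_subset card_mono finite_subset le_add_diff_inverse)
      then have "card T \<noteq> i \<or> card (S - T) \<noteq> j" using S by auto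
      then have "f T = \<zero> \<or> g (S - T) = \<zero>" using f g TS by (auto simp: koszul_simps)
      then have "f T \<otimes> g (S - T) = \<zero>"
        using koszul_carrierD[OF c(1) TS(1)] koszul_carrierD[OF c(2) TS(2)] by auto
      then show ?thesis using sign_pow(1) by simp
    qed
    have "(\<Oplus>T\<in>Pow S. (\<ominus> \<one>) [^] card {(t, u). t \<in> T \<and> u \<in> S - T \<and> u < t} \<otimes> (f T \<otimes> g (S - T))) \<in> {\<zero>}"
      by (rule finsum_ideal[OF zeroideal Pi_I[OF z]])
    then show ?thesis unfolding koszul_mult_apply[OF S(1)] by (rule singletonD)
  qed
  moreover have "f \<otimes>\<^bsub>koszul R xs\<^esub> g \<in> carrier (koszul R xs)" using c by simp
  ultimately show ?thesis by (auto simp: koszul_simps(1,7))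
qed

lemma graded_part_scale:
  assumes "a \<in> carrier R" "f \<in> graded_part (koszul R xs) i"
  shows "koszul_scale R xs a f \<in> graded_part (koszul R xs) i"
  using assms unfolding koszul_simps(7) by (auto simp: koszul_scale_def)

lemma koszul_scale_by_zero:
  assumes "f \<in> carrier (koszul R xs)"
  shows "koszul_scale R xs \<zero> f = \<zero>\<^bsub>koszul R xs\<^esub>"
  unfolding koszul_scale_def koszul_simps(2)
  using koszul_carrierD[OF assms] by (intro restrict_ext) simp

text \<open>The elements a that admit such an F form an ideal, and it contains each entry of xs
  because d e_j = x_j.\<close>

lemma Idl_lift_koszul:
  assumes xs: "set xs \<subseteq> carrier R" and a: "a \<in> Idl (set xs)"
  shows "\<exists>F\<in>graded_part (koszul R xs) 1.
    differential (koszul R xs) F = koszul_scale R xs a \<one>\<^bsub>koszul R xs\<^esub>"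
proof -
  define K where "K = koszul R xs"
  interpret D: signed_dga R K "differential K" "koszul_sign R xs" "koszul_scale R xs"
    unfolding K_def by (rule koszul_signed_dga[OF xs])
  define E where "E = {a \<in> carrier R. \<exists>F\<in>graded_part K 1. differential K F = koszul_scale R xs a \<one>\<^bsub>K\<^esub>}"
  have gc: "F \<in> carrier K" if "F \<in> graded_part K 1" for F
    using that graded_part_carrier unfolding K_def by blast
  have mult: "b \<otimes> a \<in> E" if a: "a \<in> E" and b: "b \<in> carrier R" for a b
  proof -
    obtain F where F: "F \<in> graded_part K 1" "differential K F = koszul_scale R xs a \<one>\<^bsub>K\<^esub>" "a \<in> carrier R"
      using a by (auto simp: E_def)
    have "differential K (koszul_scale R xs b F) = koszul_scale R xs (b \<otimes> a) \<one>\<^bsub>K\<^esub>"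
      using F b gc[OF F(1)] by (simp add: D.d_scale D.scale_scale)
    moreover have "koszul_scale R xs b F \<in> graded_part K 1"
      using graded_part_scale[OF b] F unfolding K_def by blast
    ultimately show ?thesis using F b by (auto simp: E_def)
  qed
  have "ideal E R"
  proof (rule idealI[OF ring_axioms])
    show "subgroup E (add_monoid R)"
    proof (rule add.subgroupI)
      show "E \<subseteq> carrier R" by (auto simp: E_def)
      have "\<zero>\<^bsub>K\<^esub> \<in> graded_part K 1" by (auto simp: K_def koszul_simps)
      moreover have "differential K \<zero>\<^bsub>K\<^esub> = koszul_scale R xs \<zero> \<one>\<^bsub>K\<^esub>"
        using koszul_scale_by_zero[of "\<one>\<^bsub>K\<^esub>" xs, folded K_def] by simp
      ultimately have "\<zero> \<in> E" unfolding E_def by blast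
      then show "E \<noteq> {}" by blast
      show "\<ominus> a \<in> E" if "a \<in> E" for a
        using mult[OF that, of "\<ominus> \<one>"] that by (simp add: E_def l_minus)
      fix a b assume "a \<in> E" "b \<in> E"
      then obtain F G where F: "F \<in> graded_part K 1" "differential K F = koszul_scale R xs a \<one>\<^bsub>K\<^esub>" "a \<in> carrier R"
        and G: "G \<in> graded_part K 1" "differential K G = koszul_scale R xs b \<one>\<^bsub>K\<^esub>" "b \<in> carrier R"
        by (auto simp: E_def)
      have "differential K (F \<oplus>\<^bsub>K\<^esub> G) = koszul_scale R xs (a \<oplus> b) \<one>\<^bsub>K\<^esub>"
        using F G gc koszul_scale_by_add[of a b "\<one>\<^bsub>K\<^esub>" xs, folded K_def] by (simp add: D.d_add)
      moreover have "F \<oplus>\<^bsub>K\<^esub> G \<in> graded_part K 1"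
        using F G by (auto simp: K_def koszul_simps)
      ultimately show "a \<oplus> b \<in> E" using F G by (auto simp: E_def)
    qed
    show "x \<otimes> a \<in> E" "a \<otimes> x \<in> E" if "a \<in> E" "x \<in> carrier R" for a x
      using mult[OF that] that by (auto simp: E_def m_comm)
  qed
  moreover have "set xs \<subseteq> E"
  proof
    fix y assume "y \<in> set xs"
    then obtain j where j: "j < length xs" "y = xs ! j" by (auto simp: in_set_conv_nth)
    then have y: "y \<in> carrier R" using xs by auto
    have xc: "xs ! i \<in> carrier R" if "i < length xs" for i using xs that by auto
    \<comment> \<open>This is the exterior generator e_j.\<close>
    define F where "F = (\<lambda>S\<in>Pow {..<length xs}. if S = {j} then \<one> else \<zero>)"
    have F: "F \<in> graded_part K 1"
      unfolding K_def koszul_simps F_def by auto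
    have "differential K F = koszul_scale R xs y \<one>\<^bsub>K\<^esub>"
      unfolding K_def
    proof (rule koszul_eqI)
      show "differential (koszul R xs) F \<in> carrier (koszul R xs)"
        "koszul_scale R xs y \<one>\<^bsub>koszul R xs\<^esub> \<in> carrier (koszul R xs)"
        using gc[OF F] y D.d_closed D.scale_closed[OF y D.B.one_closed] unfolding K_def by auto
      fix S assume S: "S \<subseteq> {..<length xs}"
      have rhs: "koszul_scale R xs y \<one>\<^bsub>koszul R xs\<^esub> S = (if S = {} then y else \<zero>)"
        using S y by (simp add: koszul_scale_def koszul_simps(3))
      have "F (insert i S) = (if S = {} \<and> i = j then \<one> else \<zero>)" if "i \<in> {..<length xs} - S" for i
        using that S unfolding F_def by auto
      then have "differential (koszul R xs) F S = (\<Oplus>i\<in>{..<length xs} - S. if j = i then (if S = {} then y else \<zero>) else \<zero>)"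
        unfolding koszul_d_apply[OF S]
        using j xc sign_pow(1) y by (intro finsum_cong') auto
      also have "\<dots> = (if S = {} then y else \<zero>)"
      proof (cases "S = {}")
        case True
        then show ?thesis
          using finsum_singleton[of j "{..<length xs}" "\<lambda>_. y"] j y by simp
      next
        case False
        then show ?thesis by simp
      qed
      finally show "differential (koszul R xs) F S = koszul_scale R xs y \<one>\<^bsub>koszul R xs\<^esub> S"
        using rhs by simp
    qed
    then show "y \<in> E" using F y by (auto simp: E_def)
  qed
  ultimately have "Idl (set xs) \<subseteq> E" by (rule genideal_minimal)
  then show ?thesis using a by (auto simp: E_def K_def)
qed

end

context ring_hom_cring
begin

text \<open>The factor ring enters only as a surjection h with kernel Q. If the product of the two
  cycles is a boundary over S, lifting a primitive to R gives G_0 G_1 G_2 G_3 = d H + q with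
  coefficients of q in Q and hence in the ideal of the squares. This contradicts
  \<open>koszul_prod_not_boundary\<close>.\<close>

lemma koszul_image_no_massey:
  fixes f :: "nat \<Rightarrow> 'a"
  assumes Q: "ideal Q R" and surj: "\<And>s. s \<in> carrier S \<Longrightarrow> \<exists>r\<in>carrier R. h r = s"
    and kernel: "\<And>r. r \<in> carrier R \<Longrightarrow> h r = \<zero>\<^bsub>S\<^esub> \<longleftrightarrow> r \<in> Q"
    and xs: "set xs \<subseteq> carrier R" and one: "\<one> \<notin> Idl (set xs)"
    and fx: "\<And>i. i < 4 \<Longrightarrow> f i \<in> Idl (set xs)"
    and fQ: "\<And>i j. \<lbrakk>i < 4; j < 4\<rbrakk> \<Longrightarrow> f j \<otimes> (f i \<otimes> f i) \<in> Q"
    and QJ: "Q \<subseteq> Idl ((\<lambda>j. f j \<otimes> f j) ` {..<4})"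
    and reg: "\<And>i r. \<lbrakk>i < 4; r \<in> carrier R; (f i \<otimes> f i) \<otimes> r \<in> Idl ((\<lambda>j. f j \<otimes> f j) ` {..<i})\<rbrakk> \<Longrightarrow>
       r \<in> Idl ((\<lambda>j. f j \<otimes> f j) ` {..<i})"
  shows "\<not> admits_trivial_massey_operation (koszul S (map h xs))"
proof
  define K where "K = koszul R xs"
  define L where "L = koszul S (map h xs)"
  define g where "g = (\<lambda>j. f j \<otimes> f j)"
  assume "admits_trivial_massey_operation (koszul S (map h xs))"
  then have adm: "admits_trivial_massey_operation L" by (simp add: L_def)
  have fc: "f i \<in> carrier R" if "i < 4" for i
    using fx[OF that] by (rule ideal.Icarr[OF R.genideal_ideal[OF xs]])
  have gc: "g i \<in> carrier R" if "i < 4" for i using fc[OF that] by (simp add: g_def)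
  have Qc: "a \<in> carrier R" if "a \<in> Q" for a using ideal.Icarr[OF Q that] .
  have xsS: "set (map h xs) \<subseteq> carrier S" using xs by auto
  interpret D: signed_dga R K "differential K" "koszul_sign R xs" "koszul_scale R xs"
    unfolding K_def by (rule R.koszul_signed_dga[OF xs])
  interpret E: signed_dga S L "differential L" "koszul_sign S (map h xs)" "koszul_scale S (map h xs)"
    unfolding L_def by (rule S.koszul_signed_dga[OF xsS])
  let ?\<phi> = "koszul_map h xs"
  note phi_closed = koszul_map_closed[where xs = xs, folded K_def L_def]
    and phi_mult = koszul_map_mult[where xs = xs, folded K_def L_def]
    and phi_add = koszul_map_add[where xs = xs, folded K_def L_def]
    and phi_d = koszul_map_d[where xs = xs, folded K_def L_def, OF _ xs]
    and phi_graded = koszul_map_graded_part[where xs = xs, folded K_def L_def]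
  have phi_zero: "?\<phi> w = \<zero>\<^bsub>L\<^esub> \<longleftrightarrow> w \<in> R.koszul_ideal xs Q" if w: "w \<in> carrier K" for w
  proof -
    have wc: "w U \<in> carrier R" if "U \<subseteq> {..<length xs}" for U
      using R.koszul_carrierD w that unfolding K_def by blast
    have "?\<phi> w = \<zero>\<^bsub>L\<^esub> \<longleftrightarrow> (\<forall>U\<subseteq>{..<length xs}. h (w U) = \<zero>\<^bsub>S\<^esub>)"
    proof
      assume "?\<phi> w = \<zero>\<^bsub>L\<^esub>"
      then show "\<forall>U\<subseteq>{..<length xs}. h (w U) = \<zero>\<^bsub>S\<^esub>"
        unfolding koszul_map_def L_def koszul_simps(2) length_map
        by (metis (no_types, lifting) PowI restrict_apply')
    next
      assume "\<forall>U\<subseteq>{..<length xs}. h (w U) = \<zero>\<^bsub>S\<^esub>"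
      then show "?\<phi> w = \<zero>\<^bsub>L\<^esub>"
        unfolding koszul_map_def L_def koszul_simps(2) length_map by (intro restrict_ext) simp
    qed
    also have "\<dots> \<longleftrightarrow> w \<in> R.koszul_ideal xs Q"
      using w kernel wc unfolding R.koszul_ideal_def K_def by blast
    finally show ?thesis .
  qed
  obtain F where F: "\<And>i. i < 4 \<Longrightarrow> F i \<in> graded_part K 1"
    and dF: "\<And>i. i < 4 \<Longrightarrow> differential K (F i) = koszul_scale R xs (f i) \<one>\<^bsub>K\<^esub>"
    using R.Idl_lift_koszul[OF xs fx, folded K_def] by metis
  have Fc: "F i \<in> carrier K" if "i < 4" for i
    using R.graded_part_carrier F[OF that] unfolding K_def by blast
  define G where "G = (\<lambda>i. koszul_scale R xs (f i) (F i))"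
  have Gg: "G i \<in> graded_part K 1" and Gc: "G i \<in> carrier K" if "i < 4" for i
    unfolding G_def using R.graded_part_scale[where xs = xs, folded K_def] F fc Fc that by auto
  have dG: "differential K (G i) = koszul_scale R xs (g i) \<one>\<^bsub>K\<^esub>" if "i < 4" for i
    unfolding G_def g_def using fc Fc dF that by (simp add: D.d_scale D.scale_scale)
  have cyc: "?\<phi> (G i \<otimes>\<^bsub>K\<^esub> G j) \<in> cycles L" if "i < 4" "j < 4" for i j
  proof -
    have c: "F i \<in> carrier K" "F j \<in> carrier K" "f i \<in> carrier R" "f j \<in> carrier R" "g i \<in> carrier R" "g j \<in> carrier R"
      using Fc fc gc that by auto
    have "differential K (G i \<otimes>\<^bsub>K\<^esub> G j) =
      koszul_scale R xs (g i) (G j) \<oplus>\<^bsub>K\<^esub> koszul_scale R xs (g j) (koszul_sign R xs (G i))"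
      using Gc dG c that by (simp add: D.d_mult D.scale_mult_left D.scale_mult_right)
    \<comment> \<open>The factor f_j of G_j is pulled out, so both coefficients have the shape f_j
      f_i^2 required by \<open>fQ\<close>. This is the reason for taking G_i = f_i F_i.\<close>
    also have "\<dots> = koszul_scale R xs (f j \<otimes> g i) (F j) \<oplus>\<^bsub>K\<^esub>
        koszul_scale R xs (f i \<otimes> g j) (koszul_sign R xs (F i))"
      unfolding G_def using c by (simp add: D.scale_scale D.sign_scale R.m_comm)
    also have "\<dots> \<in> R.koszul_ideal xs Q"
    proof (rule R.koszul_ideal_closed(6)[OF Q xs, folded K_def])
      have "koszul_scale R xs a w \<in> R.koszul_ideal xs Q" if "a \<in> Q" "w \<in> carrier K" for a w
        using that R.koszul_closed(3)[OF _ xs Qc]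
        by (auto simp: R.koszul_ideal_def R.koszul_scale_apply K_def intro!: ideal.I_r_closed[OF Q] R.koszul_carrierD)
      then show "koszul_scale R xs (f j \<otimes> g i) (F j) \<in> R.koszul_ideal xs Q"
        "koszul_scale R xs (f i \<otimes> g j) (koszul_sign R xs (F i)) \<in> R.koszul_ideal xs Q"
        using fQ that c by (auto simp: g_def)
    qed (rule c(1))
    finally have "?\<phi> (differential K (G i \<otimes>\<^bsub>K\<^esub> G j)) = \<zero>\<^bsub>L\<^esub>"
      using phi_zero Gc that by simp
    then show ?thesis
      unfolding cycles_def using Gc that phi_closed phi_d by simp
  qed
  have gr: "?\<phi> (G i \<otimes>\<^bsub>K\<^esub> G j) \<in> graded_part L (1 + 1)" if "i < 4" "j < 4" for i j
    using R.graded_part_mult[OF xs, folded K_def] Gg that phi_graded by blast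
  let ?P = "(G 0 \<otimes>\<^bsub>K\<^esub> G 1) \<otimes>\<^bsub>K\<^esub> (G 2 \<otimes>\<^bsub>K\<^esub> G 3)"
  have Pc: "?P \<in> carrier K" using Gc by simp
  have "?\<phi> (G 0 \<otimes>\<^bsub>K\<^esub> G 1) \<otimes>\<^bsub>L\<^esub> ?\<phi> (G 2 \<otimes>\<^bsub>K\<^esub> G 3) \<in> boundaries L"
    unfolding L_def
    by (rule S.massey_products_boundaries[OF xsS adm[unfolded L_def] cyc[unfolded L_def] gr[unfolded L_def] _
       cyc[unfolded L_def] gr[unfolded L_def]]) simp_all
  then obtain u where u: "u \<in> carrier L" "?\<phi> ?P = differential L u"
    using phi_mult Gc by (auto simp: boundaries_def)
  have "\<exists>r. U \<subseteq> {..<length xs} \<longrightarrow> r \<in> carrier R \<and> h r = u U" for U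
  proof (cases "U \<subseteq> {..<length xs}")
    case True
    then have "u U \<in> carrier S" using S.koszul_carrierD[of u "map h xs"] u unfolding L_def by simp
    then show ?thesis using surj by blast
  qed auto
  then obtain H0 where H0: "\<And>U. U \<subseteq> {..<length xs} \<Longrightarrow> H0 U \<in> carrier R \<and> h (H0 U) = u U"
    by metis
  define H where "H = (\<lambda>U\<in>Pow {..<length xs}. H0 U)"
  have H: "H \<in> carrier K" using H0 by (auto simp: H_def K_def koszul_simps)
  have "?\<phi> H = u"
  proof (rule S.koszul_eqI[of _ "map h xs", folded L_def])
    show "?\<phi> H U = u U" if "U \<subseteq> {..<length (map h xs)}" for U
      using that H0 by (simp add: koszul_map_def H_def)
  qed (use phi_closed H u in auto)
  then have eq: "?\<phi> ?P = ?\<phi> (differential K H)" using u phi_d H by simp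
  \<comment> \<open>The error of the lifted boundary equation: it maps to zero over S, so its
    coefficients lie in Q.\<close>
  define q where "q = ?P \<oplus>\<^bsub>K\<^esub> \<ominus>\<^bsub>K\<^esub> differential K H"
  have qc: "q \<in> carrier K" unfolding q_def using Pc H by simp
  have "?\<phi> q = \<zero>\<^bsub>L\<^esub>"
  proof -
    have "?\<phi> ?P = ?\<phi> (q \<oplus>\<^bsub>K\<^esub> differential K H)"
      unfolding q_def using Pc H by (simp add: D.B.a_assoc D.B.l_neg)
    also have "\<dots> = ?\<phi> q \<oplus>\<^bsub>L\<^esub> ?\<phi> ?P" using phi_add qc H eq by simp
    finally show ?thesis using phi_closed[OF qc] phi_closed[OF Pc] by (metis E.B.add.r_cancel_one')
  qed
  then have "q \<in> R.koszul_ideal xs Q" using phi_zero qc by simp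
  then have q: "q \<in> R.koszul_ideal xs (Idl (g ` {..<4}))"
    using QJ unfolding g_def by (auto simp: R.koszul_ideal_def)
  have "R.koszul_prod xs G 4 = ?P"
    using Gc by (simp add: numeral_eq_Suc D.B.m_assoc flip: K_def)
  also have "\<dots> = differential K H \<oplus>\<^bsub>K\<^esub> q"
    unfolding q_def using Pc D.d_closed[OF H] by (metis D.B.a_comm D.B.r_neg2 D.B.a_inv_closed)
  finally have "R.koszul_prod xs G 4 = differential (koszul R xs) H \<oplus>\<^bsub>koszul R xs\<^esub> q"
    unfolding K_def .
  moreover have "R.koszul_prod xs G 4 \<noteq> differential (koszul R xs) H \<oplus>\<^bsub>koszul R xs\<^esub> q"
    by (rule R.koszul_prod_not_boundary[OF xs one gc _ _ _ _ q])
      (use reg Gc dG H in \<open>simp_all add: g_def flip: K_def\<close>)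
  ultimately show False by blast
qed

end

text \<open>The case Q = I J: the products f_j f_i^2 lie in I J because f_j is in I and f_i^2 in J,
  and I J is contained in J.\<close>

theorem (in cring) koszul_quotient_no_massey:
  fixes f :: "nat \<Rightarrow> 'a"
  assumes I: "ideal I R" and xs: "set xs \<subseteq> carrier R" and one: "\<one> \<notin> Idl (set xs)"
    and fI: "\<And>i. i < 4 \<Longrightarrow> f i \<in> I" and fx: "\<And>i. i < 4 \<Longrightarrow> f i \<in> Idl (set xs)"
    and reg: "\<And>i r. \<lbrakk>i < 4; r \<in> carrier R; (f i \<otimes> f i) \<otimes> r \<in> Idl ((\<lambda>j. f j \<otimes> f j) ` {..<i})\<rbrakk> \<Longrightarrow>
       r \<in> Idl ((\<lambda>j. f j \<otimes> f j) ` {..<i})"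
  defines "J \<equiv> Idl ((\<lambda>j. f j \<otimes> f j) ` {..<4})"
  shows "\<not> admits_trivial_massey_operation (koszul (R Quot (I \<cdot> J)) (map ((+>) (I \<cdot> J)) xs))"
proof -
  have fc: "f i \<in> carrier R" if "i < 4" for i using fI[OF that] by (rule ideal.Icarr[OF I])
  have gsub: "(\<lambda>j. f j \<otimes> f j) ` {..<4} \<subseteq> carrier R" using fc by auto
  have J: "ideal J R" unfolding J_def by (rule genideal_ideal[OF gsub])
  have Q: "ideal (I \<cdot> J) R" by (rule ideal_prod_is_ideal[OF I J])
  have "ring_hom_cring R (R Quot (I \<cdot> J)) ((+>) (I \<cdot> J))"
    by (rule ideal.rcos_ring_hom_cring[OF Q cring_axioms])
  then show ?thesis
  proof (rule ring_hom_cring.koszul_image_no_massey[OF _ Q _ _ xs one fx _ _ reg])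
    fix s assume "s \<in> carrier (R Quot (I \<cdot> J))"
    then show "\<exists>r\<in>carrier R. I \<cdot> J +> r = s" by (auto simp: FactRing_def A_RCOSETS_def')
  next
    fix r assume "r \<in> carrier R"
    then show "I \<cdot> J +> r = \<zero>\<^bsub>R Quot (I \<cdot> J)\<^esub> \<longleftrightarrow> r \<in> I \<cdot> J"
      using a_rcos_zero[OF Q] ideal.rcos_const_imp_mem[OF Q] by (auto simp: FactRing_def)
  next
    fix i j :: nat assume "i < 4" "j < 4"
    then have "f j \<in> I" "f i \<otimes> f i \<in> J" using fI genideal_self[OF gsub] by (auto simp: J_def)
    then show "f j \<otimes> (f i \<otimes> f i) \<in> I \<cdot> J" by (rule ideal_prod.prod)
  next
    show "I \<cdot> J \<subseteq> Idl ((\<lambda>j. f j \<otimes> f j) ` {..<4})"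
      using ideal_prod_inter[OF I J] by (auto simp: J_def)
  qed
qed

section \<open>Regular sequences\<close>

lemma (in abelian_group) add_minus_cancel:
  assumes "a \<in> carrier G" "b \<in> carrier G"
  shows "(a \<oplus> b) \<oplus> \<ominus> a = b" "(a \<oplus> b) \<oplus> \<ominus> b = a"
proof -
  show "(a \<oplus> b) \<oplus> \<ominus> b = a" using assms by (simp add: a_assoc r_neg)
  then show "(a \<oplus> b) \<oplus> \<ominus> a = b" using assms by (metis a_comm a_assoc r_neg r_zero a_inv_closed)
qed

context cring
begin

text \<open>c is a nonzerodivisor on R/Q.\<close>

definition regular_mod :: "'a set \<Rightarrow> 'a \<Rightarrow> bool" where
  "regular_mod Q c \<longleftrightarrow> (\<forall>r\<in>carrier R. c \<otimes> r \<in> Q \<longrightarrow> r \<in> Q)"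

lemma regular_modD: "\<lbrakk>regular_mod Q c; r \<in> carrier R; c \<otimes> r \<in> Q\<rbrakk> \<Longrightarrow> r \<in> Q"
  by (simp add: regular_mod_def)

text \<open>The base ideal grows along the recursion instead of being computed from prefixes, so
  that inductions over the list can generalise it.\<close>

primrec regular_list :: "'a set \<Rightarrow> 'a list \<Rightarrow> bool" where
  "regular_list Q [] \<longleftrightarrow> True"
| "regular_list Q (c # cs) \<longleftrightarrow> regular_mod Q c \<and> regular_list (adjoin Q c) cs"

lemma regular_list_iff:
  assumes "A \<subseteq> carrier R" "set cs \<subseteq> carrier R"
  shows "regular_list (Idl A) cs \<longleftrightarrow> (\<forall>i<length cs. regular_mod (Idl (A \<union> set (take i cs))) (cs ! i))"
  using assms
proof (induction cs arbitrary: A)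
  case (Cons c cs)
  have "regular_list (Idl A) (c # cs) \<longleftrightarrow> regular_mod (Idl A) c \<and> regular_list (Idl (insert c A)) cs"
    using Cons.prems by (simp add: Idl_insert_eq_adjoin)
  also have "regular_list (Idl (insert c A)) cs \<longleftrightarrow>
      (\<forall>i<length cs. regular_mod (Idl (insert c A \<union> set (take i cs))) (cs ! i))"
    using Cons.prems by (intro Cons.IH) auto
  also have "regular_mod (Idl A) c \<and> \<dots> \<longleftrightarrow>
     (\<forall>i<length (c # cs). regular_mod (Idl (A \<union> set (take i (c # cs)))) ((c # cs) ! i))"
    by (simp add: All_less_Suc2)
  finally show ?case .
qed simp

text \<open>Regularity on the outer terms of \<open>0 \<rightarrow> R/Q\<^sub>1 \<rightarrow> R/Q \<rightarrow> R/Q\<^sub>2 \<rightarrow> 0\<close>, whose first map is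
  multiplication by \<open>a\<close>, implies regularity on the middle term.\<close>

lemma regular_list_middle:
  assumes "ideal Q R" "ideal Q1 R" "ideal Q2 R" "a \<in> carrier R" "set cs \<subseteq> carrier R"
    and "Q \<subseteq> Q2" "\<And>x. x \<in> Q2 \<Longrightarrow> x \<in> adjoin Q a" "a \<in> Q2"
    and "\<And>v. v \<in> carrier R \<Longrightarrow> a \<otimes> v \<in> Q \<longleftrightarrow> v \<in> Q1"
    and "regular_list Q1 cs" "regular_list Q2 cs"
  shows "regular_list Q cs"
  using assms
proof (induction cs arbitrary: Q Q1 Q2)
  case (Cons c cs)
  interpret Q: ideal Q R by fact
  interpret Q1: ideal Q1 R by fact
  interpret Q2: ideal Q2 R by fact
  note a = \<open>a \<in> carrier R\<close>
  have c: "c \<in> carrier R" using Cons.prems by simp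
  have reg: "regular_mod Q1 c" "regular_mod Q2 c" using Cons.prems by auto
  have "r \<in> Q" if r: "r \<in> carrier R" "c \<otimes> r \<in> Q" for r
  proof -
    \<comment> \<open>Regularity of c on R/Q2 puts r into Q + a R. The coefficient v of a is then
      handled by regularity of c on R/Q1.\<close>
    have "r \<in> Q2" using regular_modD[OF reg(2) r(1)] r Cons.prems(6) by blast
    then obtain q v where qv: "q \<in> Q" "v \<in> carrier R" "r = q \<oplus> a \<otimes> v"
      by (rule adjoinE[OF Cons.prems(7)])
    have q: "q \<in> carrier R" using qv Q.Icarr by blast
    have "c \<otimes> r = c \<otimes> q \<oplus> a \<otimes> (c \<otimes> v)"
      unfolding qv(3) using q c a qv(2) by (simp add: r_distr m_lcomm)
    then have "a \<otimes> (c \<otimes> v) = c \<otimes> r \<oplus> \<ominus> (c \<otimes> q)"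
      using q c a qv(2) by (simp add: add_minus_cancel)
    also have "\<dots> \<in> Q" by (rule Q.a_closed[OF r(2) Q.a_inv_closed[OF Q.I_l_closed[OF qv(1) c]]])
    finally have "c \<otimes> v \<in> Q1" using Cons.prems(9) c qv by simp
    then have "v \<in> Q1" using regular_modD[OF reg(1)] qv by blast
    then have "a \<otimes> v \<in> Q" using Cons.prems(9) qv by blast
    then show ?thesis unfolding qv(3) by (intro Q.a_closed qv)
  qed
  moreover have "regular_list (adjoin Q c) cs"
  proof (rule Cons.IH[OF _ _ _ a])
    show "ideal (adjoin Q c) R" "ideal (adjoin Q1 c) R" "ideal (adjoin Q2 c) R"
      by (intro adjoin_ideal Cons.prems c)+
    show "adjoin Q c \<subseteq> adjoin Q2 c" using Cons.prems(6) by (auto simp: adjoin_def)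
    show "a \<in> adjoin Q2 c" using adjoin_memI(1)[OF _ c] Cons.prems(3,8) by blast
    show "regular_list (adjoin Q1 c) cs" "regular_list (adjoin Q2 c) cs" "set cs \<subseteq> carrier R"
      using Cons.prems by auto
    fix x assume "x \<in> adjoin Q2 c"
    then obtain q s v where "q \<in> Q" "s \<in> carrier R" "v \<in> carrier R" "x = (q \<oplus> a \<otimes> v) \<oplus> c \<otimes> s"
      by (elim adjoinE) (metis adjoinE Cons.prems(7))
    then have "x = (q \<oplus> c \<otimes> s) \<oplus> a \<otimes> v" "q \<oplus> c \<otimes> s \<in> adjoin Q c" "v \<in> carrier R"
      using a c Q.Icarr[of q] by (simp_all add: a_ac adjoinI)
    then show "x \<in> adjoin (adjoin Q c) a" unfolding adjoin_def[of "adjoin Q c"] by blast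
  next
    fix v assume v: "v \<in> carrier R"
    show "a \<otimes> v \<in> adjoin Q c \<longleftrightarrow> v \<in> adjoin Q1 c"
    proof
      \<comment> \<open>Multiplication by a must stay injective after reduction modulo c. From a v =
        q + c w it follows that c w lies in Q2, so regularity of c on R/Q2 gives w = q' + a w'. Now
        a (v - c w') lies in Q, hence v - c w' in Q1.\<close>
      assume "a \<otimes> v \<in> adjoin Q c"
      then obtain q w where w: "q \<in> Q" "w \<in> carrier R" "a \<otimes> v = q \<oplus> c \<otimes> w" by (auto simp: adjoin_def)
      have q: "q \<in> carrier R" using w Q.Icarr by blast
      have "c \<otimes> w = a \<otimes> v \<oplus> \<ominus> q" unfolding w(3) using q c w(2) by (simp add: add_minus_cancel)
      also have "\<dots> \<in> Q2" using w Cons.prems(6,8) v by (intro Q2.a_closed Q2.a_inv_closed Q2.I_r_closed) auto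
      finally have "w \<in> Q2" using regular_modD[OF reg(2)] w by blast
      then obtain q' w' where w': "q' \<in> Q" "w' \<in> carrier R" "w = q' \<oplus> a \<otimes> w'"
        by (rule adjoinE[OF Cons.prems(7)])
      have q': "q' \<in> carrier R" using w' Q.Icarr by blast
      have "a \<otimes> (v \<oplus> \<ominus> (c \<otimes> w')) = q \<oplus> c \<otimes> q'"
      proof -
        have "a \<otimes> (v \<oplus> \<ominus> (c \<otimes> w')) = a \<otimes> v \<oplus> \<ominus> (c \<otimes> (a \<otimes> w'))"
          using a v c w' by (simp add: r_distr r_minus m_lcomm)
        also have "\<dots> = (q \<oplus> c \<otimes> q') \<oplus> c \<otimes> (a \<otimes> w') \<oplus> \<ominus> (c \<otimes> (a \<otimes> w'))"
          unfolding w(3) w'(3) using a c q q' w'(2) by (simp add: r_distr a_assoc)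
        also have "\<dots> = q \<oplus> c \<otimes> q'"
          using a c q q' w'(2) by (simp add: a_assoc r_neg)
        finally show ?thesis .
      qed
      also have "\<dots> \<in> Q" using w w' c by (intro Q.a_closed Q.I_l_closed)
      finally have *: "v \<oplus> \<ominus> (c \<otimes> w') \<in> Q1" using Cons.prems(9) v c w' by simp
      have "v = (v \<oplus> \<ominus> (c \<otimes> w')) \<oplus> c \<otimes> w'" using v c w'(2) by (simp add: a_assoc l_neg)
      then show "v \<in> adjoin Q1 c" unfolding adjoin_def using * w'(2) by blast
    next
      assume "v \<in> adjoin Q1 c"
      then obtain q s where w: "q \<in> Q1" "s \<in> carrier R" "v = q \<oplus> c \<otimes> s" by (auto simp: adjoin_def)
      have q: "q \<in> carrier R" using w Q1.Icarr by blast
      have "a \<otimes> v = a \<otimes> q \<oplus> c \<otimes> (a \<otimes> s)" unfolding w(3) using q a c w(2) by (simp add: r_distr m_lcomm)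
      moreover have "a \<otimes> q \<in> Q" using Cons.prems(9) q w by blast
      ultimately show "a \<otimes> v \<in> adjoin Q c" unfolding adjoin_def using a w(2) by blast
    qed
  qed
  ultimately show ?case by (simp add: regular_mod_def)
qed simp

text \<open>Multiplication by c gives 0 \<rightarrow> R/(Q, c) \<rightarrow> R/(Q, c^2)
  \<rightarrow> R/(Q, c) \<rightarrow> 0, exact on the left because c is regular on R/Q. By
  \<open>regular_list_middle\<close> the remaining elements stay regular when c is replaced by its
  square, and the induction squares them in turn.\<close>

lemma regular_list_squares:
  assumes "ideal Q R" "set cs \<subseteq> carrier R" "regular_list Q cs"
  shows "regular_list Q (map (\<lambda>c. c \<otimes> c) cs)"
  using assms
proof (induction cs arbitrary: Q)
  case (Cons c cs)
  interpret Q: ideal Q R by fact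
  have c: "c \<in> carrier R" "c \<otimes> c \<in> carrier R" using Cons.prems by auto
  have reg: "regular_mod Q c" "regular_list (adjoin Q c) cs" using Cons.prems by auto
  have sq: "regular_mod Q (c \<otimes> c)"
    unfolding regular_mod_def
  proof (intro ballI impI)
    fix r assume r: "r \<in> carrier R" "(c \<otimes> c) \<otimes> r \<in> Q"
    then have "c \<otimes> (c \<otimes> r) \<in> Q" using c(1) by (simp add: m_assoc)
    then show "r \<in> Q" using regular_modD[OF reg(1)] r(1) c(1) m_closed by blast
  qed
  have "regular_list (adjoin Q (c \<otimes> c)) cs"
  proof (rule regular_list_middle[of _ "adjoin Q c" "adjoin Q c" c])
    show "ideal (adjoin Q (c \<otimes> c)) R" "ideal (adjoin Q c) R" "ideal (adjoin Q c) R"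
      by (intro adjoin_ideal Cons.prems c)+
    show "adjoin Q (c \<otimes> c) \<subseteq> adjoin Q c"
      using adjoinI[of _ Q "c \<otimes> _" c] c(1) by (auto elim!: adjoinE simp: m_assoc)
    show "c \<in> adjoin Q c" using adjoin_memI(3)[OF Cons.prems(1) c(1)] .
    show "x \<in> adjoin (adjoin Q (c \<otimes> c)) c" if "x \<in> adjoin Q c" for x
      using that adjoin_memI(1)[OF Cons.prems(1) c(2)] by (auto elim!: adjoinE intro!: adjoinI)
    fix v assume v: "v \<in> carrier R"
    show "c \<otimes> v \<in> adjoin Q (c \<otimes> c) \<longleftrightarrow> v \<in> adjoin Q c"
    proof
      assume "c \<otimes> v \<in> adjoin Q (c \<otimes> c)"
      then obtain q s where qs: "q \<in> Q" "s \<in> carrier R" "c \<otimes> v = q \<oplus> (c \<otimes> c) \<otimes> s" by (auto simp: adjoin_def)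
      have q: "q \<in> carrier R" using qs Q.Icarr by blast
      have "c \<otimes> (v \<oplus> \<ominus> (c \<otimes> s)) = c \<otimes> v \<oplus> \<ominus> ((c \<otimes> c) \<otimes> s)"
        using c(1) v qs(2) by (simp add: r_distr r_minus m_assoc)
      also have "\<dots> = q" unfolding qs(3) using q c qs(2) by (simp add: a_assoc r_neg)
      finally have "c \<otimes> (v \<oplus> \<ominus> (c \<otimes> s)) \<in> Q" using qs(1) by (rule ssubst)
      then have "v \<oplus> \<ominus> (c \<otimes> s) \<in> Q" by (rule regular_modD[OF reg(1), rotated]) (use v c(1) qs(2) in simp)
      moreover have "v = (v \<oplus> \<ominus> (c \<otimes> s)) \<oplus> c \<otimes> s" using v c(1) qs(2) by (simp add: a_assoc l_neg)
      ultimately show "v \<in> adjoin Q c" unfolding adjoin_def using qs(2) by blast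
    next
      assume "v \<in> adjoin Q c"
      then obtain q s where w: "q \<in> Q" "s \<in> carrier R" "v = q \<oplus> c \<otimes> s" by (auto simp: adjoin_def)
      then have "c \<otimes> v = c \<otimes> q \<oplus> (c \<otimes> c) \<otimes> s" "c \<otimes> q \<in> Q"
        using c(1) Q.Icarr by (simp_all add: r_distr m_assoc Q.I_l_closed)
      then show "c \<otimes> v \<in> adjoin Q (c \<otimes> c)" unfolding adjoin_def using w(2) by blast
    qed
  qed (use Cons.prems c reg in auto)
  then have "regular_list (adjoin Q (c \<otimes> c)) (map (\<lambda>c. c \<otimes> c) cs)"
    using Cons.prems by (intro Cons.IH adjoin_ideal c) auto
  then show ?case using sq by simp
qed simp

section \<open>Acyclicity of Koszul complexes and the grade inequality\<close>

text \<open>The element f + g e with e the new generator, which inverts the passage to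
  coordinates.\<close>

lemma koszul_glue:
  assumes f: "f \<in> carrier (koszul R xs)" and g: "g \<in> carrier (koszul R xs)"
  obtains v where "v \<in> carrier (koszul R (xs @ [x]))" "coord0 xs v = f" "coord1 xs v = g"
    "\<And>i. \<lbrakk>f \<in> graded_part (koszul R xs) (Suc i); g \<in> graded_part (koszul R xs) i\<rbrakk> \<Longrightarrow>
       v \<in> graded_part (koszul R (xs @ [x])) (Suc i)"
proof -
  define n where "n = length xs"
  have len: "length (xs @ [x]) = Suc n" "length xs = n" by (simp_all add: n_def)
  define v where "v = (\<lambda>S\<in>Pow {..<Suc n}. if n \<in> S then g (S - {n}) else f S)"
  have v0: "v S = f S" if "S \<subseteq> {..<n}" for S
    using that by (auto simp: v_def)
  have v1: "v (insert n S) = g S" if "S \<subseteq> {..<n}" for S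
  proof -
    have "insert n S \<subseteq> {..<Suc n}" "insert n S - {n} = S" using that by auto
    then show ?thesis by (simp add: v_def)
  qed
  have vc: "v \<in> carrier (koszul R (xs @ [x]))"
    unfolding koszul_simps(1) len
  proof (rule PiE_I)
    fix S assume "S \<in> Pow {..<Suc n}"
    then have "S \<subseteq> {..<Suc n}" by simp
    then show "v S \<in> carrier R"
    proof (cases rule: subset_lessThan_Suc_cases)
      case 1
      then show ?thesis using v0 koszul_carrierD[OF f] by (simp add: len)
    next
      case (2 T)
      then show ?thesis using v1 koszul_carrierD[OF g] by (simp add: len)
    qed
  qed (simp add: v_def)
  show ?thesis
  proof (rule that[OF vc])
    show "coord0 xs v = f" "coord1 xs v = g"
      by (rule extensionalityI[of _ "Pow {..<n}"], use f g in \<open>auto simp: len v0 v1 koszul_simps(1) PiE_iff\<close>)+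
    fix i assume fi: "f \<in> graded_part (koszul R xs) (Suc i)" and gi: "g \<in> graded_part (koszul R xs) i"
    have "v S = \<zero>" if "S \<subseteq> {..<Suc n}" "card S \<noteq> Suc i" for S
      using that(1)
    proof (cases rule: subset_lessThan_Suc_cases)
      case 1
      then show ?thesis using v0 fi that(2) by (simp add: koszul_simps(7) len)
    next
      case (2 T)
      then have "n \<notin> T" "finite T" by (auto intro: finite_subset)
      then have "card T \<noteq> i" using that(2) 2 by simp
      then show ?thesis using v1 gi 2 by (simp add: koszul_simps(7) len)
    qed
    then show "v \<in> graded_part (koszul R (xs @ [x])) (Suc i)"
      using vc unfolding koszul_simps(1,7) len by simp
  qed
qed

lemma graded_part_coord:
  assumes "z \<in> graded_part (koszul R (xs @ [x])) (Suc i)"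
  shows "coord0 xs z \<in> graded_part (koszul R xs) (Suc i)" "coord1 xs z \<in> graded_part (koszul R xs) i"
proof -
  define n where "n = length xs"
  have len: "length (xs @ [x]) = Suc n" "length xs = n" by (simp_all add: n_def)
  have z: "z S \<in> carrier R" "card S \<noteq> Suc i \<Longrightarrow> z S = \<zero>" if "S \<subseteq> {..<Suc n}" for S
    using assms that unfolding koszul_simps(7) len by auto
  have S: "S \<subseteq> {..<Suc n}" "insert n S \<subseteq> {..<Suc n}" "card (insert n S) = Suc (card S)" if "S \<subseteq> {..<n}" for S
  proof -
    show "S \<subseteq> {..<Suc n}" "insert n S \<subseteq> {..<Suc n}" using that by auto
    have "n \<notin> S" "finite S" using that by (auto intro: finite_subset)
    then show "card (insert n S) = Suc (card S)" by simp
  qed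
  show "coord0 xs z \<in> graded_part (koszul R xs) (Suc i)" "coord1 xs z \<in> graded_part (koszul R xs) i"
    unfolding koszul_simps(7) len using z S by auto
qed

lemma graded_part_add_minus:
  assumes "f \<in> graded_part (koszul R xs) i" "g \<in> graded_part (koszul R xs) i"
  shows "f \<oplus>\<^bsub>koszul R xs\<^esub> g \<in> graded_part (koszul R xs) i" "\<ominus>\<^bsub>koszul R xs\<^esub> f \<in> graded_part (koszul R xs) i"
  using assms koszul_a_inv[of f xs] graded_part_carrier[of f xs i]
  by (auto simp: koszul_simps(4,7))

lemma graded_part_sign:
  assumes "f \<in> graded_part (koszul R xs) i"
  shows "koszul_sign R xs f \<in> graded_part (koszul R xs) i"
  using assms unfolding koszul_simps(7) by (auto simp: koszul_sign_def)

lemma graded_part_d: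
  assumes xs: "set xs \<subseteq> carrier R" and f: "f \<in> graded_part (koszul R xs) (Suc i)"
  shows "differential (koszul R xs) f \<in> graded_part (koszul R xs) i"
proof -
  have fc: "f \<in> carrier (koszul R xs)" using f by (rule graded_part_carrier)
  have "differential (koszul R xs) f S = \<zero>" if S: "S \<subseteq> {..<length xs}" "card S \<noteq> i" for S
  proof -
    have fin: "finite S" using S finite_subset by blast
    have z: "(\<ominus> \<one>) [^] card {j \<in> S. j < k} \<otimes> (xs ! k \<otimes> f (insert k S)) \<in> {\<zero>}"
      if k: "k \<in> {..<length xs} - S" for k
    proof -
      have "card (insert k S) \<noteq> Suc i" using k fin S by simp
      then have "f (insert k S) = \<zero>" using f k S unfolding koszul_simps(7) by simp
      moreover have "xs ! k \<in> carrier R" using k xs by auto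
      ultimately show ?thesis using sign_pow(1) by simp
    qed
    have "(\<Oplus>k\<in>{..<length xs} - S. (\<ominus> \<one>) [^] card {j \<in> S. j < k} \<otimes> (xs ! k \<otimes> f (insert k S))) \<in> {\<zero>}"
      by (rule finsum_ideal[OF zeroideal Pi_I[OF z]])
    then show ?thesis unfolding koszul_d_apply[OF S(1)] by (rule singletonD)
  qed
  then show ?thesis using koszul_closed(1)[OF fc xs] unfolding koszul_simps(1,7) by simp
qed

text \<open>Write z = z0 + z1 e, with e the last generator. Then d z = 0 means d z1 = 0 and d z0 =
  -x \<tau>(z1). If z1 = d w, then z0 - x \<tau>(w) is a cycle over the shorter list, hence some d
  v0, and z = d(v0 + w e). The element x being regular is what makes z1 a boundary when it has
  degree 0.\<close>

lemma koszul_acyclic: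
  assumes "set xs \<subseteq> carrier R" "\<And>i. i < length xs \<Longrightarrow> regular_mod (Idl (set (take i xs))) (xs ! i)"
    and "z \<in> graded_part (koszul R xs) (Suc k)" "differential (koszul R xs) z = \<zero>\<^bsub>koszul R xs\<^esub>"
  shows "\<exists>v\<in>graded_part (koszul R xs) (Suc (Suc k)). z = differential (koszul R xs) v"
  using assms
proof (induction xs arbitrary: z k rule: rev_induct)
  case Nil
  have z0: "z = \<zero>\<^bsub>koszul R []\<^esub>"
  proof (rule koszul_eqI)
    show "z \<in> carrier (koszul R [])" "\<zero>\<^bsub>koszul R []\<^esub> \<in> carrier (koszul R [])"
      using graded_part_carrier[OF Nil.prems(3)] by (simp_all add: koszul_simps(1,2))
    show "z S = \<zero>\<^bsub>koszul R []\<^esub> S" if "S \<subseteq> {..<length []}" for S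
      using that Nil.prems(3) by (simp add: koszul_simps(2,7))
  qed
  have "\<zero>\<^bsub>koszul R []\<^esub> \<in> graded_part (koszul R []) (Suc (Suc k))" by (auto simp: koszul_simps(2,7))
  then show ?case using Nil.prems(4) z0 by metis
next
  case (snoc x xs)
  define K where "K = koszul R xs"
  define C where "C = koszul R (xs @ [x])"
  have xs: "set xs \<subseteq> carrier R" and x: "x \<in> carrier R" using snoc.prems(1) by auto
  interpret D: signed_dga R K "differential K" "koszul_sign R xs" "koszul_scale R xs"
    unfolding K_def by (rule koszul_signed_dga[OF xs])
  have reg: "regular_mod (Idl (set (take i xs))) (xs ! i)" if "i < length xs" for i
    using snoc.prems(2)[of i] that by (simp add: nth_append)
  have regx: "regular_mod (Idl (set xs)) x"
    using snoc.prems(2)[of "length xs"] by simp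
  note IH = snoc.IH[OF xs reg, folded K_def]
  have zc: "z \<in> carrier (koszul R (xs @ [x]))" using snoc.prems(3) by (rule graded_part_carrier)
  let ?z0 = "coord0 xs z" and ?z1 = "coord1 xs z"
  have z0: "?z0 \<in> graded_part K (Suc k)" and z1: "?z1 \<in> graded_part K k"
    using graded_part_coord[OF snoc.prems(3)] by (simp_all add: K_def)
  have c: "?z0 \<in> carrier K" "?z1 \<in> carrier K"
    using z0 z1 graded_part_carrier unfolding K_def by blast+
  have zero: "coord0 xs \<zero>\<^bsub>koszul R (xs @ [x])\<^esub> = \<zero>\<^bsub>K\<^esub>" "coord1 xs \<zero>\<^bsub>koszul R (xs @ [x])\<^esub> = \<zero>\<^bsub>K\<^esub>"
    unfolding K_def koszul_simps(2) by (auto intro!: restrict_ext simp: subset_iff less_Suc_eq)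
  have d0: "differential K ?z0 \<oplus>\<^bsub>K\<^esub> koszul_scale R xs x (koszul_sign R xs ?z1) = \<zero>\<^bsub>K\<^esub>"
    using coord_d(1)[OF zc snoc.prems(1), unfolded snoc.prems(4) zero(1), folded K_def] by (rule sym)
  have d1: "differential K ?z1 = \<zero>\<^bsub>K\<^esub>"
    using coord_d(2)[OF zc snoc.prems(1), unfolded snoc.prems(4) zero(2), folded K_def] by (rule sym)
  obtain w where w: "w \<in> graded_part K (Suc k)" "?z1 = differential K w"
  proof (cases k)
    case 0
    \<comment> \<open>In degree 0 the induction hypothesis says nothing, and z1 is a scalar b. The
      equation for d z0 shows that x b lies in (xs), so b does too by regularity, and elements of
      (xs) are boundaries.\<close>
    define b where "b = ?z1 {}"
    have b: "b \<in> carrier R" using koszul_carrierD[of ?z1 xs "{}"] c by (simp add: b_def K_def)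
    have z1b: "?z1 = koszul_scale R xs b \<one>\<^bsub>K\<^esub>"
      using koszul_degree_zero[OF z1[unfolded K_def 0]] unfolding b_def K_def .
    interpret X: ideal "Idl (set xs)" R by (rule genideal_ideal[OF xs])
    have dz: "differential K ?z0 {} \<in> Idl (set xs)"
    proof -
      have "xs ! i \<in> Idl (set xs)" if "i < length xs" for i
        using that genideal_self[OF xs] by auto
      then show ?thesis
        unfolding K_def koszul_d_apply[OF empty_subsetI]
        by (intro finsum_ideal[OF X.is_ideal] Pi_I X.I_l_closed X.I_r_closed sign_pow
            koszul_carrierD[OF c(1)[unfolded K_def]]) auto
    qed
    have "differential K ?z0 {} \<oplus> x \<otimes> b = \<zero>"
    proof -
      have "koszul_scale R xs x (koszul_sign R xs ?z1) {} = x \<otimes> b"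
        using b by (simp add: koszul_scale_apply koszul_sign_apply b_def)
      then show ?thesis
        using fun_cong[OF d0, of "{}"] by (simp add: K_def koszul_add_apply koszul_simps(2))
    qed
    then have "x \<otimes> b = \<ominus> differential K ?z0 {}"
      using x b dz X.Icarr by (metis a_comm m_closed minus_equality)
    then have "x \<otimes> b \<in> Idl (set xs)" using dz X.a_inv_closed by simp
    then have "b \<in> Idl (set xs)" using regular_modD[OF regx b] by blast
    then obtain F where F: "F \<in> graded_part K 1" "differential K F = koszul_scale R xs b \<one>\<^bsub>K\<^esub>"
      using Idl_lift_koszul[OF xs] unfolding K_def by blast
    show ?thesis by (rule that[of F]) (use F z1b 0 in simp_all)
  next
    case (Suc k')
    then obtain v where "v \<in> graded_part K (Suc (Suc k'))" "?z1 = differential K v"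
      using IH[OF _ z1[unfolded Suc] d1] by blast
    then show ?thesis using that Suc by simp
  qed
  have wc: "w \<in> carrier K" using w graded_part_carrier unfolding K_def by blast
  let ?y = "?z0 \<oplus>\<^bsub>K\<^esub> \<ominus>\<^bsub>K\<^esub> koszul_scale R xs x (koszul_sign R xs w)"
  have yg: "?y \<in> graded_part K (Suc k)"
    using z0 w(1) x unfolding K_def
    by (intro graded_part_add_minus graded_part_scale graded_part_sign)
  have dy: "differential K ?y = \<zero>\<^bsub>K\<^esub>"
    using c wc x d0 by (simp add: D.d_add D.d_minus D.d_scale D.d_sign D.scale_minus flip: w(2))
  obtain v0 where v0: "v0 \<in> graded_part K (Suc (Suc k))" "?y = differential K v0"
    using IH[OF _ yg dy] by blast
  have v0c: "v0 \<in> carrier K" using v0 graded_part_carrier unfolding K_def by blast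
  obtain v where v: "v \<in> carrier (koszul R (xs @ [x]))" "coord0 xs v = v0" "coord1 xs v = w"
    "v \<in> graded_part (koszul R (xs @ [x])) (Suc (Suc k))"
    using koszul_glue[of v0 xs w x] v0 v0c w(1) wc unfolding K_def by metis
  have "z = differential (koszul R (xs @ [x])) v"
  proof (rule coord_eqI[OF zc koszul_closed(1)[OF v(1) snoc.prems(1)]])
    have "coord0 xs (differential (koszul R (xs @ [x])) v) =
      differential K v0 \<oplus>\<^bsub>K\<^esub> koszul_scale R xs x (koszul_sign R xs w)"
      using coord_d(1)[OF v(1) snoc.prems(1), unfolded v(2,3), folded K_def] .
    also have "\<dots> = ?z0"
      unfolding v0(2)[symmetric] using c wc x by (simp add: D.B.a_assoc D.B.l_neg)
    finally show "?z0 = coord0 xs (differential (koszul R (xs @ [x])) v)" by (rule sym)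
    show "?z1 = coord1 xs (differential (koszul R (xs @ [x])) v)"
      using coord_d(2)[OF v(1) snoc.prems(1), unfolded v(2,3), folded K_def] w(2) by simp
  qed
  then show ?case using v(4) by blast
qed

text \<open>Each regular element \<open>g\<close> added to the ideal shifts the vanishing range of the Koszul homology by
  one, by the long exact sequence of \<open>0 \<rightarrow> R/Q \<rightarrow> R/Q \<rightarrow> R/(Q, g) \<rightarrow> 0\<close>.\<close>

lemma koszul_acyclic_mod:
  assumes xs: "set xs \<subseteq> carrier R"
    and reg: "\<And>i. i < length xs \<Longrightarrow> regular_mod (Idl (set (take i xs))) (xs ! i)"
    and "set gs \<subseteq> carrier R" "\<And>i. i < length gs \<Longrightarrow> regular_mod (Idl (set (take i gs))) (gs ! i)"
    and "length gs \<le> k" "z \<in> graded_part (koszul R xs) (Suc k)"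
    and "differential (koszul R xs) z \<in> koszul_ideal xs (Idl (set gs))"
  shows "\<exists>v\<in>graded_part (koszul R xs) (Suc (Suc k)).
    z \<oplus>\<^bsub>koszul R xs\<^esub> \<ominus>\<^bsub>koszul R xs\<^esub> differential (koszul R xs) v \<in> koszul_ideal xs (Idl (set gs))"
  using assms(3-)
proof (induction gs arbitrary: z k rule: rev_induct)
  case Nil
  have Idl0: "Idl {} = {\<zero>}"
    using genideal_minimal[OF zeroideal, of "{}"] additive_subgroup.zero_closed[OF ideal.axioms(1)[OF genideal_ideal[of "{}"]]]
    by auto
  have zc: "z \<in> carrier (koszul R xs)" using Nil.prems(4) by (rule graded_part_carrier)
  have "differential (koszul R xs) z = \<zero>\<^bsub>koszul R xs\<^esub>"
    by (rule koszul_eqI[OF koszul_closed(1)[OF zc xs]])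
      (use Nil.prems(5) in \<open>auto simp: koszul_simps(1,2) koszul_ideal_def Idl0\<close>)
  then obtain v where v: "v \<in> graded_part (koszul R xs) (Suc (Suc k))" "z = differential (koszul R xs) v"
    using koszul_acyclic[OF xs reg Nil.prems(4)] by blast
  interpret K: abelian_group "koszul R xs" by (rule koszul_abelian_group)
  have "z \<oplus>\<^bsub>koszul R xs\<^esub> \<ominus>\<^bsub>koszul R xs\<^esub> differential (koszul R xs) v = \<zero>\<^bsub>koszul R xs\<^esub>"
    unfolding v(2)[symmetric] using zc by (rule K.r_neg)
  then show ?case using v(1) koszul_ideal_zero[OF zeroideal] by (metis Idl0 list.set(1))
next
  case (snoc g gs)
  define K where "K = koszul R xs"
  define Q where "Q = Idl (set gs)"
  interpret D: signed_dga R K "differential K" "koszul_sign R xs" "koszul_scale R xs"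
    unfolding K_def by (rule koszul_signed_dga[OF xs])
  have gs: "set gs \<subseteq> carrier R" and g: "g \<in> carrier R" using snoc.prems(1) by auto
  have Q: "ideal Q R" unfolding Q_def by (rule genideal_ideal[OF gs])
  have Q': "Idl (set (gs @ [g])) = adjoin Q g"
    using Idl_insert_eq_adjoin[OF gs g] by (simp add: Q_def)
  have idl': "ideal (adjoin Q g) R" by (rule adjoin_ideal[OF Q g])
  have regs: "regular_mod (Idl (set (take i gs))) (gs ! i)" if "i < length gs" for i
    using snoc.prems(2)[of i] that by (simp add: nth_append)
  have regg: "regular_mod Q g" using snoc.prems(2)[of "length gs"] by (simp add: Q_def)
  obtain k' where k: "k = Suc k'" "length gs \<le> k'" using snoc.prems(3) by (cases k) auto
  note IH = snoc.IH[OF gs regs, folded Q_def K_def]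
  note cl = koszul_ideal_closed[OF Q xs, folded K_def] and cl' = koszul_ideal_closed[OF idl' xs, folded K_def]
  have zg: "z \<in> graded_part K (Suc k)" and zc: "z \<in> carrier K"
    using snoc.prems(4) graded_part_carrier unfolding K_def by blast+
  have mono: "w \<in> koszul_ideal xs (adjoin Q g)" if "w \<in> koszul_ideal xs Q" for w
    using that adjoin_memI(1)[OF Q g] by (auto simp: koszul_ideal_def)
  have gmem: "koszul_scale R xs g w \<in> koszul_ideal xs (adjoin Q g)" if "w \<in> carrier K" for w
    using that koszul_closed(3)[OF _ xs g] adjoin_memI(2)[OF Q g]
    by (auto simp: koszul_ideal_def koszul_scale_apply K_def koszul_carrierD)
  have dg: "differential K z \<in> graded_part K k"
    using graded_part_d[OF xs] zg unfolding K_def by blast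
  \<comment> \<open>This w represents the connecting homomorphism: modulo Q it is a cycle one degree
    lower, where k' still bounds the number of remaining elements, so it is d v modulo Q. Then z - g
    v is a cycle modulo Q to which the induction hypothesis applies, and g v vanishes modulo (Q,
    g).\<close>
  obtain q w where w: "q \<in> koszul_ideal xs Q" "w \<in> carrier K" "differential K z = q \<oplus>\<^bsub>K\<^esub> koszul_scale R xs g w"
    "w \<in> graded_part K k"
    using koszul_ideal_add_decomp[OF snoc.prems(5)[unfolded Q'] g Q] dg
    unfolding K_def by metis
  have qc: "q \<in> carrier K" using cl(1)[OF w(1) zc] .
  have "koszul_scale R xs g (differential K w) = \<ominus>\<^bsub>K\<^esub> differential K q"
  proof -
    have "\<zero>\<^bsub>K\<^esub> = differential K (differential K z)" using zc by simp
    also have "\<dots> = differential K q \<oplus>\<^bsub>K\<^esub> koszul_scale R xs g (differential K w)"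
      unfolding w(3) using qc w(2) g by (simp add: D.d_add D.d_scale)
    finally show ?thesis using qc w(2) g
      by (metis D.B.a_comm D.B.minus_equality D.d_closed D.scale_closed)
  qed
  also have "\<dots> \<in> koszul_ideal xs Q" by (rule cl(4)[OF cl(2)[OF w(1) zc] zc])
  finally have dw: "differential K w \<in> koszul_ideal xs Q"
    by (rule koszul_ideal_cancel[where xs = xs, folded K_def, rotated])
      (use w(2) regular_modD[OF regg] in simp_all)
  obtain v where v: "v \<in> graded_part K (Suc k)" "w \<oplus>\<^bsub>K\<^esub> \<ominus>\<^bsub>K\<^esub> differential K v \<in> koszul_ideal xs Q"
    using IH[OF _ k(2) w(4)[unfolded k(1)] dw] unfolding k(1) by blast
  have vc: "v \<in> carrier K" using v graded_part_carrier unfolding K_def by blast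
  let ?y = "z \<oplus>\<^bsub>K\<^esub> \<ominus>\<^bsub>K\<^esub> koszul_scale R xs g v"
  have yg: "?y \<in> graded_part K (Suc k)"
    using zg v(1) g unfolding K_def by (intro graded_part_add_minus graded_part_scale)
  have "differential K ?y = q \<oplus>\<^bsub>K\<^esub> koszul_scale R xs g (w \<oplus>\<^bsub>K\<^esub> \<ominus>\<^bsub>K\<^esub> differential K v)"
    using zc vc g qc w(2) by (simp add: D.d_add D.d_minus D.d_scale w(3) D.scale_add D.scale_minus D.B.a_assoc)
  also have "\<dots> \<in> koszul_ideal xs Q"
  proof (rule cl(6)[OF w(1) zc])
    have c: "w \<oplus>\<^bsub>K\<^esub> \<ominus>\<^bsub>K\<^esub> differential K v \<in> carrier K" using w(2) vc by simp
    have "koszul_scale R xs g (w \<oplus>\<^bsub>K\<^esub> \<ominus>\<^bsub>K\<^esub> differential K v) =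
      (w \<oplus>\<^bsub>K\<^esub> \<ominus>\<^bsub>K\<^esub> differential K v) \<otimes>\<^bsub>K\<^esub> koszul_scale R xs g \<one>\<^bsub>K\<^esub>"
      using c g by (simp add: D.scale_mult_right)
    also have "\<dots> \<in> koszul_ideal xs Q" by (rule cl(5)[OF v(2)]) (use g in simp)
    finally show "koszul_scale R xs g (w \<oplus>\<^bsub>K\<^esub> \<ominus>\<^bsub>K\<^esub> differential K v) \<in> koszul_ideal xs Q" .
  qed
  finally have dy: "differential K ?y \<in> koszul_ideal xs Q" .
  obtain u where u: "u \<in> graded_part K (Suc (Suc k))" "?y \<oplus>\<^bsub>K\<^esub> \<ominus>\<^bsub>K\<^esub> differential K u \<in> koszul_ideal xs Q"
    using IH[OF _ _ yg dy] k by auto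
  have uc: "u \<in> carrier K" using u graded_part_carrier unfolding K_def by blast
  have "z \<oplus>\<^bsub>K\<^esub> \<ominus>\<^bsub>K\<^esub> differential K u =
    (?y \<oplus>\<^bsub>K\<^esub> \<ominus>\<^bsub>K\<^esub> differential K u) \<oplus>\<^bsub>K\<^esub> koszul_scale R xs g v"
    using zc uc vc g
    by (simp add: D.B.a_assoc D.B.a_comm[of "\<ominus>\<^bsub>K\<^esub> differential K u" "koszul_scale R xs g v"] D.B.r_neg1)
  also have "\<dots> \<in> koszul_ideal xs (adjoin Q g)"
    by (rule cl'(6)[OF mono[OF u(2)] zc gmem[OF vc]])
  finally show ?case using u(1) unfolding Q' K_def by blast
qed

text \<open>Such a u makes u e_0 ... e_(n-1) a cycle of top degree n in the Koszul complex modulo Q.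
  Homology vanishes there because n exceeds the length of gs, so it is a boundary modulo Q.
  Boundaries have no coefficient in top degree, and therefore u lies in Q.\<close>

lemma colon_regular_sequence:
  assumes xs: "set xs \<subseteq> carrier R"
    and reg: "\<And>i. i < length xs \<Longrightarrow> regular_mod (Idl (set (take i xs))) (xs ! i)"
    and gs: "set gs \<subseteq> carrier R" "\<And>i. i < length gs \<Longrightarrow> regular_mod (Idl (set (take i gs))) (gs ! i)"
    and len: "length gs < length xs"
    and u: "u \<in> carrier R" "\<And>x. x \<in> set xs \<Longrightarrow> x \<otimes> u \<in> Idl (set gs)"
  shows "u \<in> Idl (set gs)"
proof -
  let ?Q = "Idl (set gs)" and ?n = "length xs"
  interpret Q: ideal ?Q R by (rule genideal_ideal[OF gs(1)])
  define z where "z = (\<lambda>S\<in>Pow {..<?n}. if S = {..<?n} then u else \<zero>)"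
  obtain k where k: "?n = Suc k" "length gs \<le> k" using len by (cases ?n) auto
  have zg: "z \<in> graded_part (koszul R xs) (Suc k)"
    unfolding koszul_simps(7) k(1)[symmetric] z_def using u(1) by auto
  have zc: "z \<in> carrier (koszul R xs)" using zg by (rule graded_part_carrier)
  have xc: "xs ! i \<in> carrier R" if "i < ?n" for i using xs that by auto
  have dz: "differential (koszul R xs) z \<in> koszul_ideal xs ?Q"
    unfolding koszul_ideal_def
  proof (intro CollectI conjI allI impI koszul_closed(1)[OF zc xs])
    fix S assume S: "S \<subseteq> {..<?n}"
    have "xs ! i \<otimes> z (insert i S) \<in> ?Q" if i: "i \<in> {..<?n} - S" for i
    proof -
      have "insert i S \<subseteq> {..<?n}" using i S by auto
      then have "z (insert i S) = u \<or> z (insert i S) = \<zero>" by (auto simp: z_def)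
      then show ?thesis using u(2)[of "xs ! i"] i xc[of i] by auto
    qed
    then show "differential (koszul R xs) z S \<in> ?Q"
      unfolding koszul_d_apply[OF S]
      by (intro finsum_ideal[OF Q.is_ideal] Pi_I Q.I_l_closed[OF _ sign_pow(1)])
  qed
  obtain v where v: "v \<in> graded_part (koszul R xs) (Suc (Suc k))"
    "z \<oplus>\<^bsub>koszul R xs\<^esub> \<ominus>\<^bsub>koszul R xs\<^esub> differential (koszul R xs) v \<in> koszul_ideal xs ?Q"
    using koszul_acyclic_mod[OF xs reg gs k(2) zg dz] by blast
  have vc: "v \<in> carrier (koszul R xs)" using v(1) by (rule graded_part_carrier)
  have "(z \<oplus>\<^bsub>koszul R xs\<^esub> \<ominus>\<^bsub>koszul R xs\<^esub> differential (koszul R xs) v) {..<?n} = u"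
    using u(1) koszul_closed(1)[OF vc xs]
    by (simp add: koszul_add_apply koszul_minus_apply koszul_d_apply z_def)
  then show ?thesis using v(2) unfolding koszul_ideal_def by force
qed

section \<open>The local case\<close>

lemma grade_ge_regular_sequence:
  assumes "enat n \<le> grade R I" "0 < n" "I \<subseteq> carrier R"
  obtains fs where "length fs = n" "set fs \<subseteq> I"
    "\<And>i. i < n \<Longrightarrow> regular_mod (Idl (set (take i fs))) (fs ! i)"
proof -
  have "\<exists>xs. set xs \<subseteq> I \<and> regular_sequence R xs \<and> n \<le> length xs"
  proof (rule ccontr)
    assume *: "\<not> ?thesis"
    \<comment> \<open>The grade is a supremum that is not known to be attained. Were all lengths
      below n, it would be at most n - 1; a longer sequence is truncated.\<close>
    have "grade R I \<le> enat (n - 1)"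
      unfolding grade_def
    proof (rule Sup_least)
      fix l assume "l \<in> {enat (length xs) |xs. set xs \<subseteq> I \<and> regular_sequence R xs}"
      then obtain xs where "l = enat (length xs)" "set xs \<subseteq> I" "regular_sequence R xs" by blast
      then show "l \<le> enat (n - 1)" using * by force
    qed
    then have "enat n \<le> enat (n - 1)" using assms(1) by (rule order_trans[rotated])
    then show False using assms(2) by simp
  qed
  then obtain xs where xs: "set xs \<subseteq> I" "regular_sequence R xs" "n \<le> length xs" by blast
  show ?thesis
  proof (rule that[of "take n xs"])
    show "length (take n xs) = n" using xs by simp
    show "set (take n xs) \<subseteq> I" using xs(1) set_take_subset by fast
    show "regular_mod (Idl (set (take i (take n xs)))) (take n xs ! i)" if "i < n" for i
      using xs that unfolding regular_sequence_def regular_mod_def by (simp add: min_def)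
  qed
qed

text \<open>Lifts of generators of M/Q generate M up to Q, that is, M = (xt) + Q. Removing the
  summand Q is left to the Nakayama arguments.\<close>

lemma quotient_generators:
  assumes Q: "ideal Q R" and M: "ideal M R" "Q \<subseteq> M" and xt: "set xt \<subseteq> carrier R"
    and gen: "Idl\<^bsub>R Quot Q\<^esub> (set (map ((+>) Q) xt)) = (+>) Q ` M"
  shows "Idl (set xt) \<subseteq> M" and "m \<in> M \<Longrightarrow> \<exists>x\<in>Idl (set xt). \<exists>q\<in>Q. m = x \<oplus> q"
proof -
  define A where "A = R Quot Q"
  interpret A: ring A unfolding A_def by (rule ideal.quotient_is_ring[OF Q])
  have Qc: "a \<in> carrier R" if "a \<in> Q" for a using ideal.Icarr[OF Q that] .
  have Mc: "a \<in> carrier R" if "a \<in> M" for a using ideal.Icarr[OF M(1) that] .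
  have N: "ideal (Idl (set xt)) R" by (rule genideal_ideal[OF xt])
  have Xc: "a \<in> carrier R" if "a \<in> Idl (set xt)" for a using ideal.Icarr[OF N that] .
  have eqD: "\<exists>q\<in>Q. a = b \<oplus> q" if "a \<in> carrier R" "b \<in> carrier R" "Q +> a = Q +> b" for a b
  proof -
    have "a \<in> Q +> b"
      using that additive_subgroup.a_subgroup[OF ideal.axioms(1)[OF Q]] ideal.axioms(1)[OF Q]
      by (metis abelian_subgroup.a_rcos_self abelian_subgroupI3 abelian_group_axioms)
    then obtain q where "q \<in> Q" "a = q \<oplus> b" by (auto simp: a_r_coset_def' )
    then show ?thesis using Qc that(2) a_comm by blast
  qed
  have sub: "set (map ((+>) Q) xt) \<subseteq> carrier A"
    using xt by (auto simp: A_def FactRing_def A_RCOSETS_def')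
  show "Idl (set xt) \<subseteq> M"
  proof (rule genideal_minimal[OF M(1)], rule subsetI)
    fix x assume x: "x \<in> set xt"
    then have "Q +> x \<in> (+>) Q ` M" using A.genideal_self[OF sub] gen by (auto simp: A_def)
    then obtain m where m: "m \<in> M" "Q +> x = Q +> m" by auto
    then obtain q where "q \<in> Q" "x = m \<oplus> q" using eqD[of x m] x xt Mc by blast
    then show "x \<in> M" using m M additive_subgroup.a_closed[OF ideal.axioms(1)[OF M(1)]] by blast
  qed
  show "\<exists>x\<in>Idl (set xt). \<exists>q\<in>Q. m = x \<oplus> q" if m: "m \<in> M"
  proof -
    have "(Idl\<^bsub>A\<^esub> (set (map ((+>) Q) xt))) \<subseteq> (+>) Q ` (Idl (set xt))"
    proof (rule A.genideal_minimal)
      show "ideal ((+>) Q ` (Idl (set xt))) A"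
        unfolding A_def by (rule ring_ideal_imp_quot_ideal[OF Q N])
      show "set (map ((+>) Q) xt) \<subseteq> (+>) Q ` (Idl (set xt))"
        using genideal_self[OF xt] by auto
    qed
    then have "Q +> m \<in> (+>) Q ` (Idl (set xt))" using gen m by (auto simp: A_def)
    then obtain x where "x \<in> Idl (set xt)" "Q +> m = Q +> x" by auto
    then show ?thesis using eqD[of m x] Mc[OF m] Xc by blast
  qed
qed

section \<open>Nakayama's lemma for a finite list, by elimination\<close>

primrec ideal_combinations :: "'a set \<Rightarrow> 'a set \<Rightarrow> 'a list \<Rightarrow> 'a set" where
  "ideal_combinations M N [] = N"
| "ideal_combinations M N (b # bs) = {w \<oplus> c \<otimes> b |w c. w \<in> ideal_combinations M N bs \<and> c \<in> M}"

lemma ideal_combinations_ideal: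
  assumes M: "ideal M R" and N: "ideal N R" and "set bs \<subseteq> carrier R"
  shows "ideal (ideal_combinations M N bs) R"
  using assms(3)
proof (induction bs)
  case (Cons b bs)
  let ?W = "ideal_combinations M N bs"
  interpret M: ideal M R by fact
  interpret W: ideal ?W R using Cons by simp
  have b: "b \<in> carrier R" using Cons.prems by simp
  have "ideal (?W <+> (\<lambda>c. c \<otimes> b) ` M) R"
  proof (rule add_ideals[OF W.is_ideal])
    show "ideal ((\<lambda>c. c \<otimes> b) ` M) R"
    proof (rule idealI[OF ring_axioms])
      show "subgroup ((\<lambda>c. c \<otimes> b) ` M) (add_monoid R)"
      proof (rule add.subgroupI)
        show "(\<lambda>c. c \<otimes> b) ` M \<subseteq> carrier R" using b M.Icarr by auto
        show "(\<lambda>c. c \<otimes> b) ` M \<noteq> {}" using M.zero_closed by blast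
        fix a a' assume "a \<in> (\<lambda>c. c \<otimes> b) ` M" "a' \<in> (\<lambda>c. c \<otimes> b) ` M"
        then obtain c c' where c: "c \<in> M" "c' \<in> M" "a = c \<otimes> b" "a' = c' \<otimes> b" by auto
        show "\<ominus> a \<in> (\<lambda>c. c \<otimes> b) ` M"
          by (rule image_eqI[of _ _ "\<ominus> c"]) (use c b M.Icarr in \<open>simp_all add: l_minus\<close>)
        show "a \<oplus> a' \<in> (\<lambda>c. c \<otimes> b) ` M"
          by (rule image_eqI[of _ _ "c \<oplus> c'"]) (use c b M.Icarr in \<open>simp_all add: l_distr\<close>)
      qed
      fix a x assume "a \<in> (\<lambda>c. c \<otimes> b) ` M" and x: "x \<in> carrier R"
      then obtain c where c: "c \<in> M" "a = c \<otimes> b" by auto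
      show "x \<otimes> a \<in> (\<lambda>c. c \<otimes> b) ` M"
        by (rule image_eqI[of _ _ "x \<otimes> c"]) (use c b x M.Icarr in \<open>simp_all add: m_assoc M.I_l_closed\<close>)
      then show "a \<otimes> x \<in> (\<lambda>c. c \<otimes> b) ` M" using c b x M.Icarr by (simp add: m_comm)
    qed
  qed
  moreover have "ideal_combinations M N (b # bs) = ?W <+> (\<lambda>c. c \<otimes> b) ` M"
    by (auto simp: set_add_def')
  ultimately show ?case by simp
qed (use N in simp)

lemma ideal_combinations_memI:
  assumes M: "ideal M R" and N: "ideal N R" and "set bs \<subseteq> carrier R"
  shows "x \<in> N \<Longrightarrow> x \<in> ideal_combinations M N bs"
    and "b \<in> set bs \<Longrightarrow> c \<in> M \<Longrightarrow> c \<otimes> b \<in> ideal_combinations M N bs"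
proof -
  have step: "w \<in> ideal_combinations M N (a # bs)"
    if "w \<in> ideal_combinations M N bs" "set (a # bs) \<subseteq> carrier R" for w a bs
  proof -
    have "w \<in> carrier R" using ideal.Icarr[OF ideal_combinations_ideal[OF M N]] that by auto
    then have "w = w \<oplus> \<zero> \<otimes> a" using that by simp
    then show ?thesis
      using that(1) additive_subgroup.zero_closed[OF ideal.axioms(1)[OF M]] by auto
  qed
  show N': "x \<in> ideal_combinations M N bs" if "x \<in> N" for x
    using assms(3) that by (induction bs) (simp_all only: ideal_combinations.simps(1), auto intro!: step simp del: ideal_combinations.simps)
  show "c \<otimes> b \<in> ideal_combinations M N bs" if "b \<in> set bs" "c \<in> M"
    using assms(3) that(1)
  proof (induction bs)
    case (Cons a bs)
    show ?case
    proof (cases "b \<in> set bs")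
      case True
      then show ?thesis using Cons by (intro step) auto
    next
      case False
      then have ba: "b = a" using Cons by simp
      have "\<zero> \<in> ideal_combinations M N bs"
        using Cons.prems ideal_combinations_ideal[OF M N, of bs] by (simp add: additive_subgroup.zero_closed ideal.axioms(1))
      moreover have "c \<otimes> b = \<zero> \<oplus> c \<otimes> a" using ba Cons.prems ideal.Icarr[OF M that(2)] by simp
      ultimately show ?thesis using that(2) by auto
    qed
  qed simp
qed

text \<open>\<open>ideal_combinations\<close> is N + M b_1 + ... + M b_n. The equation b = w + c b
  gives (1 - c) b = w, and 1 - c is a unit, so b is a combination of the others and can be
  eliminated. Once the others lie in N, so does b.\<close>

lemma nakayama_list:
  assumes M: "ideal M R" and unit: "\<And>c. c \<in> M \<Longrightarrow> \<exists>u\<in>carrier R. u \<otimes> (\<one> \<oplus> \<ominus> c) = \<one>"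
    and N: "ideal N R" and "set bs \<subseteq> carrier R" "\<And>b. b \<in> set bs \<Longrightarrow> b \<in> ideal_combinations M N bs"
  shows "set bs \<subseteq> N"
  using assms(4,5)
proof (induction bs)
  case (Cons b bs)
  let ?W = "ideal_combinations M N bs"
  have bs: "set bs \<subseteq> carrier R" and b: "b \<in> carrier R" using Cons.prems by auto
  interpret W: ideal ?W R by (rule ideal_combinations_ideal[OF M N bs])
  have Mc: "c \<in> carrier R" if "c \<in> M" for c using ideal.Icarr[OF M that] .
  obtain w c where w: "w \<in> ?W" "c \<in> M" "b = w \<oplus> c \<otimes> b" using Cons.prems(2)[of b] by auto
  obtain u where u: "u \<in> carrier R" "u \<otimes> (\<one> \<oplus> \<ominus> c) = \<one>" using unit[OF w(2)] by blast
  have "(\<one> \<oplus> \<ominus> c) \<otimes> b = b \<oplus> \<ominus> (c \<otimes> b)" using Mc[OF w(2)] b by (simp add: l_distr l_minus)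
  also have "\<dots> = (w \<oplus> c \<otimes> b) \<oplus> \<ominus> (c \<otimes> b)" using w(3) by simp
  also have "\<dots> = w" using W.Icarr[OF w(1)] Mc[OF w(2)] b by (simp add: add_minus_cancel)
  finally have wb: "(\<one> \<oplus> \<ominus> c) \<otimes> b = w" .
  have "b = u \<otimes> (\<one> \<oplus> \<ominus> c) \<otimes> b" using u(2) b by simp
  also have "\<dots> = u \<otimes> ((\<one> \<oplus> \<ominus> c) \<otimes> b)" using u(1) b Mc[OF w(2)] by (intro m_assoc) auto
  also have "\<dots> = u \<otimes> w" unfolding wb ..
  finally have "b = u \<otimes> w" .
  then have bW: "b \<in> ?W" using W.I_l_closed[OF w(1) u(1)] by simp
  have "set bs \<subseteq> N"
  proof (rule Cons.IH[OF bs])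
    fix a assume "a \<in> set bs"
    then obtain w c where w: "w \<in> ?W" "c \<in> M" "a = w \<oplus> c \<otimes> b" using Cons.prems(2)[of a] by auto
    show "a \<in> ?W" unfolding w(3) by (intro W.a_closed W.I_l_closed w(1) bW Mc w(2))
  qed
  moreover have "b \<in> N"
  proof -
    interpret N: ideal N R by fact
    have "ideal_combinations M N cs \<subseteq> N" if "set cs \<subseteq> N" for cs
      using that by (induction cs) (auto intro!: N.a_closed N.I_l_closed Mc)
    then show ?thesis using bW calculation by blast
  qed
  ultimately show ?case by simp
qed simp

text \<open>Each b in fs lies in N up to an error in the ideal of the squares. Since c^2 = c c with
  c in M, this error lies in N + M fs, so Nakayama's lemma applies to the finite list fs
  itself.\<close>

lemma nakayama_squares:
  assumes M: "ideal M R" and unit: "\<And>c. c \<in> M \<Longrightarrow> \<exists>u\<in>carrier R. u \<otimes> (\<one> \<oplus> \<ominus> c) = \<one>"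
    and N: "ideal N R" and fs: "set fs \<subseteq> M"
    and Q: "Q \<subseteq> Idl ((\<lambda>c. c \<otimes> c) ` set fs)"
    and dec: "\<And>b. b \<in> set fs \<Longrightarrow> \<exists>x\<in>N. \<exists>q\<in>Q. b = x \<oplus> q"
  shows "set fs \<subseteq> N"
proof (rule nakayama_list[OF M unit N])
  have Mc: "c \<in> carrier R" if "c \<in> M" for c using ideal.Icarr[OF M that] .
  show fsc: "set fs \<subseteq> carrier R" using fs Mc by auto
  interpret W: ideal "ideal_combinations M N fs" R by (rule ideal_combinations_ideal[OF M N fsc])
  note mem = ideal_combinations_memI[OF M N fsc]
  have "Idl ((\<lambda>c. c \<otimes> c) ` set fs) \<subseteq> ideal_combinations M N fs"
    by (rule genideal_minimal[OF W.is_ideal]) (use mem(2) fs in auto)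
  then show "b \<in> ideal_combinations M N fs" if b: "b \<in> set fs" for b
    using dec[OF b] Q mem(1) W.a_closed by blast
qed

end

section \<open>Units and proper ideals in local rings\<close>

lemma (in noetherian_ring) proper_ideal_maximal:
  assumes "ideal I R" "I \<noteq> carrier R"
  obtains M where "maximalideal M R" "I \<subseteq> M"
proof -
  define \<A> where "\<A> = {J. ideal J R \<and> I \<subseteq> J \<and> J \<noteq> carrier R}"
  have "\<exists>M\<in>\<A>. \<forall>N\<in>\<A>. M \<subseteq> N \<longrightarrow> N = M"
  proof (rule subset_Zorn)
    fix C assume C: "subset.chain \<A> C"
    show "\<exists>U\<in>\<A>. \<forall>N\<in>C. N \<subseteq> U"
    proof (cases "C = {}")
      case True
      then show ?thesis using assms by (auto simp: \<A>_def)
    next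
      case False
      have "subset.chain {I. ideal I R} C"
        using C unfolding subset.chain_def \<A>_def by blast
      then have "\<Union>C \<in> C" using ideal_chain_is_trivial[OF False] by blast
      then have "\<Union>C \<in> \<A>" using C unfolding subset.chain_def by blast
      then show ?thesis by (intro bexI[of _ "\<Union>C"]) auto
    qed
  qed
  then obtain M where M: "M \<in> \<A>" "\<And>N. N \<in> \<A> \<Longrightarrow> M \<subseteq> N \<Longrightarrow> N = M" by blast
  have "maximalideal M R"
  proof (rule maximalidealI)
    show "ideal M R" "carrier R \<noteq> M" using M(1) by (auto simp: \<A>_def)
    fix J assume "ideal J R" "M \<subseteq> J" "J \<subseteq> carrier R"
    then show "J = M \<or> J = carrier R" using M(1) M(2)[of J] unfolding \<A>_def by blast
  qed
  then show ?thesis using that M(1) by (auto simp: \<A>_def)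
qed

lemma local_ring_units:
  fixes R (structure)
  assumes "local_ring R \<mm>" "r \<in> carrier R" "r \<notin> \<mm>"
  shows "\<exists>u\<in>carrier R. u \<otimes> r = \<one>"
proof -
  interpret cring R using assms(1) by (simp add: local_ring_def)
  interpret noetherian_ring R using assms(1) by (simp add: local_ring_def)
  have "PIdl r = carrier R"
  proof (rule ccontr)
    assume "PIdl r \<noteq> carrier R"
    then obtain M where "maximalideal M R" "PIdl r \<subseteq> M"
      using proper_ideal_maximal[OF cgenideal_ideal[OF assms(2)]] by blast
    then have "PIdl r \<subseteq> \<mm>" using assms(1) by (auto simp: local_ring_def)
    then show False using cgenideal_self[OF assms(2)] assms(3) by blast
  qed
  then have "\<one> \<in> PIdl r" by simp
  then show ?thesis by (auto simp: cgenideal_def)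
qed

lemma local_ring_proper_ideal:
  fixes R (structure)
  assumes "local_ring R \<mm>" "ideal I R" "I \<noteq> carrier R"
  shows "I \<subseteq> \<mm>"
proof -
  interpret noetherian_ring R using assms(1) by (simp add: local_ring_def)
  obtain M where "maximalideal M R" "I \<subseteq> M" using proper_ideal_maximal[OF assms(2,3)] .
  then show ?thesis using assms(1) by (auto simp: local_ring_def)
qed

theorem local_ring_not_golod:
  fixes R (structure)
  assumes loc: "local_ring R \<mm>" and I: "ideal I R" "I \<noteq> carrier R" and grade: "4 \<le> grade R I"
  shows "\<exists>J. ideal J R \<and> J \<subseteq> I \<and> \<not> golod_local (R Quot (I \<cdot> J)) ((\<lambda>r. (I \<cdot> J) +> r) ` \<mm>)"
proof -
  interpret cring R using loc by (simp add: local_ring_def)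
  have M: "ideal \<mm> R" and M1: "\<one> \<notin> \<mm>"
  proof -
    have "maximalideal \<mm> R" using loc by (simp add: local_ring_def)
    then show "ideal \<mm> R" by (rule maximalideal.axioms(1))
    then show "\<one> \<notin> \<mm>" using ideal.one_imp_carrier maximalideal.I_notcarr \<open>maximalideal \<mm> R\<close> by metis
  qed
  have IM: "I \<subseteq> \<mm>" by (rule local_ring_proper_ideal[OF loc I])
  have Ic: "I \<subseteq> carrier R" using ideal.Icarr[OF I(1)] by blast
  have "enat 4 \<le> grade R I" using grade by (simp add: numeral_eq_enat)
  then obtain fs where fs: "length fs = 4" "set fs \<subseteq> I"
    and reg: "\<And>i. i < 4 \<Longrightarrow> regular_mod (Idl (set (take i fs))) (fs ! i)"
    using grade_ge_regular_sequence[of 4 I] Ic by auto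
  have fsc: "set fs \<subseteq> carrier R" using fs Ic by blast
  define sq where "sq = (\<lambda>c. c \<otimes> c)"
  \<comment> \<open>The recursive form of regularity serves only to pass to squares;
    \<open>regular_list_iff\<close> translates back to prefixes.\<close>
  have "regular_list (Idl {}) fs"
    using regular_list_iff[OF empty_subsetI fsc] fs reg by simp
  then have "regular_list (Idl {}) (map sq fs)"
    unfolding sq_def using fsc by (intro regular_list_squares genideal_ideal) auto
  moreover have sqc: "set (map sq fs) \<subseteq> carrier R" using fsc by (auto simp: sq_def)
  ultimately have regsq: "\<forall>i<4. regular_mod (Idl (set (take i (map sq fs)))) (sq (fs ! i))"
    using regular_list_iff[OF empty_subsetI sqc] fs by simp
  have img: "(\<lambda>j. fs ! j \<otimes> fs ! j) ` {..<i} = set (take i (map sq fs))" if "i \<le> 4" for i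
    using that fs(1) by (force simp: set_conv_nth sq_def)
  define J where "J = Idl ((\<lambda>j. fs ! j \<otimes> fs ! j) ` {..<4})"
  have Jeq: "J = Idl (sq ` set fs)" unfolding J_def img[OF order_refl] using fs(1) by simp
  have J: "ideal J R" unfolding Jeq by (rule genideal_ideal) (use sqc in simp)
  have JI: "J \<subseteq> I"
    unfolding Jeq by (rule genideal_minimal[OF I(1)])
      (use fs(2) fsc ideal.I_l_closed[OF I(1)] in \<open>auto simp: sq_def\<close>)
  have Q: "ideal (I \<cdot> J) R" and QJ: "I \<cdot> J \<subseteq> J"
    using ideal_prod_is_ideal[OF I(1) J] ideal_prod_inter[OF I(1) J] by auto
  have "\<not> golod_local (R Quot (I \<cdot> J)) ((\<lambda>r. (I \<cdot> J) +> r) ` \<mm>)"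
  proof
    assume "golod_local (R Quot (I \<cdot> J)) ((\<lambda>r. (I \<cdot> J) +> r) ` \<mm>)"
    then obtain ys where ys: "minimal_generators (R Quot (I \<cdot> J)) ((+>) (I \<cdot> J) ` \<mm>) ys"
      and adm: "admits_trivial_massey_operation (koszul (R Quot (I \<cdot> J)) ys)"
      by (auto simp: golod_local_def)
    \<comment> \<open>The generators used by the Golod property live in the factor ring. Lifting
      them presents its Koszul complex as the image of one over R.\<close>
    have "\<forall>y\<in>set ys. \<exists>x\<in>carrier R. I \<cdot> J +> x = y"
      using ys by (auto simp: minimal_generators_def FactRing_def A_RCOSETS_def')
    then obtain p where p: "\<And>y. y \<in> set ys \<Longrightarrow> p y \<in> carrier R \<and> I \<cdot> J +> p y = y" by metis
    define xt where "xt = map p ys"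
    have xt: "set xt \<subseteq> carrier R" "map ((+>) (I \<cdot> J)) xt = ys"
      using p by (auto simp: xt_def map_idI)
    have gen: "Idl\<^bsub>R Quot (I \<cdot> J)\<^esub> (set (map ((+>) (I \<cdot> J)) xt)) = (+>) (I \<cdot> J) ` \<mm>"
      using ys unfolding xt(2) minimal_generators_def by blast
    have QM: "I \<cdot> J \<subseteq> \<mm>" using QJ JI IM by blast
    note quo = quotient_generators[OF Q M QM xt(1) gen]
    have N: "ideal (Idl (set xt)) R" by (rule genideal_ideal[OF xt(1)])
    have unit: "\<exists>u\<in>carrier R. u \<otimes> (\<one> \<oplus> \<ominus> c) = \<one>" if c: "c \<in> \<mm>" for c
    proof (rule local_ring_units[OF loc])
      have cc: "c \<in> carrier R" using ideal.Icarr[OF M c] .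
      then show "\<one> \<oplus> \<ominus> c \<in> carrier R" by simp
      show "\<one> \<oplus> \<ominus> c \<notin> \<mm>"
      proof
        assume "\<one> \<oplus> \<ominus> c \<in> \<mm>"
        then have "(\<one> \<oplus> \<ominus> c) \<oplus> c \<in> \<mm>"
          using additive_subgroup.a_closed[OF ideal.axioms(1)[OF M]] c by blast
        then show False using M1 cc by (simp add: a_assoc l_neg)
      qed
    qed
    \<comment> \<open>Needed for d F_i = f_i in the Koszul complex on \<open>xt\<close>: the lifts
      generate the maximal ideal a priori only modulo I J.\<close>
    have fX: "set fs \<subseteq> Idl (set xt)"
    proof (rule nakayama_squares[OF M unit N])
      show "set fs \<subseteq> \<mm>" using fs IM by blast
      show "I \<cdot> J \<subseteq> Idl ((\<lambda>c. c \<otimes> c) ` set fs)" using QJ unfolding Jeq sq_def .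
      show "\<exists>x\<in>Idl (set xt). \<exists>q\<in>I \<cdot> J. b = x \<oplus> q" if "b \<in> set fs" for b
        using quo(2) that fs IM by blast
    qed
    have "\<not> admits_trivial_massey_operation (koszul (R Quot (I \<cdot> J)) (map ((+>) (I \<cdot> J)) xt))"
      unfolding J_def
    proof (rule koszul_quotient_no_massey[OF I(1) xt(1)])
      show "\<one> \<notin> Idl (set xt)" using quo(1) M1 by blast
      show "fs ! i \<in> I" "fs ! i \<in> Idl (set xt)" if "i < 4" for i
        using that fs fX nth_mem[of i fs] by auto
      fix i r assume "i < (4::nat)" "r \<in> carrier R" "(fs ! i \<otimes> fs ! i) \<otimes> r \<in> Idl ((\<lambda>j. fs ! j \<otimes> fs ! j) ` {..<i})"
      then show "r \<in> Idl ((\<lambda>j. fs ! j \<otimes> fs ! j) ` {..<i})"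
        using regsq regular_modD img[of i] by (metis less_imp_le sq_def)
    qed
    then show False using adm unfolding xt(2) by blast
  qed
  then show ?thesis using J JI by blast
qed

section \<open>Polynomial rings: homogeneous components and the basis theorem\<close>

type_synonym ('v, 'k) mpoly = "('v \<Rightarrow>\<^sub>0 nat) \<Rightarrow>\<^sub>0 'k"

definition mdeg :: "('v::finite \<Rightarrow>\<^sub>0 nat) \<Rightarrow> nat" where
  "mdeg m = (\<Sum>v\<in>UNIV. Poly_Mapping.lookup m v)"

lemma mdeg_add: "mdeg (m + m') = mdeg m + mdeg m'"
  by (simp add: mdeg_def lookup_add sum.distrib)

lemma mdeg_zero_iff: "mdeg m = 0 \<longleftrightarrow> m = 0"
  by (simp add: mdeg_def poly_mapping_eq_iff fun_eq_iff)

lemma mpoly_part_iff: "p \<in> mpoly_part d \<longleftrightarrow> (\<forall>m. Poly_Mapping.lookup p m \<noteq> 0 \<longrightarrow> mdeg m = d)"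
  by (auto simp: mpoly_part_def mdeg_def in_keys_iff)

definition hcomp :: "nat \<Rightarrow> ('v::finite, 'k::field) mpoly \<Rightarrow> ('v, 'k) mpoly" where
  "hcomp d p = (\<Sum>m\<in>{m \<in> Poly_Mapping.keys p. mdeg m = d}. Poly_Mapping.single m (Poly_Mapping.lookup p m))"

lemma lookup_hcomp: "Poly_Mapping.lookup (hcomp d p) m = (if mdeg m = d then Poly_Mapping.lookup p m else 0)"
proof -
  have "Poly_Mapping.lookup (hcomp d p) m =
    (\<Sum>m'\<in>{m \<in> Poly_Mapping.keys p. mdeg m = d}. if m = m' then Poly_Mapping.lookup p m' else 0)"
    unfolding hcomp_def lookup_sum by (intro sum.cong) (auto simp: lookup_single when_def)
  also have "\<dots> = (if mdeg m = d then Poly_Mapping.lookup p m else 0)"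
    by (auto simp: sum.delta' in_keys_iff)
  finally show ?thesis .
qed

lemma hcomp_in_part: "hcomp d p \<in> mpoly_part d"
  by (simp add: mpoly_part_iff lookup_hcomp)

lemma hcomp_of_part: "p \<in> mpoly_part d \<Longrightarrow> hcomp e p = (if e = d then p else 0)"
  by (auto simp: poly_mapping_eq_iff fun_eq_iff lookup_hcomp mpoly_part_iff)

lemma hcomp_add: "hcomp d (p + q) = hcomp d p + hcomp d q"
  by (simp add: poly_mapping_eq_iff fun_eq_iff lookup_hcomp lookup_add)

lemma hcomp_zero [simp]: "hcomp d 0 = 0"
  by (simp add: poly_mapping_eq_iff fun_eq_iff lookup_hcomp)

lemma hcomp_sum: "hcomp d (\<Sum>i\<in>A. f i) = (\<Sum>i\<in>A. hcomp d (f i))"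
  by (induction A rule: infinite_finite_induct) (simp_all add: hcomp_add)

lemma hcomp_decomp: "p = (\<Sum>d\<in>mdeg ` Poly_Mapping.keys p. hcomp d p)"
proof -
  have "Poly_Mapping.lookup (\<Sum>d\<in>mdeg ` Poly_Mapping.keys p. hcomp d p) m = Poly_Mapping.lookup p m" for m
  proof -
    have "Poly_Mapping.lookup (\<Sum>d\<in>mdeg ` Poly_Mapping.keys p. hcomp d p) m =
      (\<Sum>d\<in>mdeg ` Poly_Mapping.keys p. if mdeg m = d then Poly_Mapping.lookup p m else 0)"
      unfolding lookup_sum by (simp add: lookup_hcomp)
    also have "\<dots> = Poly_Mapping.lookup p m"
      by (auto simp: sum.delta in_keys_iff)
    finally show ?thesis .
  qed
  then show ?thesis by (simp add: poly_mapping_eq_iff fun_eq_iff)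
qed

lemma mpoly_part_zero: "0 \<in> mpoly_part d"
  by (simp add: mpoly_part_iff)

lemma mpoly_part_add: "p \<in> mpoly_part d \<Longrightarrow> q \<in> mpoly_part d \<Longrightarrow> p + q \<in> mpoly_part d"
  unfolding mpoly_part_iff lookup_add by (metis add_0)

lemma mpoly_part_mult:
  assumes "p \<in> mpoly_part d" "q \<in> mpoly_part e"
  shows "p * q \<in> mpoly_part (d + e)"
  unfolding mpoly_part_iff
proof (intro allI impI)
  fix m assume "Poly_Mapping.lookup (p * q) m \<noteq> 0"
  then have "m \<in> Poly_Mapping.keys (p * q)" by (simp add: in_keys_iff)
  then obtain a b where "a \<in> Poly_Mapping.keys p" "b \<in> Poly_Mapping.keys q" "m = a + b"
    using keys_mult[of p q] by blast
  then show "mdeg m = d + e" using assms by (simp add: mpoly_part_iff in_keys_iff mdeg_add)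
qed

lemma mpoly_part_one: "1 \<in> mpoly_part 0"
  by (auto simp: mpoly_part_iff lookup_one mdeg_zero_iff when_def)

lemma mpoly_part_power: "p \<in> mpoly_part d \<Longrightarrow> p ^ n \<in> mpoly_part (d * n)"
  by (induction n) (auto simp: mpoly_part_one dest: mpoly_part_mult)

lemma hcomp_mult:
  assumes "u \<in> mpoly_part e"
  shows "hcomp (d + e) (p * u) = hcomp d p * u"
proof -
  have "hcomp (d + e) (p * u) = hcomp (d + e) (\<Sum>c\<in>mdeg ` Poly_Mapping.keys p. hcomp c p * u)"
    using hcomp_decomp[of p] by (metis sum_distrib_right)
  also have "\<dots> = (\<Sum>c\<in>mdeg ` Poly_Mapping.keys p. if d = c then hcomp c p * u else 0)"
    unfolding hcomp_sum using hcomp_of_part[OF mpoly_part_mult[OF hcomp_in_part assms]]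
    by (intro sum.cong) simp_all
  also have "\<dots> = (if d \<in> mdeg ` Poly_Mapping.keys p then hcomp d p * u else 0)"
    by (simp add: sum.delta)
  also have "\<dots> = hcomp d p * u"
  proof -
    have "hcomp d p = 0" if "d \<notin> mdeg ` Poly_Mapping.keys p"
      unfolding hcomp_def using that by (intro sum.neutral) auto
    then show ?thesis by auto
  qed
  finally show ?thesis .
qed

lemma lookup_single_mult:
  fixes q :: "('v::finite, 'k::field) mpoly"
  shows "Poly_Mapping.lookup (Poly_Mapping.single t c * q) (t + k) = c * Poly_Mapping.lookup q k"
  by (simp add: lookup_mult lookup_single when_mult eq_commute[of "t + k"])

lemma keys_single_mult:
  "Poly_Mapping.keys (Poly_Mapping.single t c * q) \<subseteq> (+) t ` Poly_Mapping.keys q"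
  using keys_mult[of "Poly_Mapping.single t c" q] by (auto split: if_splits)

text \<open>Ideals in type class form, which lets the arguments on chains and annihilators use type
  class arithmetic. The link to the record version is \<open>ideal_mpoly_ring_iff\<close>.\<close>

definition is_ideal :: "'a::comm_ring_1 set \<Rightarrow> bool" where
  "is_ideal Q \<longleftrightarrow> 0 \<in> Q \<and> (\<forall>a\<in>Q. \<forall>b\<in>Q. a + b \<in> Q) \<and> (\<forall>a\<in>Q. \<forall>r. r * a \<in> Q)"

lemma is_idealD:
  assumes "is_ideal Q"
  shows "0 \<in> Q" "a \<in> Q \<Longrightarrow> b \<in> Q \<Longrightarrow> a + b \<in> Q" "a \<in> Q \<Longrightarrow> r * a \<in> Q" "a \<in> Q \<Longrightarrow> a * r \<in> Q"
    "a \<in> Q \<Longrightarrow> - a \<in> Q" "a \<in> Q \<Longrightarrow> b \<in> Q \<Longrightarrow> a - b \<in> Q"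
proof -
  show "0 \<in> Q" and add: "a \<in> Q \<Longrightarrow> b \<in> Q \<Longrightarrow> a + b \<in> Q" and mult: "a \<in> Q \<Longrightarrow> r * a \<in> Q" for a b r
    using assms by (auto simp: is_ideal_def)
  then show "a \<in> Q \<Longrightarrow> a * r \<in> Q" by (metis mult.commute)
  show minus: "a \<in> Q \<Longrightarrow> - a \<in> Q" for a using mult[of a "- 1"] by simp
  show "a \<in> Q \<Longrightarrow> b \<in> Q \<Longrightarrow> a - b \<in> Q" using add[of a "- b"] minus[of b] by simp
qed

lemma is_ideal_sum: "is_ideal Q \<Longrightarrow> (\<And>i. i \<in> A \<Longrightarrow> f i \<in> Q) \<Longrightarrow> (\<Sum>i\<in>A. f i) \<in> Q"
  by (induction A rule: infinite_finite_induct) (auto simp: is_idealD)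

section \<open>Dickson's lemma, monomial orders and the ascending chain condition\<close>

lemma nat_seq_mono_subseq:
  fixes a :: "nat \<Rightarrow> nat"
  shows "\<exists>s :: nat \<Rightarrow> nat. strict_mono s \<and> (\<forall>i j. i \<le> j \<longrightarrow> a (s i) \<le> a (s j))"
proof -
  obtain s :: "nat \<Rightarrow> nat" where s: "strict_mono s" "monoseq (\<lambda>n. a (s n))" using seq_monosub by blast
  show ?thesis
  proof (cases "incseq (\<lambda>n. a (s n))")
    case True
    then show ?thesis using s(1) incseqD by blast
  next
    case False
    then have dec: "decseq (\<lambda>n. a (s n))" using s(2) by (simp add: monoseq_iff)
    \<comment> \<open>A decreasing sequence of naturals is constant from a point on where its
      minimum is attained, so its tail is also nondecreasing.\<close>
    obtain N where N: "\<And>n. a (s N) \<le> a (s n)"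
      using ex_has_least_nat[of "\<lambda>_. True" _ "\<lambda>n. a (s n)"] by auto
    have "a (s (N + n)) = a (s N)" for n
      using decseqD[OF dec, of N "N + n"] N[of "N + n"] by simp
    moreover have "strict_mono (\<lambda>n. s (N + n))"
      using s(1) by (simp add: strict_mono_def)
    ultimately show ?thesis by (intro exI[of _ "\<lambda>n. s (N + n)"]) simp
  qed
qed

lemma dickson_subseq:
  fixes f :: "nat \<Rightarrow> 'v \<Rightarrow> nat"
  assumes "finite V"
  shows "\<exists>s :: nat \<Rightarrow> nat. strict_mono s \<and> (\<forall>v\<in>V. \<forall>i j. i \<le> j \<longrightarrow> f (s i) v \<le> f (s j) v)"
  using assms
proof induction
  case empty
  show ?case by (auto intro!: exI[of _ id] simp: strict_mono_def)
next
  case (insert v V)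
  then obtain s :: "nat \<Rightarrow> nat"
    where s: "strict_mono s" "\<forall>v\<in>V. \<forall>i j. i \<le> j \<longrightarrow> f (s i) v \<le> f (s j) v" by blast
  obtain s' :: "nat \<Rightarrow> nat" where s': "strict_mono s'" "\<forall>i j. i \<le> j \<longrightarrow> f (s (s' i)) v \<le> f (s (s' j)) v"
    using nat_seq_mono_subseq[of "\<lambda>n. f (s n) v"] by blast
  have "strict_mono (s \<circ> s')" using s(1) s'(1) by (rule strict_mono_o)
  moreover have "f ((s \<circ> s') i) w \<le> f ((s \<circ> s') j) w" if "w \<in> insert v V" "i \<le> j" for w i j
    using that s(2) s'(2) strict_mono_less_eq[OF s'(1), of i j] by auto
  ultimately show ?case by blast
qed

lemma dickson:
  fixes m :: "nat \<Rightarrow> ('v::finite \<Rightarrow>\<^sub>0 nat)"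
  shows "\<exists>i j t. i < j \<and> m j = t + m i"
proof -
  obtain s :: "nat \<Rightarrow> nat" where s: "strict_mono s"
    "\<forall>v\<in>UNIV. \<forall>i j. i \<le> j \<longrightarrow> Poly_Mapping.lookup (m (s i)) v \<le> Poly_Mapping.lookup (m (s j)) v"
    using dickson_subseq[OF finite[of UNIV], of "\<lambda>n. Poly_Mapping.lookup (m n)"] by blast
  have "m (s 1) = (m (s 1) - m (s 0)) + m (s 0)"
    using s(2) by (auto simp: poly_mapping_eq_iff fun_eq_iff lookup_add lookup_minus)
  moreover have "s 0 < s 1" using s(1) by (simp add: strict_mono_def)
  ultimately show ?thesis by blast
qed

lemma measures_linear:
  shows "trans (measures fs)" "irrefl (measures fs)"
    and "(x, y) \<in> measures fs \<or> (y, x) \<in> measures fs \<or> (\<forall>f\<in>set fs. f x = f y)"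
proof -
  have "(x, y) \<in> measures fs \<Longrightarrow> (y, z) \<in> measures fs \<Longrightarrow> (x, z) \<in> measures fs" for x y z
    by (induction fs) auto
  then show "trans (measures fs)" by (rule transI)
  have "(x, x) \<notin> measures fs" for x by (induction fs) auto
  then show "irrefl (measures fs)" by (simp add: irrefl_def)
  show "(x, y) \<in> measures fs \<or> (y, x) \<in> measures fs \<or> (\<forall>f\<in>set fs. f x = f y)"
    by (induction fs) auto
qed

text \<open>The lexicographic order for an enumeration of the variables. As an instance of
  \<open>measures\<close> it is well-founded, and comparing exponents is invariant under
  translation.\<close>

lemma monomial_order_exists:
  obtains ord :: "(('v::finite \<Rightarrow>\<^sub>0 nat) \<times> ('v \<Rightarrow>\<^sub>0 nat)) set" where
    "wf ord" "trans ord" "\<And>x y. x = y \<or> (x, y) \<in> ord \<or> (y, x) \<in> ord"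
    "\<And>t x y. (x, y) \<in> ord \<Longrightarrow> (t + x, t + y) \<in> ord"
proof -
  obtain vs :: "'v list" where vs: "set vs = UNIV" using finite_list[OF finite[of UNIV]] by blast
  define fs where "fs = map (\<lambda>v (m :: 'v \<Rightarrow>\<^sub>0 nat). Poly_Mapping.lookup m v) vs"
  have "x = y \<or> (x, y) \<in> measures fs \<or> (y, x) \<in> measures fs" for x y
    using measures_linear(3)[of x y fs] vs by (auto simp: fs_def poly_mapping_eq_iff fun_eq_iff)
  moreover have "(t + x, t + y) \<in> measures fs" if "(x, y) \<in> measures fs" for t x y
    using that unfolding fs_def by (induction vs) (auto simp: lookup_add)
  ultimately show ?thesis using that[of "measures fs"] measures_linear(1)[of fs] by auto
qed

lemma finite_total_max:
  assumes "finite A" "A \<noteq> {}" "trans r" "\<And>x y. x = y \<or> (x, y) \<in> r \<or> (y, x) \<in> r"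
  shows "\<exists>m\<in>A. \<forall>x\<in>A. x = m \<or> (x, m) \<in> r"
  using assms(1,2)
proof (induction rule: finite_ne_induct)
  case (insert a A)
  then obtain m where m: "m \<in> A" "\<forall>x\<in>A. x = m \<or> (x, m) \<in> r" by blast
  consider "a = m" | "(a, m) \<in> r" | "(m, a) \<in> r" using assms(4) by blast
  then show ?case
  proof cases
    case 3
    then have "\<forall>x\<in>A. (x, a) \<in> r" using m(2) assms(3) by (metis transD)
    then show ?thesis by auto
  qed (use m in auto)
qed simp

text \<open>Hilbert's basis theorem, by choosing polynomials with minimal leading monomials and reducing one
  modulo an earlier one whose leading monomial divides its own.\<close>

lemma mpoly_ideal_chain:
  fixes Q :: "nat \<Rightarrow> ('v::finite, 'k::field) mpoly set"
  assumes ideal: "\<And>n. is_ideal (Q n)" and mono: "\<And>n. Q n \<subseteq> Q (Suc n)"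
  shows "\<exists>n. Q (Suc n) = Q n"
proof (rule ccontr)
  assume "\<nexists>n. Q (Suc n) = Q n"
  then have strict: "Q (Suc n) - Q n \<noteq> {}" for n using mono by blast
  have mono': "Q i \<subseteq> Q j" if "i \<le> j" for i j using that mono by (rule lift_Suc_mono_le[rotated])
  obtain ord :: "(('v \<Rightarrow>\<^sub>0 nat) \<times> ('v \<Rightarrow>\<^sub>0 nat)) set" where
    wf: "wf ord" and trans: "trans ord" and total: "\<And>x y. x = y \<or> (x, y) \<in> ord \<or> (y, x) \<in> ord" and
    compat: "\<And>t x y. (x, y) \<in> ord \<Longrightarrow> (t + x, t + y) \<in> ord"
    by (rule monomial_order_exists) blast
  define lead where "lead = (\<lambda>(p :: ('v, 'k) mpoly) m. m \<in> Poly_Mapping.keys p \<and>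
    (\<forall>m'\<in>Poly_Mapping.keys p. m' = m \<or> (m', m) \<in> ord))"
  have lead_ex: "\<exists>m. lead p m" if "p \<noteq> 0" for p
    using finite_total_max[of "Poly_Mapping.keys p" ord] that trans total unfolding lead_def by auto
  \<comment> \<open>Leading monomials are minimised over the difference of consecutive ideals, so
    that an element with a smaller leading monomial in this difference is a contradiction.\<close>
  define minimal where "minimal = (\<lambda>n q m. q \<in> Q (Suc n) - Q n \<and> lead q m \<and>
     (\<forall>q' m'. q' \<in> Q (Suc n) - Q n \<longrightarrow> lead q' m' \<longrightarrow> (m', m) \<notin> ord))"
  have "\<exists>q m. minimal n q m" for n
  proof -
    let ?L = "{m. \<exists>q. q \<in> Q (Suc n) - Q n \<and> lead q m}"
    obtain q where q: "q \<in> Q (Suc n) - Q n" using strict by blast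
    then have "q \<noteq> 0" using is_idealD(1)[OF ideal] by auto
    then obtain m0 where m0: "m0 \<in> ?L" using lead_ex q by blast
    have "\<exists>m\<in>?L. \<forall>m'. (m', m) \<in> ord \<longrightarrow> m' \<notin> ?L"
      by (rule wf[unfolded wf_eq_minimal, rule_format, OF m0])
    then show ?thesis unfolding minimal_def by blast
  qed
  then obtain q m where "\<And>n. minimal n (q n) (m n)" by metis
  then have q: "\<And>n. q n \<in> Q (Suc n) - Q n" and lead: "\<And>n. lead (q n) (m n)"
    and min: "\<And>n q' m'. q' \<in> Q (Suc n) - Q n \<Longrightarrow> lead q' m' \<Longrightarrow> (m', m n) \<notin> ord"
    unfolding minimal_def by blast+
  obtain i j t where ij: "i < j" "m j = t + m i" using dickson by blast
  define ci where "ci = Poly_Mapping.lookup (q i) (m i)"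
  define cj where "cj = Poly_Mapping.lookup (q j) (m j)"
  have ci: "ci \<noteq> 0" using lead[of i] by (simp add: ci_def lead_def in_keys_iff)
  \<comment> \<open>This monomial multiple of q_i has the same leading term as q_j and lies in Q_j
    because i < j. Hence q_j - s is still outside Q_j, but its leading monomial is smaller.\<close>
  define s where "s = Poly_Mapping.single t (cj / ci) * q i"
  define r where "r = q j - s"
  have "q i \<in> Q j" using q[of i] mono'[of "Suc i" j] ij by auto
  then have s: "s \<in> Q j" unfolding s_def by (rule is_idealD(3)[OF ideal])
  have "r \<in> Q (Suc j)" unfolding r_def using q[of j] s mono by (intro is_idealD(6)[OF ideal]) auto
  moreover have "r \<notin> Q j"
  proof
    assume "r \<in> Q j"
    then have "r + s \<in> Q j" using s by (rule is_idealD(2)[OF ideal])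
    then show False using q[of j] by (simp add: r_def)
  qed
  ultimately have r: "r \<in> Q (Suc j) - Q j" by simp
  then have "r \<noteq> 0" using is_idealD(1)[OF ideal] by auto
  then obtain m' where m': "lead r m'" using lead_ex by blast
  have "Poly_Mapping.lookup s (m j) = cj"
    unfolding s_def ij(2) lookup_single_mult using ci by (simp add: ci_def)
  then have "Poly_Mapping.lookup r (m j) = 0" by (simp add: r_def lookup_minus cj_def)
  then have "m' \<noteq> m j" using m' by (auto simp: lead_def in_keys_iff)
  moreover have "m' = m j \<or> (m', m j) \<in> ord"
  proof -
    have "m' \<in> Poly_Mapping.keys (q j) \<union> Poly_Mapping.keys s"
      using m' keys_diff[of "q j" s] unfolding lead_def r_def by blast
    moreover have "k = m j \<or> (k, m j) \<in> ord" if "k \<in> Poly_Mapping.keys s" for k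
    proof -
      have "k \<in> (+) t ` Poly_Mapping.keys (q i)"
        using that keys_single_mult unfolding s_def by blast
      then obtain l where l: "l \<in> Poly_Mapping.keys (q i)" "k = t + l" by blast
      then have "l = m i \<or> (l, m i) \<in> ord" using lead[of i] unfolding lead_def by blast
      then show ?thesis using compat[of l "m i" t] l(2) ij(2) by auto
    qed
    ultimately show ?thesis using lead[of j] unfolding lead_def by blast
  qed
  ultimately have "(m', m j) \<in> ord" by blast
  then show False using min[OF r m'] by blast
qed

text \<open>Without such a member every ideal of the family above Q0 could be enlarged strictly
  within it; iterating this contradicts the chain condition.\<close>

lemma mpoly_ideal_maximal:
  fixes \<A> :: "('v::finite, 'k::field) mpoly set set"
  assumes "\<And>Q. Q \<in> \<A> \<Longrightarrow> is_ideal Q" "Q0 \<in> \<A>"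
  shows "\<exists>Q\<in>\<A>. Q0 \<subseteq> Q \<and> (\<forall>Q'\<in>\<A>. Q \<subseteq> Q' \<longrightarrow> Q' = Q)"
proof (rule ccontr)
  assume *: "\<not> ?thesis"
  define nxt where "nxt = (\<lambda>Q. SOME Q'. Q' \<in> \<A> \<and> Q \<subset> Q')"
  have nxt: "nxt Q \<in> \<A> \<and> Q \<subset> nxt Q" if "Q \<in> \<A>" "Q0 \<subseteq> Q" for Q
    unfolding nxt_def by (rule someI_ex) (use * that in blast)
  define C where "C = (\<lambda>n. (nxt ^^ n) Q0)"
  have C: "C n \<in> \<A> \<and> Q0 \<subseteq> C n" for n
    by (induction n) (use assms(2) nxt in \<open>auto simp: C_def\<close>)
  have "C n \<subset> C (Suc n)" for n using nxt C[of n] by (simp add: C_def)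
  then show False using mpoly_ideal_chain[of C] assms(1) C by (metis psubset_eq)
qed

section \<open>Homogeneous prime avoidance\<close>

lemma mpoly_part_zero_unit:
  fixes a :: "('v::finite, 'k::field) mpoly"
  assumes "a \<in> mpoly_part 0" "a \<noteq> 0"
  shows "\<exists>b. b * a = 1"
proof -
  define c where "c = Poly_Mapping.lookup a 0"
  have "a = Poly_Mapping.single 0 c"
    by (rule poly_mapping_eqI)
      (use assms(1) in \<open>auto simp: lookup_single c_def when_def mpoly_part_iff mdeg_zero_iff\<close>)
  moreover have "c \<noteq> 0" using calculation assms(2) by auto
  ultimately have "Poly_Mapping.single 0 (inverse c) * a = 1" by (simp add: mult_single)
  then show ?thesis by blast
qed

lemma is_ideal_hcompI:
  assumes "is_ideal P" "\<And>d. hcomp d r \<in> P"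
  shows "r \<in> P"
  using is_ideal_sum[OF assms(1), of "mdeg ` Poly_Mapping.keys r" "\<lambda>d. hcomp d r"] assms(2) hcomp_decomp[of r]
  by metis

text \<open>The members of \<M> are the maximal annihilators of nonzero homogeneous classes in R/Q.
  They are homogeneous, prime with respect to homogeneous elements, and finite in number, and every
  homogeneous zero divisor on R/Q with a homogeneous witness lies in one of them. By
  \<open>colon\<close>, I is contained in none, so prime avoidance yields a homogeneous h in I
  outside all of them.\<close>

theorem homogeneous_nonzerodivisor:
  fixes Q I :: "('v::finite, 'k::field) mpoly set"
  assumes Q: "is_ideal Q" and Qh: "\<And>p d. p \<in> Q \<Longrightarrow> hcomp d p \<in> Q"
    and I: "is_ideal I" and Ih: "\<And>p d. p \<in> I \<Longrightarrow> hcomp d p \<in> I" and proper: "1 \<notin> I"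
    and colon: "\<And>u. (\<And>a. a \<in> I \<Longrightarrow> a * u \<in> Q) \<Longrightarrow> u \<in> Q"
  shows "\<exists>h\<in>I. (\<exists>d>0. h \<in> mpoly_part d) \<and> (\<forall>r. h * r \<in> Q \<longrightarrow> r \<in> Q)"
proof -
  define hom where "hom = (\<lambda>p :: ('v, 'k) mpoly. \<exists>d. p \<in> mpoly_part d)"
  have hom_mult: "hom (p * q)" if "hom p" "hom q" for p q
    using that mpoly_part_mult unfolding hom_def by blast
  have hom_one: "hom 1" using mpoly_part_one unfolding hom_def by blast
  have hom_comp: "hom (hcomp d p)" for d p using hcomp_in_part unfolding hom_def by blast
  define Ann where "Ann = (\<lambda>u. {r. r * u \<in> Q})"
  have Ann_ideal: "is_ideal (Ann u)" for u
    unfolding is_ideal_def Ann_def using Q by (auto simp: is_idealD distrib_right mult.assoc)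
  have Ann_comp: "hcomp d r \<in> Ann u" if r: "r \<in> Ann u" and u: "hom u" for d r u
  proof -
    obtain e where "u \<in> mpoly_part e" using u by (auto simp: hom_def)
    then have "hcomp d r * u = hcomp (d + e) (r * u)" by (rule hcomp_mult[symmetric])
    then show ?thesis using Qh[of "r * u" "d + e"] r by (simp add: Ann_def)
  qed
  define \<A> where "\<A> = {Ann u |u. hom u \<and> u \<notin> Q}"
  define \<M> where "\<M> = {P \<in> \<A>. \<forall>P'\<in>\<A>. P \<subseteq> P' \<longrightarrow> P' = P}"
  have Mu: "\<exists>u. P = Ann u \<and> hom u \<and> u \<notin> Q" if "P \<in> \<M>" for P
    using that by (auto simp: \<M>_def \<A>_def)
  have M_ideal: "is_ideal P" if "P \<in> \<M>" for P using Mu[OF that] Ann_ideal by blast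
  have M_comp: "hcomp d r \<in> P" if "P \<in> \<M>" "r \<in> P" for P r d
    using Mu[OF that(1)] Ann_comp that(2) by blast
  have M_one: "1 \<notin> P" if "P \<in> \<M>" for P using Mu[OF that] by (auto simp: Ann_def)
  have M_incomparable: "P' = P" if "P \<in> \<M>" "P' \<in> \<M>" "P' \<subseteq> P" for P P'
    using that by (auto simp: \<M>_def)
  have M_above: "\<exists>P\<in>\<M>. Ann u \<subseteq> P" if "hom u" "u \<notin> Q" for u
  proof -
    have "\<exists>P\<in>\<A>. Ann u \<subseteq> P \<and> (\<forall>P'\<in>\<A>. P \<subseteq> P' \<longrightarrow> P' = P)"
      by (rule mpoly_ideal_maximal) (use that Ann_ideal in \<open>auto simp: \<A>_def\<close>)
    then show ?thesis by (auto simp: \<M>_def)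
  qed
  have M_prime: "a \<in> P \<or> b \<in> P" if P: "P \<in> \<M>" and ab: "hom a" "hom b" "a * b \<in> P" for P a b
  proof (rule disjCI)
    assume b: "b \<notin> P"
    obtain u where u: "P = Ann u" "hom u" "u \<notin> Q" using Mu[OF P] by blast
    have bu: "b * u \<notin> Q" using b u(1) by (simp add: Ann_def)
    \<comment> \<open>Passing from u to b u can only enlarge the annihilator, so maximality forces
      equality, and a annihilates b u.\<close>
    then have "Ann (b * u) \<in> \<A>" using hom_mult ab(2) u(2) by (auto simp: \<A>_def)
    moreover have "P \<subseteq> Ann (b * u)"
    proof
      fix r assume "r \<in> P"
      then have "b * (r * u) \<in> Q" using u(1) is_idealD(3)[OF Q] by (simp add: Ann_def)
      then show "r \<in> Ann (b * u)" by (simp add: Ann_def mult.left_commute)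
    qed
    ultimately have "Ann (b * u) = P" using P by (auto simp: \<M>_def)
    moreover have "a \<in> Ann (b * u)" using ab(3) u(1) by (simp add: Ann_def mult.assoc)
    ultimately show "a \<in> P" by simp
  qed
  have M_power: "a ^ n \<notin> P" if P: "P \<in> \<M>" and a: "hom a" "a \<notin> P" for P a n
  proof (induction n)
    case 0
    then show ?case using M_one[OF P] by simp
  next
    case (Suc n)
    have "hom (a ^ n)" using a(1) mpoly_part_power unfolding hom_def by blast
    then show ?case using M_prime[OF P a(1)] a(2) Suc by auto
  qed
  \<comment> \<open>By incomparability each P' in F has an element outside P, and one of its
    homogeneous components is outside P too. Primality keeps the product of these components outside
    P.\<close>
  have separate: "\<exists>b. hom b \<and> b \<notin> P \<and> (\<forall>P'\<in>F. b \<in> P')"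
    if "finite F" "F \<subseteq> \<M>" "P \<in> \<M>" "P \<notin> F" for F P
    using that
  proof (induction F)
    case empty
    then show ?case using hom_one M_one by auto
  next
    case (insert P' F)
    then obtain b where b: "hom b" "b \<notin> P" "\<forall>P'\<in>F. b \<in> P'" by auto
    have "\<not> P' \<subseteq> P" using M_incomparable[of P P'] insert.prems by auto
    then obtain r where "r \<in> P'" "r \<notin> P" by blast
    moreover have "is_ideal P" using M_ideal insert.prems by blast
    ultimately obtain d where c: "hcomp d r \<notin> P" "hcomp d r \<in> P'"
      using is_ideal_hcompI M_comp[of P' r] insert.prems by blast
    have "hcomp d r * b \<notin> P" using M_prime[OF insert.prems(2) hom_comp b(1)] c b by blast
    moreover have "hcomp d r * b \<in> P''" if "P'' \<in> insert P' F" for P''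
    proof -
      have "is_ideal P''" using that insert.prems M_ideal by blast
      then show ?thesis using that c b is_idealD(3,4) by blast
    qed
    ultimately show ?case using hom_mult[OF hom_comp b(1)] by blast
  qed
  have "finite \<M>"
  proof (rule ccontr)
    assume "infinite \<M>"
    then obtain P :: "nat \<Rightarrow> ('v, 'k) mpoly set" where P: "inj P" "range P \<subseteq> \<M>"
      using infinite_countable_subset by blast
    have PM: "P n \<in> \<M>" for n using P(2) by blast
    obtain u where u: "\<And>n. P n = Ann (u n)" using Mu[OF PM] by metis
    \<comment> \<open>If \<M> were infinite, the ideals Q + (u_0, ..., u_(n-1)) would still
      stabilise, making some u_n a combination of earlier ones modulo Q. An element b of P_0, ...,
      P_(n-1) outside P_n annihilates these, and hence u_n: a contradiction.\<close>
    define C where "C = (\<lambda>n. {q + (\<Sum>i<n. r i * u i) |q r. q \<in> Q})"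
    have CI: "x \<in> C n" if "q \<in> Q" "x = q + (\<Sum>i<n. r i * u i)" for x n q r
      using that unfolding C_def by blast
    have C_ideal: "is_ideal (C n)" for n
      unfolding is_ideal_def
    proof (intro conjI ballI allI)
      show "0 \<in> C n" by (rule CI[OF is_idealD(1)[OF Q], of _ "\<lambda>_. 0"]) simp
      fix a assume "a \<in> C n"
      then obtain q r where a: "a = q + (\<Sum>i<n. r i * u i)" "q \<in> Q" by (auto simp: C_def)
      show "s * a \<in> C n" for s
        by (rule CI[OF is_idealD(3)[OF Q a(2)], of _ s "\<lambda>i. s * r i"])
          (simp add: a(1) distrib_left sum_distrib_left mult.assoc)
      fix b assume "b \<in> C n"
      then obtain q' r' where b: "b = q' + (\<Sum>i<n. r' i * u i)" "q' \<in> Q" by (auto simp: C_def)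
      show "a + b \<in> C n"
        by (rule CI[OF is_idealD(2)[OF Q a(2) b(2)], of _ "\<lambda>i. r i + r' i"])
          (simp add: a(1) b(1) distrib_right sum.distrib)
    qed
    have C_mono: "C n \<subseteq> C (Suc n)" for n
    proof
      fix a assume "a \<in> C n"
      then obtain q r where a: "a = q + (\<Sum>i<n. r i * u i)" "q \<in> Q" by (auto simp: C_def)
      show "a \<in> C (Suc n)"
        by (rule CI[OF a(2), of _ "\<lambda>i. if i < n then r i else 0"]) (simp add: a(1))
    qed
    obtain n where n: "C (Suc n) = C n" using mpoly_ideal_chain[of C] C_ideal C_mono by blast
    have "u n \<in> C (Suc n)"
      by (rule CI[OF is_idealD(1)[OF Q], of _ "\<lambda>i. if i = n then 1 else 0"]) simp
    then have "u n \<in> C n" using n by (rule subst[rotated])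
    then obtain q r where un: "u n = q + (\<Sum>i<n. r i * u i)" "q \<in> Q" by (auto simp: C_def)
    have "P n \<notin> P ` {..<n}" using P(1) by (auto simp: inj_eq)
    then obtain b where b: "b \<notin> P n" "\<forall>P'\<in>P ` {..<n}. b \<in> P'"
      using separate[of "P ` {..<n}" "P n"] PM by blast
    have "b * u n = b * q + (\<Sum>i<n. r i * (b * u i))"
      by (simp add: un(1) distrib_left sum_distrib_left mult.left_commute)
    also have "\<dots> \<in> Q"
    proof (rule is_idealD(2)[OF Q is_idealD(3)[OF Q un(2)] is_ideal_sum[OF Q]])
      fix i assume "i \<in> {..<n}"
      then have "b * u i \<in> Q" using b(2) u by (simp add: Ann_def)
      then show "r i * (b * u i) \<in> Q" by (rule is_idealD(3)[OF Q])
    qed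
    finally show False using b(1) u by (simp add: Ann_def)
  qed
  have avoid: "\<exists>h\<in>I. (\<exists>d>0. h \<in> mpoly_part d) \<and> (\<forall>P\<in>F. h \<notin> P)" if "finite F" "F \<subseteq> \<M>" for F
    using that
  proof (induction F)
    case empty
    \<comment> \<open>Zero counts as homogeneous of degree 1. It is the final choice only when \<M>
      is empty, and then Q is the whole ring.\<close>
    show ?case using is_idealD(1)[OF I] mpoly_part_zero[of 1] by (intro bexI[of _ 0]) auto
  next
    case (insert P F)
    then obtain h d where h: "h \<in> I" "d > 0" "h \<in> mpoly_part d" "\<forall>P\<in>F. h \<notin> P" by auto
    have P: "P \<in> \<M>" and F: "F \<subseteq> \<M>" using insert.prems by auto
    show ?case
    proof (cases "h \<in> P")
      case False
      then show ?thesis using h by blast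
    next
      case True
      obtain u where u: "P = Ann u" "hom u" "u \<notin> Q" using Mu[OF P] by blast
      then obtain a' where "a' \<in> I" "a' \<notin> P" using colon[of u] by (auto simp: Ann_def)
      then obtain e where e: "hcomp e a' \<in> I" "hcomp e a' \<notin> P"
        using is_ideal_hcompI[OF M_ideal[OF P]] Ih by blast
      obtain b where b: "hom b" "b \<notin> P" "\<forall>P'\<in>F. b \<in> P'"
        using separate[OF insert.hyps(1) F P insert.hyps(2)] by blast
      define x where "x = hcomp e a' * b"
      have xI: "x \<in> I" unfolding x_def by (rule is_idealD(4)[OF I e(1)])
      have xP: "x \<notin> P" unfolding x_def using M_prime[OF P hom_comp b(1)] e(2) b(2) by blast
      have xF: "x \<in> P'" if "P' \<in> F" for P'
        unfolding x_def using that b(3) F M_ideal is_idealD(3) by blast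
      have "hom x" unfolding x_def by (rule hom_mult[OF hom_comp b(1)])
      then obtain c where c: "x \<in> mpoly_part c" by (auto simp: hom_def)
      \<comment> \<open>A nonzero element of degree 0 would be a unit in I. Positive degrees keep
        both exponents in the next sum positive.\<close>
      have "c > 0"
      proof (rule ccontr)
        assume "\<not> 0 < c"
        moreover have "x \<noteq> 0" using xP is_idealD(1)[OF M_ideal[OF P]] by auto
        ultimately obtain y where "y * x = 1" using mpoly_part_zero_unit c by auto
        then show False using is_idealD(3)[OF I xI, of y] proper by simp
      qed
      \<comment> \<open>The exponents equalise the degrees: h has degree d and x has degree c. In P
        only the first summand vanishes, in the members of F only the second, so the sum avoids all
        of them.\<close>
      define g where "g = h ^ c + x ^ d"
      have pow_in: "y ^ n \<in> N" if "is_ideal N" "y \<in> N" "n > 0" for y n and N :: "('v, 'k) mpoly set"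
        using that by (cases n) (auto intro: is_idealD)
      have homh: "hom h" using h(3) by (auto simp: hom_def)
      have gI: "g \<in> I"
        unfolding g_def by (intro is_idealD(2)[OF I] pow_in I h(1,2) xI \<open>c > 0\<close>)
      have gpart: "g \<in> mpoly_part (d * c)"
        unfolding g_def using mpoly_part_power[OF h(3), of c] mpoly_part_power[OF c, of d]
        by (intro mpoly_part_add) (simp_all add: mult.commute)
      have "g \<notin> P'" if "P' \<in> insert P F" for P'
      proof
        assume g: "g \<in> P'"
        have P': "P' \<in> \<M>" using that P F by blast
        note id = M_ideal[OF P']
        show False
        proof (cases "P' = P")
          case True
          have "h ^ c \<in> P'" using pow_in[OF id _ \<open>c > 0\<close>] \<open>h \<in> P\<close> True by simp
          then have "x ^ d \<in> P'" using is_idealD(6)[OF id g, of "h ^ c"] by (simp add: g_def)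
          then show False using M_power[OF P \<open>hom x\<close> xP] True by simp
        next
          case False
          then have "P' \<in> F" using that by simp
          then have "x ^ d \<in> P'" using pow_in[OF id _ h(2)] xF by simp
          then have "h ^ c \<in> P'" using is_idealD(6)[OF id g, of "x ^ d"] by (simp add: g_def)
          then show False using M_power[OF P' homh] h(4) \<open>P' \<in> F\<close> by blast
        qed
      qed
      moreover have "d * c > 0" using h(2) \<open>c > 0\<close> by simp
      ultimately show ?thesis using gI gpart by blast
    qed
  qed
  obtain h d where h: "h \<in> I" "d > 0" "h \<in> mpoly_part d" "\<forall>P\<in>\<M>. h \<notin> P"
    using avoid[OF \<open>finite \<M>\<close> order_refl] by blast
  \<comment> \<open>Because h and Q are homogeneous, the relation passes to the components of r. A
    component outside Q would put h into a member of \<M>.\<close>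
  have "r \<in> Q" if "h * r \<in> Q" for r
  proof (rule is_ideal_hcompI[OF Q], rule ccontr)
    fix e assume e: "hcomp e r \<notin> Q"
    then obtain P where P: "P \<in> \<M>" "Ann (hcomp e r) \<subseteq> P" using M_above hom_comp by blast
    have "hcomp (e + d) (r * h) = hcomp e r * h" by (rule hcomp_mult[OF h(3)])
    then have "h * hcomp e r \<in> Q" using Qh[OF that, of "e + d"] by (simp add: mult.commute)
    then show False using P h(4) by (auto simp: Ann_def)
  qed
  then show ?thesis using h by blast
qed

section \<open>The graded case\<close>

lemma mpoly_ring_simps [simp]:
  "carrier mpoly_ring = UNIV" "p \<otimes>\<^bsub>mpoly_ring\<^esub> q = p * q" "p \<oplus>\<^bsub>mpoly_ring\<^esub> q = p + q"
  "\<one>\<^bsub>mpoly_ring\<^esub> = 1" "\<zero>\<^bsub>mpoly_ring\<^esub> = 0"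
  by (simp_all add: mpoly_ring_def ring_of_type_algebra_def)

lemma cring_mpoly_ring: "cring mpoly_ring"
  unfolding mpoly_ring_def by (rule cring_from_type_algebra)

lemma ideal_mpoly_ring_iff: "ideal Q mpoly_ring \<longleftrightarrow> is_ideal Q"
proof
  interpret P: cring mpoly_ring by (rule cring_mpoly_ring)
  assume "ideal Q mpoly_ring"
  then interpret Q: ideal Q mpoly_ring .
  show "is_ideal Q"
    unfolding is_ideal_def using Q.zero_closed Q.a_closed Q.I_l_closed by auto
next
  interpret P: cring mpoly_ring by (rule cring_mpoly_ring)
  assume Q: "is_ideal Q"
  have minus: "\<ominus>\<^bsub>mpoly_ring\<^esub> a = - a" for a :: "('a, 'b) mpoly"
    by (rule P.minus_equality) simp_all
  show "ideal Q mpoly_ring"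
  proof (rule idealI[OF P.ring_axioms])
    show "subgroup Q (add_monoid mpoly_ring)"
      by (rule P.add.subgroupI) (use is_idealD[OF Q] minus in auto)
  qed (use is_idealD[OF Q] in auto)
qed

lemma hcomp_mult_eq_zero:
  assumes "u \<in> mpoly_part e" "d < e"
  shows "hcomp d (p * u) = 0"
proof -
  have "hcomp d (p * u) = (\<Sum>c\<in>mdeg ` Poly_Mapping.keys p. hcomp d (hcomp c p * u))"
    using hcomp_decomp[of p] by (metis hcomp_sum sum_distrib_right)
  also have "\<dots> = 0"
    using assms hcomp_of_part[OF mpoly_part_mult[OF hcomp_in_part assms(1)]]
    by (intro sum.neutral) auto
  finally show ?thesis .
qed

lemma hcomp_mult_sum: "hcomp d (p * q) = (\<Sum>e\<in>mdeg ` Poly_Mapping.keys q. hcomp d (p * hcomp e q))"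
  using hcomp_decomp[of q] by (metis hcomp_sum sum_distrib_left)

text \<open>The polynomials all of whose components lie in I form an ideal, and this ideal contains
  the homogeneous generators.\<close>

lemma homogeneous_ideal_hcomp:
  fixes I :: "('v::finite, 'k::field) mpoly set"
  assumes "homogeneous_ideal mpoly_ring mpoly_part I" "p \<in> I"
  shows "hcomp d p \<in> I"
proof -
  interpret P: cring "mpoly_ring :: ('v, 'k) mpoly ring" by (rule cring_mpoly_ring)
  obtain S where S: "S \<subseteq> (\<Union>i. mpoly_part i)" "I = Idl\<^bsub>mpoly_ring\<^esub> S"
    using assms(1) by (auto simp: homogeneous_ideal_def)
  have I: "is_ideal I"
    using P.genideal_ideal[of S] unfolding S(2) ideal_mpoly_ring_iff by simp
  define H where "H = {p. \<forall>d. hcomp d p \<in> I}"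
  have "is_ideal H"
    unfolding is_ideal_def H_def
  proof (intro conjI ballI allI CollectI)
    fix a r d assume a: "a \<in> {p. \<forall>d. hcomp d p \<in> I}"
    show "hcomp d (r * a) \<in> I"
    proof (subst hcomp_mult_sum, rule is_ideal_sum[OF I])
      fix e
      show "hcomp d (r * hcomp e a) \<in> I"
      proof (cases "d < e")
        case True
        then show ?thesis using is_idealD(1)[OF I] by (simp add: hcomp_mult_eq_zero[OF hcomp_in_part])
      next
        case False
        then have "hcomp d (r * hcomp e a) = hcomp (d - e) r * hcomp e a"
          using hcomp_mult[OF hcomp_in_part[of e a], of "d - e" r] by simp
        then show ?thesis using a is_idealD(3)[OF I] by simp
      qed
    qed
  qed (use is_idealD[OF I] in \<open>auto simp: hcomp_add\<close>)
  moreover have "S \<subseteq> H"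
  proof
    fix s assume s: "s \<in> S"
    then obtain i where "s \<in> mpoly_part i" using S(1) by blast
    moreover have "s \<in> I" using P.genideal_self[of S] s S(2) by auto
    ultimately show "s \<in> H" using is_idealD(1)[OF I] by (simp add: H_def hcomp_of_part)
  qed
  ultimately have "I \<subseteq> H"
    unfolding S(2) by (intro P.genideal_minimal) (simp_all add: ideal_mpoly_ring_iff)
  then show ?thesis using assms(2) by (auto simp: H_def)
qed

section \<open>The homogeneous maximal ideal and a graded Nakayama lemma\<close>

definition positive_ideal :: "('v::finite, 'k::field) mpoly set" where
  "positive_ideal = {p. hcomp 0 p = 0}"

lemma is_ideal_positive: "is_ideal positive_ideal"
  unfolding is_ideal_def positive_ideal_def
proof (intro conjI ballI allI CollectI)
  fix a r :: "('v::finite, 'k::field) mpoly" assume a: "a \<in> {p. hcomp 0 p = 0}"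
  show "hcomp 0 (r * a) = 0"
  proof (subst hcomp_mult_sum, rule sum.neutral, rule ballI)
    fix e show "hcomp 0 (r * hcomp e a) = 0"
      using a by (cases "e = 0") (auto simp: hcomp_mult_eq_zero[OF hcomp_in_part])
  qed
qed (auto simp: hcomp_add)

lemma one_notin_positive_ideal: "1 \<notin> positive_ideal"
  by (simp add: positive_ideal_def hcomp_of_part[OF mpoly_part_one])

lemma mpoly_part_subset_positive: "0 < d \<Longrightarrow> mpoly_part d \<subseteq> positive_ideal"
  by (auto simp: positive_ideal_def hcomp_of_part)

lemma positive_ideal_memI:
  fixes N :: "('v::finite, 'k::field) mpoly set"
  assumes N: "is_ideal N" "\<And>d p. 0 < d \<Longrightarrow> p \<in> mpoly_part d \<Longrightarrow> p \<in> N"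
  shows "positive_ideal \<subseteq> N"
proof
  fix p :: "('v, 'k) mpoly" assume p: "p \<in> positive_ideal"
  show "p \<in> N"
  proof (rule is_ideal_hcompI[OF N(1)])
    fix d show "hcomp d p \<in> N"
      using p N(2)[OF _ hcomp_in_part] is_idealD(1)[OF N(1)] by (cases "d = 0") (auto simp: positive_ideal_def)
  qed
qed

lemma proper_homogeneous_ideal_positive:
  assumes "homogeneous_ideal mpoly_ring mpoly_part I" "is_ideal I" "1 \<notin> I"
  shows "I \<subseteq> positive_ideal"
proof
  fix p assume "p \<in> I"
  then have "hcomp 0 p \<in> I" using homogeneous_ideal_hcomp assms(1) by blast
  then have "hcomp 0 p = 0"
    using mpoly_part_zero_unit[OF hcomp_in_part[of 0 p]] is_idealD(3)[OF assms(2)] assms(3) by metis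
  then show "p \<in> positive_ideal" by (simp add: positive_ideal_def)
qed

text \<open>Induction on the degree d: both factors of a product i j have no constant term, so its
  component of degree d involves only components of j of degree less than d, and these already lie
  in N.\<close>

lemma graded_nakayama:
  fixes N I J :: "('v::finite, 'k::field) mpoly set"
  assumes N: "is_ideal N" "\<And>p d. p \<in> N \<Longrightarrow> hcomp d p \<in> N"
    and IJ: "I \<subseteq> positive_ideal" "J \<subseteq> positive_ideal"
    and dec: "\<And>p. p \<in> positive_ideal \<Longrightarrow> \<exists>x\<in>N. \<exists>q\<in>I \<cdot>\<^bsub>mpoly_ring\<^esub> J. p = x + q"
  shows "positive_ideal \<subseteq> N"
proof (rule positive_ideal_memI[OF N(1)])
  show "p \<in> N" if "0 < d" "p \<in> mpoly_part d" for d p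
    using that
  proof (induction d arbitrary: p rule: less_induct)
    case (less d)
    obtain x q where xq: "x \<in> N" "q \<in> I \<cdot>\<^bsub>mpoly_ring\<^esub> J" "p = x + q"
      using dec mpoly_part_subset_positive[OF less.prems(1)] less.prems(2) by blast
    have "hcomp d q \<in> N"
      using xq(2)
    proof (induction q rule: ideal_prod.induct)
      case (prod i j)
      have ij: "hcomp 0 i = 0" "hcomp 0 j = 0"
        using prod IJ by (auto simp: positive_ideal_def)
      have "hcomp d (i * hcomp e j) \<in> N" for e
      proof -
        \<comment> \<open>The case e = d pairs the component of j of full degree with the constant
          term of i, which is zero.\<close>
        consider "e = 0" | "d < e" | "e = d" | "0 < e" "e < d" by linarith
        then show ?thesis
        proof cases
          case 1
          then show ?thesis using ij(2) is_idealD(1)[OF N(1)] by simp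
        next
          case 2
          then show ?thesis using is_idealD(1)[OF N(1)] by (simp add: hcomp_mult_eq_zero[OF hcomp_in_part])
        next
          case 3
          then show ?thesis
            using hcomp_mult[OF hcomp_in_part[of d j], of 0 i] ij(1) is_idealD(1)[OF N(1)] by simp
        next
          case 4
          then have "hcomp d (i * hcomp e j) = hcomp (d - e) i * hcomp e j"
            using hcomp_mult[OF hcomp_in_part[of e j], of "d - e" i] by simp
          moreover have "hcomp e j \<in> N" using less.IH[OF 4(2,1) hcomp_in_part] .
          ultimately show ?thesis using is_idealD(3)[OF N(1)] by simp
        qed
      qed
      then show ?case unfolding mpoly_ring_simps by (subst hcomp_mult_sum) (rule is_ideal_sum[OF N(1)])
    next
      case (sum s1 s2)
      then show ?case using is_idealD(2)[OF N(1)] by (simp add: hcomp_add)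
    qed
    moreover have "p = hcomp d x + hcomp d q"
      using hcomp_of_part[OF less.prems(2), of d] by (simp add: xq(3) hcomp_add)
    ultimately show ?case using N xq(1) is_idealD(2)[OF N(1)] by simp
  qed
qed

text \<open>Identifies the ideal used by \<open>golod_graded\<close> as an image from the polynomial
  ring, as \<open>quotient_generators\<close> requires.\<close>

lemma irrelevant_ideal_quotient:
  fixes Q :: "('v::finite, 'k::field) mpoly set"
  assumes Q: "ideal Q mpoly_ring"
  shows "irrelevant_ideal (mpoly_ring Quot Q) (quot_part mpoly_ring mpoly_part Q) =
    (+>\<^bsub>mpoly_ring\<^esub>) Q ` positive_ideal"
proof -
  let ?R = "mpoly_ring :: ('v, 'k) mpoly ring" and ?\<pi> = "(+>\<^bsub>mpoly_ring\<^esub>) Q"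
  define A where "A = ?R Quot Q"
  interpret P: cring ?R by (rule cring_mpoly_ring)
  interpret A: ring A unfolding A_def by (rule ideal.quotient_is_ring[OF Q])
  define G where "G = (\<Union>i\<in>{1..}. quot_part ?R mpoly_part Q i)"
  have GA: "G \<subseteq> carrier A"
    by (auto simp: G_def A_def quot_part_def FactRing_def A_RCOSETS_def')
  have GI: "G \<subseteq> Idl\<^bsub>A\<^esub> G" by (rule A.genideal_self[OF GA])
  have hom: "ring_hom_ring ?R A ?\<pi>" unfolding A_def by (rule ideal.rcos_ring_hom_ring[OF Q])
  have "(Idl\<^bsub>A\<^esub> G) = ?\<pi> ` positive_ideal"
  proof
    show "(Idl\<^bsub>A\<^esub> G) \<subseteq> ?\<pi> ` positive_ideal"
    proof (rule A.genideal_minimal)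
      show "ideal (?\<pi> ` positive_ideal) A"
        unfolding A_def
        by (rule P.ring_ideal_imp_quot_ideal[OF Q]) (simp add: ideal_mpoly_ring_iff is_ideal_positive)
      show "G \<subseteq> ?\<pi> ` positive_ideal"
      proof
        fix x assume "x \<in> G"
        then obtain i p where "1 \<le> i" "p \<in> mpoly_part i" "x = ?\<pi> p" by (auto simp: G_def quot_part_def)
        then show "x \<in> ?\<pi> ` positive_ideal" using mpoly_part_subset_positive[of i] by auto
      qed
    qed
    have "ideal {r \<in> carrier ?R. ?\<pi> r \<in> Idl\<^bsub>A\<^esub> G} ?R"
      by (rule ring_hom_ring.ideal_vimage[OF hom A.genideal_ideal[OF GA]])
    then have "is_ideal {r. ?\<pi> r \<in> Idl\<^bsub>A\<^esub> G}" by (simp add: ideal_mpoly_ring_iff)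
    then have "positive_ideal \<subseteq> {r. ?\<pi> r \<in> Idl\<^bsub>A\<^esub> G}"
    proof (rule positive_ideal_memI)
      fix d and p :: "('v, 'k) mpoly" assume "0 < d" "p \<in> mpoly_part d"
      then have "?\<pi> p \<in> G" by (auto simp: G_def quot_part_def Suc_le_eq)
      then show "p \<in> {r. ?\<pi> r \<in> Idl\<^bsub>A\<^esub> G}" using GI by blast
    qed
    then show "?\<pi> ` positive_ideal \<subseteq> (Idl\<^bsub>A\<^esub> G)" by blast
  qed
  then show ?thesis by (simp add: irrelevant_ideal_def G_def A_def)
qed

text \<open>Each new element is chosen regular modulo the squares of the earlier ones, so the
  squares form a regular sequence by construction. As they are fewer than the elements of fs,
  \<open>colon_regular_sequence\<close> shows that I annihilates nothing nonzero modulo them, which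
  is what \<open>homogeneous_nonzerodivisor\<close> asks for.\<close>

lemma homogeneous_regular_sequence:
  fixes I :: "('v::finite, 'k::field) mpoly set"
  assumes hI: "homogeneous_ideal mpoly_ring mpoly_part I" and I: "is_ideal I" "1 \<notin> I"
    and fs: "set fs \<subseteq> I"
    and reg: "\<And>i. i < length fs \<Longrightarrow> cring.regular_mod mpoly_ring (Idl\<^bsub>mpoly_ring\<^esub> (set (take i fs))) (fs ! i)"
    and n: "n \<le> length fs"
  shows "\<exists>hs. length hs = n \<and> set hs \<subseteq> I \<inter> (\<Union>d. mpoly_part d) \<and>
    (\<forall>i<n. cring.regular_mod mpoly_ring (Idl\<^bsub>mpoly_ring\<^esub> ((\<lambda>h. h * h) ` set (take i hs))) (hs ! i))"
  using n
proof (induction n)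
  case (Suc n)
  interpret P: cring "mpoly_ring :: ('v, 'k) mpoly ring" by (rule cring_mpoly_ring)
  obtain hs where hs: "length hs = n" "set hs \<subseteq> I \<inter> (\<Union>d. mpoly_part d)"
    and hreg: "\<And>i. i < n \<Longrightarrow> P.regular_mod (Idl\<^bsub>mpoly_ring\<^esub> ((\<lambda>h. h * h) ` set (take i hs))) (hs ! i)"
    using Suc by auto
  define gs where "gs = map (\<lambda>h. h * h) hs"
  define Q where "Q = (Idl\<^bsub>mpoly_ring\<^esub> (set gs))"
  have Q: "is_ideal Q"
    unfolding Q_def ideal_mpoly_ring_iff[symmetric] by (rule P.genideal_ideal) simp
  have "set gs \<subseteq> (\<Union>d. mpoly_part d)"
    using hs(2) mpoly_part_mult by (fastforce simp: gs_def)
  then have hQ: "homogeneous_ideal mpoly_ring mpoly_part Q"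
    unfolding homogeneous_ideal_def Q_def by blast
  have greg: "P.regular_mod (Idl\<^bsub>mpoly_ring\<^esub> (set (take i gs))) (gs ! i)" if "i < length gs" for i
  proof -
    have i: "i < n" using that hs(1) by (simp add: gs_def)
    have "(\<lambda>h. h * h) ` set (take i hs) = set (take i gs)" by (simp add: gs_def take_map)
    note r = hreg[OF i, unfolded this]
    show ?thesis
      unfolding P.regular_mod_def
    proof (intro ballI impI)
      fix r assume "gs ! i \<otimes>\<^bsub>mpoly_ring\<^esub> r \<in> Idl\<^bsub>mpoly_ring\<^esub> (set (take i gs))"
      then have "hs ! i \<otimes>\<^bsub>mpoly_ring\<^esub> (hs ! i \<otimes>\<^bsub>mpoly_ring\<^esub> r) \<in> Idl\<^bsub>mpoly_ring\<^esub> (set (take i gs))"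
        using i hs(1) by (simp add: gs_def mult.assoc)
      then show "r \<in> Idl\<^bsub>mpoly_ring\<^esub> (set (take i gs))" using P.regular_modD[OF r] by simp
    qed
  qed
  have "\<exists>h\<in>I. (\<exists>d>0. h \<in> mpoly_part d) \<and> (\<forall>r. h * r \<in> Q \<longrightarrow> r \<in> Q)"
  proof (rule homogeneous_nonzerodivisor[OF Q _ I(1) _ I(2)])
    show "hcomp d p \<in> Q" if "p \<in> Q" for p d by (rule homogeneous_ideal_hcomp[OF hQ that])
    show "hcomp d p \<in> I" if "p \<in> I" for p d by (rule homogeneous_ideal_hcomp[OF hI that])
    fix u assume u: "\<And>a. a \<in> I \<Longrightarrow> a * u \<in> Q"
    show "u \<in> Q"
      unfolding Q_def
      by (rule P.colon_regular_sequence[of fs])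
        (use fs u reg greg hs(1) Suc.prems in \<open>auto simp: gs_def Q_def\<close>)
  qed
  then obtain h where h: "h \<in> I" "\<exists>d>0. h \<in> mpoly_part d" "\<And>r. h * r \<in> Q \<Longrightarrow> r \<in> Q" by blast
  have "P.regular_mod (Idl\<^bsub>mpoly_ring\<^esub> ((\<lambda>h. h * h) ` set (take i (hs @ [h])))) ((hs @ [h]) ! i)"
    if "i < Suc n" for i
  proof (cases "i < n")
    case True
    then show ?thesis using hreg[OF True] hs(1) by (simp add: nth_append)
  next
    case False
    then have "i = n" using that by simp
    then show ?thesis using h(3) hs(1) by (simp add: P.regular_mod_def Q_def gs_def nth_append)
  qed
  then show ?case using h hs by (intro exI[of _ "hs @ [h]"]) auto
qed simp

theorem mpoly_ring_not_golod:
  fixes I :: "('v::finite, 'k::field) mpoly set"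
  assumes hI: "homogeneous_ideal mpoly_ring mpoly_part I" and proper: "I \<noteq> carrier mpoly_ring"
    and grade: "4 \<le> grade mpoly_ring I"
  shows "\<exists>J. homogeneous_ideal mpoly_ring mpoly_part J \<and> J \<subseteq> I \<and>
     \<not> golod_graded (mpoly_ring Quot (I \<cdot>\<^bsub>mpoly_ring\<^esub> J)) (quot_part mpoly_ring mpoly_part (I \<cdot>\<^bsub>mpoly_ring\<^esub> J))"
proof -
  let ?R = "mpoly_ring :: ('v, 'k) mpoly ring"
  interpret P: cring ?R by (rule cring_mpoly_ring)
  have I: "ideal I ?R"
    using hI P.genideal_ideal by (auto simp: homogeneous_ideal_def)
  then have iI: "is_ideal I" by (simp add: ideal_mpoly_ring_iff)
  have I1: "1 \<notin> I"
    using ideal.one_imp_carrier[OF I] proper by auto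
  have "enat 4 \<le> grade ?R I" using grade by (simp add: numeral_eq_enat)
  then obtain fs where fs: "length fs = 4" "set fs \<subseteq> I"
    "\<And>i. i < 4 \<Longrightarrow> P.regular_mod (Idl\<^bsub>?R\<^esub> (set (take i fs))) (fs ! i)"
    using P.grade_ge_regular_sequence[of 4 I] by auto
  obtain hs where hs: "length hs = 4" "set hs \<subseteq> I \<inter> (\<Union>d. mpoly_part d)"
    and hreg: "\<And>i. i < 4 \<Longrightarrow> P.regular_mod (Idl\<^bsub>?R\<^esub> ((\<lambda>h. h * h) ` set (take i hs))) (hs ! i)"
    using homogeneous_regular_sequence[OF hI iI I1 fs(2), of 4] fs(1,3) by auto
  define f where "f = (\<lambda>i. hs ! i)"
  have img: "(\<lambda>j. f j \<otimes>\<^bsub>?R\<^esub> f j) ` {..<i} = (\<lambda>h. h * h) ` set (take i hs)" if "i \<le> 4" for i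
    using that hs(1) by (force simp: f_def set_conv_nth)
  have fI: "f i \<in> I" "\<exists>d. f i \<in> mpoly_part d" if "i < 4" for i
  proof -
    have "hs ! i \<in> set hs" using that hs(1) by simp
    then show "f i \<in> I" "\<exists>d. f i \<in> mpoly_part d" using hs(2) unfolding f_def by blast+
  qed
  define S where "S = (\<lambda>j. f j \<otimes>\<^bsub>?R\<^esub> f j) ` {..<4::nat}"
  define J where "J = (Idl\<^bsub>?R\<^esub> S)"
  have "S \<subseteq> (\<Union>i. mpoly_part i)"
    using fI(2) mpoly_part_mult by (fastforce simp: S_def)
  then have hJ: "homogeneous_ideal ?R mpoly_part J" by (auto simp: homogeneous_ideal_def J_def)
  have J: "ideal J ?R" unfolding J_def by (rule P.genideal_ideal) simp
  have JI: "J \<subseteq> I"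
    unfolding J_def using fI(1) is_idealD(3)[OF iI]
    by (intro P.genideal_minimal[OF I]) (auto simp: S_def)
  define Q where "Q = I \<cdot>\<^bsub>?R\<^esub> J"
  have Q: "ideal Q ?R" unfolding Q_def by (rule P.ideal_prod_is_ideal[OF I J])
  have Ipos: "I \<subseteq> positive_ideal" by (rule proper_homogeneous_ideal_positive[OF hI iI I1])
  have Qpos: "Q \<subseteq> positive_ideal"
    using P.ideal_prod_inter[OF I J] Ipos by (auto simp: Q_def)
  have "\<not> golod_graded (?R Quot Q) (quot_part ?R mpoly_part Q)"
  proof
    assume "golod_graded (?R Quot Q) (quot_part ?R mpoly_part Q)"
    then obtain ys where ys: "minimal_generators (?R Quot Q) ((+>\<^bsub>?R\<^esub>) Q ` positive_ideal) ys"
      "set ys \<subseteq> (\<Union>i. quot_part ?R mpoly_part Q i)"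
      and adm: "admits_trivial_massey_operation (koszul (?R Quot Q) ys)"
      unfolding golod_graded_def irrelevant_ideal_quotient[OF Q] by blast
    \<comment> \<open>The lifts are taken homogeneous, so that they generate a homogeneous ideal;
      the graded Nakayama argument needs its components.\<close>
    have "\<forall>y\<in>set ys. \<exists>x\<in>(\<Union>i. mpoly_part i). Q +>\<^bsub>?R\<^esub> x = y"
      using ys(2) by (fastforce simp: quot_part_def)
    then obtain p where p: "\<And>y. y \<in> set ys \<Longrightarrow> p y \<in> (\<Union>i. mpoly_part i) \<and> Q +>\<^bsub>?R\<^esub> p y = y" by metis
    define xt where "xt = map p ys"
    have xt: "map ((+>\<^bsub>?R\<^esub>) Q) xt = ys" "set xt \<subseteq> (\<Union>i. mpoly_part i)"
      using p by (auto simp: xt_def map_idI)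
    define N where "N = (Idl\<^bsub>?R\<^esub> (set xt))"
    have N: "is_ideal N" unfolding N_def ideal_mpoly_ring_iff[symmetric] by (rule P.genideal_ideal) simp
    have hN: "homogeneous_ideal ?R mpoly_part N"
      using xt(2) by (auto simp: homogeneous_ideal_def N_def)
    have gen: "(Idl\<^bsub>?R Quot Q\<^esub> (set (map ((+>\<^bsub>?R\<^esub>) Q) xt))) = (+>\<^bsub>?R\<^esub>) Q ` positive_ideal"
      using ys(1) unfolding xt(1) minimal_generators_def by blast
    have pos: "ideal positive_ideal ?R" by (simp add: ideal_mpoly_ring_iff is_ideal_positive)
    have xtc: "set xt \<subseteq> carrier ?R" by simp
    note quo = P.quotient_generators[OF Q pos Qpos xtc gen, folded N_def]
    have posN: "positive_ideal \<subseteq> N"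
    proof (rule graded_nakayama[OF N _ Ipos, where J = J])
      show "hcomp d p \<in> N" if "p \<in> N" for p d by (rule homogeneous_ideal_hcomp[OF hN that])
      show "J \<subseteq> positive_ideal" using JI Ipos by blast
      show "\<exists>x\<in>N. \<exists>q\<in>I \<cdot>\<^bsub>?R\<^esub> J. p = x + q" if "p \<in> positive_ideal" for p
        using quo(2)[OF that] by (simp add: Q_def)
    qed
    have "\<not> admits_trivial_massey_operation (koszul (?R Quot Q) (map ((+>\<^bsub>?R\<^esub>) Q) xt))"
      unfolding Q_def J_def S_def
    proof (rule P.koszul_quotient_no_massey[OF I xtc])
      show "\<one>\<^bsub>?R\<^esub> \<notin> Idl\<^bsub>?R\<^esub> (set xt)"
        using quo(1) one_notin_positive_ideal by (auto simp: N_def)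
      show "f i \<in> I" "f i \<in> Idl\<^bsub>?R\<^esub> (set xt)" if "i < 4" for i
        using fI(1)[OF that] Ipos posN by (auto simp: N_def)
      fix i r assume i: "i < (4::nat)"
        and mem: "(f i \<otimes>\<^bsub>?R\<^esub> f i) \<otimes>\<^bsub>?R\<^esub> r \<in> Idl\<^bsub>?R\<^esub> ((\<lambda>j. f j \<otimes>\<^bsub>?R\<^esub> f j) ` {..<i})"
      \<comment> \<open>This gives regularity of f_i itself modulo the earlier squares; cancelling
        f_i twice gives that of f_i^2.\<close>
      note r = P.regular_modD[OF hreg[OF i, folded img[OF less_imp_le[OF i]] f_def]]
      have "f i \<otimes>\<^bsub>?R\<^esub> (f i \<otimes>\<^bsub>?R\<^esub> r) \<in> Idl\<^bsub>?R\<^esub> ((\<lambda>j. f j \<otimes>\<^bsub>?R\<^esub> f j) ` {..<i})"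
        using mem by (simp add: mult.assoc)
      then show "r \<in> Idl\<^bsub>?R\<^esub> ((\<lambda>j. f j \<otimes>\<^bsub>?R\<^esub> f j) ` {..<i})"
        using r[of r] r[of "f i \<otimes>\<^bsub>?R\<^esub> r"] by (simp add: f_def)
    qed
    then show False using adm unfolding xt(1) by blast
  qed
  then show ?thesis using hJ JI unfolding Q_def by blast
qed

theorem mainTheorem3:
  fixes R :: "('a, 'm) ring_scheme" and \<mm> I :: "'a set"
    and I' :: "(('v::finite \<Rightarrow>\<^sub>0 nat) \<Rightarrow>\<^sub>0 'k::field) set"
  shows "(regular_local_ring R \<mm> \<and> ideal I R \<and> I \<noteq> carrier R \<and> 4 \<le> grade R I \<longrightarrow>
            (\<exists>J. ideal J R \<and> J \<subseteq> I \<and>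
               \<not> golod_local (R Quot (I \<cdot>\<^bsub>R\<^esub> J)) ((\<lambda>r. (I \<cdot>\<^bsub>R\<^esub> J) +>\<^bsub>R\<^esub> r) ` \<mm>)))
       \<and> (homogeneous_ideal mpoly_ring mpoly_part I' \<and> I' \<noteq> carrier mpoly_ring
            \<and> 4 \<le> grade mpoly_ring I' \<longrightarrow>
            (\<exists>J. homogeneous_ideal mpoly_ring mpoly_part J \<and> J \<subseteq> I' \<and>
               \<not> golod_graded (mpoly_ring Quot (I' \<cdot>\<^bsub>mpoly_ring\<^esub> J))
                   (quot_part mpoly_ring mpoly_part (I' \<cdot>\<^bsub>mpoly_ring\<^esub> J))))"
  using local_ring_not_golod[of R \<mm> I] mpoly_ring_not_golod[of I']
  unfolding regular_local_ring_def by blast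

end
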